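(* There is a universal constant $c>0$ such that the following holds. Let $0<\varepsilon<1$, $2\le s\le2^{d+1}$, $\lambda>0$, $H>0$, and let $\boldsymbol v\in\mathbb R^m$ with $v_i\ge1$ for all $i\in[m]$. Let $\Lambda=\Lambda^{\mathrm{HC}}_{d,s}$ be the hyperbolic cross and let $\{\phi_{\boldsymbol i}\}_{\boldsymbol i\in\mathbb N_0^d}$ be the tensor Legendre or tensor Chebyshev polynomial basis. Let $0<\delta<1$ be such that $$\delta\le\frac1{1+4\Theta},\qquad\Theta=\frac{\sqrt{K(s)+\lambda^2H}}{\min\{\sqrt{K(s)},\lambda\sqrt H\}}.$$ Draw $\boldsymbol t_1,\dots,\boldsymbol t_m$ independently according to the corresponding measure $\nu$, with $$m\ \ge\ c\,s^{\gamma}\max\{L(s,n,\delta,\varepsilon),\ \delta^{-2}H\}.$$ Then, with probability at least $1-\varepsilon$, the following holds. For every $f\in L^2_\nu(D)\cap L^\infty(D)$ with coefficient sequence $\boldsymbol x$, and data $\boldsymbol y=\boldsymbol A\boldsymbol x_\Lambda+\boldsymbol e$ with unknown error $\boldsymbol e\in\mathbb C^m$, the approximation $\tilde f=\sum_{\boldsymbol i\in\Lambda}\hat x_{\boldsymbol i}\phi_{\boldsymbol i}$ computed from a minimizer (weighted LAD-LASSO) $$\hat{\boldsymbol x}_\Lambda\in\arg\min_{\boldsymbol z\in\mathbb C^n}\|\boldsymbol z\|_{1,\boldsymbol u}+\lambda\|\boldsymbol A\boldsymbol z-\boldsymbol y\|_{1,\boldsymbol v}$$ satisfies $$\|f-\tilde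 f\|_{L^\infty}+\lambda\|\boldsymbol e-(\boldsymbol y-\boldsymbol A\hat{\boldsymbol x}_\Lambda)\|_{1,\boldsymbol v}\le C_1\big(\sigma_{s,L}(\boldsymbol x)_{1,\boldsymbol u}+\lambda\,\sigma_H(\boldsymbol e)_{1,\boldsymbol v}\big)$$ and, additionally assuming $H\ge2\|\boldsymbol v\|_\infty^2$, $$\|f-\tilde f\|_{L^2_\nu}+\|\boldsymbol e-(\boldsymbol y-\boldsymbol A\hat{\boldsymbol x}_\Lambda)\|_2\le C_2\,(1+\sqrt\Theta)\left(\frac{\sigma_{s,L}(\boldsymbol x)_{1,\boldsymbol u}}{s^{\gamma/2}}+\frac{\sigma_H(\boldsymbol e)_{1,\boldsymbol v}}{\sqrt H}\right)+\|f-f_\Lambda\|_{L^2_\nu},$$ where $$C_1=\frac{3+\rho}{1-\rho},\qquad C_2=\frac{4\sqrt2\,(1+\rho)\max\{\rho,2\sqrt\rho\}}{1-\rho},\qquad\rho=\frac{4\delta}{1-\delta}.$$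
   Context: Setting. $d\in\mathbb N$, $D=(-1,1)^d$, $\mathbb N_0=\{0,1,2,\dots\}$, $[m]=\{1,\dots,m\}$. The measure $\nu$ on $D$ is the tensor uniform probability measure $d\nu=2^{-d}d\boldsymbol t$ (Legendre case) or the tensor Chebyshev measure $d\nu=\prod_{\ell=1}^d\frac{1}{\pi\sqrt{1-t_\ell^2}}d\boldsymbol t$ (Chebyshev case). $\{\phi_{\boldsymbol i}\}_{\boldsymbol i\in\mathbb N_0^d}$ is the tensor product of the corresponding univariate orthonormal polynomials; it is an orthonormal basis of $L^2_\nu(D)$. For $f\in L^2_\nu(D)\cap L^\infty(D)$ (complex valued), $\boldsymbol x=(x_{\boldsymbol i})_{\boldsymbol i\in\mathbb N_0^d}$ with $x_{\boldsymbol i}=\langle f,\phi_{\boldsymbol i}\rangle_{L^2_\nu}$, so $f=\sum_{\boldsymbol i}x_{\boldsymbol i}\phi_{\boldsymbol i}$. Weights: $u_{\boldsymbol i}=\|\phi_{\boldsymbol i}\|_{L^\infty}$, i.e. $u_{\boldsymbol i}=\prod_{\ell=1}^d\sqrt{2i_\ell+1}$ (Legendre) and $u_{\boldsymbol i}=2^{\|\boldsymbol i\|_0/2}$ (Chebyshev, $\|\boldsymbol i\|_0$ the number of nonzero entries). For weights $\boldsymbol w$: $\|\boldsymbol z\|_{1,\boldsymbol w}=\sum_iw_i|z_i|$ and $|S|_{\boldsymbol w}=\sum_{i\in S}w_i^2$. A set $S\subseteq\mathbb N_0^d$ is lower if $\boldsymbol i\in S$ and $\boldsymbol j\le\boldsymbol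 i$ componentwise imply $\boldsymbol j\in S$. $\sigma_{s,L}(\boldsymbol z)_{1,\boldsymbol u}=\inf\{\|\boldsymbol z-\boldsymbol z'\|_{1,\boldsymbol u}:|\mathrm{supp}(\boldsymbol z')|\le s,\ \mathrm{supp}(\boldsymbol z')\text{ lower}\}$ (possibly $+\infty$). For $\boldsymbol e\in\mathbb C^m$, $\sigma_H(\boldsymbol e)_{1,\boldsymbol v}=\inf\{\|\boldsymbol e-\boldsymbol e'\|_{1,\boldsymbol v}:\boldsymbol e'\in\mathbb C^m,\ |\mathrm{supp}(\boldsymbol e')|_{\boldsymbol v}\le H\}$. $K(s)=\max\{|S|_{\boldsymbol u}:S\subseteq\mathbb N_0^d\text{ lower},\ |S|\le s\}$. $\gamma=2$ (Legendre), $\gamma=\ln 3/\ln 2$ (Chebyshev). Hyperbolic cross: $\Lambda^{\mathrm{HC}}_{d,s}=\{\boldsymbol i\in\mathbb N_0^d:\prod_{\ell=1}^d(i_\ell+1)\le s\}$, $n=|\Lambda|$, with a fixed enumeration $\boldsymbol i_1,\dots,\boldsymbol i_n$ of $\Lambda$. Vectors in $\mathbb C^n$ are indexed by $\Lambda$ and identified with sequences on $\mathbb N_0^d$ vanishing off $\Lambda$. $\boldsymbol x_\Lambda=(x_{\boldsymbol i})_{\boldsymbol i\in\Lambda}$ and $f_\Lambda=\sum_{\boldsymbol i\in\Lambda}x_{\boldsymbol i}\phi_{\boldsymbol i}$. Design matrix: $\boldsymbol A\in\mathbb C^{m\times n}$, $A_{ij}=\frac1{\sqrt m}\phi_{\boldsymbol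 i_j}(\boldsymbol t_i)$. The data are $\boldsymbol y=\boldsymbol A\boldsymbol x_\Lambda+\boldsymbol e$, where the unknown error $\boldsymbol e$ contains the truncation error $\frac{1}{\sqrt m}(f(\boldsymbol t_i)-f_\Lambda(\boldsymbol t_i))_{i}$ and possibly any further error. Polylogarithmic factor: $$L(s,n,\delta,\varepsilon)=\frac1{\delta^2}\ln\Big(\frac{K(s)}{\delta^2}\Big)\max\Big\{\frac1{\delta^4}\ln\Big(\frac{K(s)}{\delta^2}\ln\Big(\frac{K(s)}{\delta^2}\Big)\Big)\ln(n),\ \frac1\delta\ln\Big(\frac1{\delta\varepsilon}\ln\Big(\frac{K(s)}{\delta^2}\Big)\Big)\Big\}.$$ *)

theory Defs
  imports "HOL-Probability.Probability" "HOL-Computational_Algebra.Polynomial"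
begin

datatype poly_basis = Legendre | Chebyshev

text \<open>The univariate measures live on the open interval, so that the space of their \<open>d\<close>-fold product
  is exactly the cube \<open>D = (-1,1)^d\<close>, as a set of extensional functions on \<open>{..<d}\<close>.\<close>

fun density1 :: "poly_basis \<Rightarrow> real \<Rightarrow> real" where
  "density1 Legendre t = 1 / 2"
| "density1 Chebyshev t = 1 / (pi * sqrt (1 - t\<^sup>2))"

definition nu1 :: "poly_basis \<Rightarrow> real measure" where
  "nu1 B = density (restrict_space lborel {-1<..<1}) (\<lambda>t. ennreal (density1 B t))"

definition nu :: "poly_basis \<Rightarrow> nat \<Rightarrow> (nat \<Rightarrow> real) measure" where
  "nu B d = (\<Pi>\<^sub>M l\<in>{..<d}. nu1 B)"

definition orthonormal_polys :: "real measure \<Rightarrow> (nat \<Rightarrow> real poly) \<Rightarrow> bool" where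
  "orthonormal_polys \<mu> p \<longleftrightarrow>
     (\<forall>k. degree (p k) = k \<and> 0 < lead_coeff (p k)) \<and>
     (\<forall>j k. (LINT t|\<mu>. poly (p j) t * poly (p k) t) = (if j = k then 1 else 0))"

text \<open>Orthonormal polynomials are determined up to sign; the leading coefficient is taken positive.
  Existence and uniqueness for the two measures is shown in \<open>ex1_orthonormal_polys_nu1\<close> below.\<close>

definition phi1 :: "poly_basis \<Rightarrow> nat \<Rightarrow> real \<Rightarrow> real" where
  "phi1 B k = poly ((THE p. orthonormal_polys (nu1 B) p) k)"

text \<open>Multi-indices in dimension \<open>d\<close> are functions on \<open>nat\<close> that vanish outside \<open>{..<d}\<close>; the
  componentwise order is then the order on functions.\<close>

type_synonym mindex = "nat \<Rightarrow> nat"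

definition mindices :: "nat \<Rightarrow> mindex set" where
  "mindices d = {i. \<forall>l\<ge>d. i l = 0}"

definition phi :: "poly_basis \<Rightarrow> nat \<Rightarrow> mindex \<Rightarrow> (nat \<Rightarrow> real) \<Rightarrow> complex" where
  "phi B d i t = complex_of_real (\<Prod>l<d. phi1 B (i l) (t l))"

definition Linf_norm :: "'a measure \<Rightarrow> ('a \<Rightarrow> complex) \<Rightarrow> ennreal" where
  "Linf_norm M f = esssup M (\<lambda>t. ennreal (cmod (f t)))"

definition in_Linf :: "'a measure \<Rightarrow> ('a \<Rightarrow> complex) \<Rightarrow> bool" where
  "in_Linf M f \<longleftrightarrow> f \<in> borel_measurable M \<and> Linf_norm M f < \<infinity>"

definition in_L2 :: "'a measure \<Rightarrow> ('a \<Rightarrow> complex) \<Rightarrow> bool" where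
  "in_L2 M f \<longleftrightarrow> f \<in> borel_measurable M \<and> integrable M (\<lambda>t. (cmod (f t))\<^sup>2)"

definition L2_norm :: "'a measure \<Rightarrow> ('a \<Rightarrow> complex) \<Rightarrow> real" where
  "L2_norm M f = sqrt (LINT t|M. (cmod (f t))\<^sup>2)"

definition coeffs_of :: "poly_basis \<Rightarrow> nat \<Rightarrow> ((nat \<Rightarrow> real) \<Rightarrow> complex) \<Rightarrow> mindex \<Rightarrow> complex" where
  "coeffs_of B d f i = (LINT t|nu B d. f t * cnj (phi B d i t))"

definition uweight :: "poly_basis \<Rightarrow> nat \<Rightarrow> mindex \<Rightarrow> real" where
  "uweight B d i = enn2real (Linf_norm (nu B d) (phi B d i))"

definition wnorm1 :: "'i set \<Rightarrow> ('i \<Rightarrow> real) \<Rightarrow> ('i \<Rightarrow> complex) \<Rightarrow> real" where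
  "wnorm1 I w z = (\<Sum>i\<in>I. w i * cmod (z i))"

definition wcard :: "('i \<Rightarrow> real) \<Rightarrow> 'i set \<Rightarrow> real" where
  "wcard w S = (\<Sum>i\<in>S. (w i)\<^sup>2)"

definition supp :: "('i \<Rightarrow> complex) \<Rightarrow> 'i set" where
  "supp z = {i. z i \<noteq> 0}"

definition lower_set :: "nat \<Rightarrow> mindex set \<Rightarrow> bool" where
  "lower_set d S \<longleftrightarrow> S \<subseteq> mindices d \<and> (\<forall>i\<in>S. \<forall>j\<in>mindices d. j \<le> i \<longrightarrow> j \<in> S)"

text \<open>Sequences on multi-indices need not be weighted summable, so this error takes values in
  \<open>[0,\<infinity>]\<close>.\<close>

definition sigma_L :: "poly_basis \<Rightarrow> nat \<Rightarrow> nat \<Rightarrow> (mindex \<Rightarrow> complex) \<Rightarrow> ennreal" where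
  "sigma_L B d s z =
     (INF z' \<in> {z'. finite (supp z') \<and> card (supp z') \<le> s \<and> lower_set d (supp z')}.
        (\<Sum>\<^sub>\<infinity>i\<in>mindices d. ennreal (uweight B d i * cmod (z i - z' i))))"

text \<open>Vectors indexed by \<open>[m]\<close> are functions on \<open>nat\<close> of which only the values on \<open>{..<m}\<close> matter.\<close>

definition sigma_H :: "nat \<Rightarrow> (nat \<Rightarrow> real) \<Rightarrow> real \<Rightarrow> (nat \<Rightarrow> complex) \<Rightarrow> real" where
  "sigma_H m v H e =
     (INF e' \<in> {e'. wcard v (supp e' \<inter> {..<m}) \<le> H}. wnorm1 {..<m} v (\<lambda>i. e i - e' i))"

definition Kfun :: "poly_basis \<Rightarrow> nat \<Rightarrow> nat \<Rightarrow> real" where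
  "Kfun B d s = Max {wcard (uweight B d) S |S. lower_set d S \<and> finite S \<and> card S \<le> s}"

fun gam :: "poly_basis \<Rightarrow> real" where
  "gam Legendre = 2"
| "gam Chebyshev = ln 3 / ln 2"

definition hyp_cross :: "nat \<Rightarrow> nat \<Rightarrow> mindex set" where
  "hyp_cross d s = {i \<in> mindices d. (\<Prod>l<d. i l + 1) \<le> s}"

text \<open>The design matrix has its columns indexed by the multi-indices in \<open>\<Lambda>\<close> themselves instead of by
  their position in an enumeration. The sample \<open>t\<close> consists of the points \<open>t 0, \<dots>, t (m - 1)\<close>.\<close>

definition design :: "poly_basis \<Rightarrow> nat \<Rightarrow> nat \<Rightarrow> (nat \<Rightarrow> nat \<Rightarrow> real) \<Rightarrow> nat \<Rightarrow> mindex \<Rightarrow> complex" where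
  "design B d m t i j = complex_of_real (1 / sqrt (real m)) * phi B d j (t i)"

definition mat_apply :: "('r \<Rightarrow> 'c \<Rightarrow> complex) \<Rightarrow> 'c set \<Rightarrow> ('c \<Rightarrow> complex) \<Rightarrow> 'r \<Rightarrow> complex" where
  "mat_apply A J z i = (\<Sum>j\<in>J. A i j * z j)"

definition expansion :: "poly_basis \<Rightarrow> nat \<Rightarrow> mindex set \<Rightarrow> (mindex \<Rightarrow> complex) \<Rightarrow> (nat \<Rightarrow> real) \<Rightarrow> complex" where
  "expansion B d \<Lambda> z t = (\<Sum>i\<in>\<Lambda>. z i * phi B d i t)"

definition restrict_to :: "'i set \<Rightarrow> ('i \<Rightarrow> complex) \<Rightarrow> 'i \<Rightarrow> complex" where
  "restrict_to \<Lambda> z i = (if i \<in> \<Lambda> then z i else 0)"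

definition polylog :: "real \<Rightarrow> nat \<Rightarrow> real \<Rightarrow> real \<Rightarrow> real" where
  "polylog K n \<delta> \<epsilon> =
     1 / \<delta>\<^sup>2 * ln (K / \<delta>\<^sup>2) *
       max (1 / \<delta> ^ 4 * ln (K / \<delta>\<^sup>2 * ln (K / \<delta>\<^sup>2)) * ln (real n))
           (1 / \<delta> * ln (1 / (\<delta> * \<epsilon>) * ln (K / \<delta>\<^sup>2)))"

definition Theta :: "real \<Rightarrow> real \<Rightarrow> real \<Rightarrow> real" where
  "Theta K lam H = sqrt (K + lam\<^sup>2 * H) / min (sqrt K) (lam * sqrt H)"

definition rho :: "real \<Rightarrow> real" where
  "rho \<delta> = 4 * \<delta> / (1 - \<delta>)"

definition C1 :: "real \<Rightarrow> real" where
  "C1 \<delta> = (3 + rho \<delta>) / (1 - rho \<delta>)"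

definition C2 :: "real \<Rightarrow> real" where
  "C2 \<delta> = 4 * sqrt 2 * (1 + rho \<delta>) * max (rho \<delta>) (2 * sqrt (rho \<delta>)) / (1 - rho \<delta>)"

definition lad_lasso_minimizer ::
  "poly_basis \<Rightarrow> nat \<Rightarrow> mindex set \<Rightarrow> nat \<Rightarrow> (nat \<Rightarrow> real) \<Rightarrow> real \<Rightarrow> (nat \<Rightarrow> nat \<Rightarrow> real) \<Rightarrow>
   (nat \<Rightarrow> complex) \<Rightarrow> (mindex \<Rightarrow> complex) \<Rightarrow> bool" where
  "lad_lasso_minimizer B d \<Lambda> m v lam t y xh \<longleftrightarrow>
     is_arg_min
       (\<lambda>z. wnorm1 \<Lambda> (uweight B d) z +
            lam * wnorm1 {..<m} v (\<lambda>i. mat_apply (design B d m t) \<Lambda> z i - y i))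
       (\<lambda>z. supp z \<subseteq> \<Lambda>) xh"

lemma ex1_orthonormal_polys:
  fixes \<mu> :: "real measure"
  assumes int: "\<And>p. integrable \<mu> (poly p)"
    and pos: "\<And>p. p \<noteq> 0 \<Longrightarrow> 0 < (LINT t|\<mu>. poly p t * poly p t)"
  shows "\<exists>!p. orthonormal_polys \<mu> p"
proof -
  define ip where "ip p q = (LINT t|\<mu>. poly p t * poly q t)" for p q
  have int2: "integrable \<mu> (\<lambda>t. poly p t * poly q t)" for p q
    using int[of "p * q"] by (simp add: poly_mult[abs_def])
  have ip_add: "ip (p + r) q = ip p q + ip r q" for p q r
    using int2 by (simp add: ip_def distrib_right)
  have ip_diff: "ip (p - r) q = ip p q - ip r q" for p q r
    using int2 by (simp add: ip_def left_diff_distrib)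
  have ip_smult: "ip (smult c p) q = c * ip p q" for c p q
    by (simp add: ip_def mult.assoc)
  have ip_comm: "ip p q = ip q p" for p q
    by (simp add: ip_def mult.commute)
  have ip_0: "ip 0 q = 0" for q
    by (simp add: ip_def)
  have ip_sum: "ip (\<Sum>i\<in>A. g i) q = (\<Sum>i\<in>A. ip (g i) q)" if "finite A" for A :: "nat set" and g q
    using that by (induction rule: finite_induct) (auto simp: ip_add ip_0)
  have ip_pos: "0 < ip p p" if "p \<noteq> 0" for p
    using pos[OF that] by (simp add: ip_def)
  have on: "orthonormal_polys \<mu> p \<longleftrightarrow> (\<forall>k. degree (p k) = k \<and> 0 < lead_coeff (p k)) \<and>
      (\<forall>j k. ip (p j) (p k) = (if j = k then 1 else 0))" for p
    by (simp add: orthonormal_polys_def ip_def)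

  define P where "P f k r \<longleftrightarrow> degree r = k \<and> 0 < lead_coeff r \<and> (\<forall>j<k. ip r (f j) = 0) \<and> ip r r = 1"
    for f :: "nat \<Rightarrow> real poly" and k r
  have "\<exists>f. \<forall>k. P f k (f k)"
  proof (rule dependent_wellorder_choice)
    fix r :: "real poly" and f g :: "nat \<Rightarrow> real poly" and k :: nat
    assume "\<And>y. y < k \<Longrightarrow> f y = g y" then show "P f k r = P g k r"
      by (simp add: P_def)
  next
    fix k :: nat and f :: "nat \<Rightarrow> real poly" assume IH: "\<And>y. y < k \<Longrightarrow> P f y (f y)"
    define h where "h = (\<Sum>i<k. smult (ip (monom 1 k) (f i)) (f i))"
    define q where "q = monom 1 k - h"
    have fdeg: "coeff (f i) n = 0" if "i < k" "k \<le> n" for i n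
      using IH[OF that(1)] that by (intro coeff_eq_0) (simp add: P_def)
    have hn: "coeff h n = 0" if "k \<le> n" for n
      using fdeg that by (simp add: h_def coeff_sum)
    have qk: "coeff q k = 1" by (simp add: q_def hn)
    have qn: "coeff q n = 0" if "k < n" for n
      using that by (simp add: q_def hn)
    have degq: "degree q = k"
      by (intro antisym degree_le le_degree) (auto simp: qn qk)
    have fo: "ip (f i) (f j) = (if i = j then 1 else 0)" if "i < k" "j < k" for i j
      using IH[OF that(1)] IH[OF that(2)] ip_comm[of "f i" "f j"]
      by (cases i j rule: linorder_cases) (auto simp: P_def)
    have qo: "ip q (f j) = 0" if "j < k" for j
    proof -
      have "ip h (f j) = (\<Sum>i<k. ip (monom 1 k) (f i) * (if i = j then 1 else 0))"
        unfolding h_def using that by (simp add: ip_sum ip_smult fo)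
      also have "\<dots> = ip (monom 1 k) (f j)"
        using that by (simp add: if_distrib[where f = "\<lambda>x. _ * x"] cong: if_cong)
      finally show ?thesis by (simp add: q_def ip_diff)
    qed
    have "q \<noteq> 0" using qk by auto
    then have q0: "0 < ip q q" by (rule ip_pos)
    define c where "c = 1 / sqrt (ip q q)"
    have c: "0 < c" "c * (c * ip q q) = 1"
      using q0 by (simp_all add: c_def)
    have "P f k (smult c q)"
      using c degq qk qo ip_comm[of q "smult c q"] by (simp add: P_def ip_smult)
    then show "\<exists>r. P f k r" by blast
  qed
  then obtain f where f: "\<And>k. P f k (f k)" by blast
  have ex: "orthonormal_polys \<mu> f"
    unfolding on
  proof (intro conjI allI)
    fix k show "degree (f k) = k" "0 < lead_coeff (f k)"
      using f[of k] unfolding P_def by blast+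
  next
    fix j k show "ip (f j) (f k) = (if j = k then 1 else 0)"
      using f[of j] f[of k] ip_comm[of "f j" "f k"]
      by (cases j k rule: linorder_cases) (auto simp: P_def)
  qed

  have orth: "ip (p k) q = 0" if p: "orthonormal_polys \<mu> p" and "q = 0 \<or> degree q < k" for p k q
    using that(2)
  proof (induction "degree q" arbitrary: q rule: less_induct)
    case less
    show ?case
    proof (cases "q = 0")
      case True then show ?thesis using ip_0 ip_comm by metis
    next
      case False
      define n where "n = degree q"
      have n: "n < k" using False less.prems by (simp add: n_def)
      have pn: "degree (p n) = n" "lead_coeff (p n) > 0" "ip (p k) (p n) = 0"
        using p n unfolding on by (blast, blast, auto)
      define c where "c = lead_coeff q / lead_coeff (p n)"
      define r where "r = q - smult c (p n)"
      have rn: "coeff r n = 0" using pn by (simp add: r_def c_def n_def)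
      have rb: "coeff r i = 0" if "n < i" for i
        using that pn by (simp add: r_def coeff_eq_0 n_def)
      have r: "r = 0 \<or> degree r < n"
        by (metis leading_coeff_0_iff linorder_neqE_nat rn rb)
      have "ip (p k) r = 0"
      proof (cases "r = 0")
        case True then show ?thesis using ip_0 ip_comm by metis
      next
        case False then show ?thesis using less.hyps[of r] r n by (simp add: n_def)
      qed
      moreover have "q = r + smult c (p n)" by (simp add: r_def)
      ultimately show ?thesis
        using pn ip_comm by (metis add.right_neutral ip_add ip_smult mult_zero_right)
    qed
  qed
  have uniq: "p = p'" if p: "orthonormal_polys \<mu> p" and p': "orthonormal_polys \<mu> p'" for p p'
  proof
    fix k
    have a: "degree (p k) = k" "coeff (p k) k > 0" "ip (p k) (p k) = 1"
      "degree (p' k) = k" "coeff (p' k) k > 0" "ip (p' k) (p' k) = 1"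
      using p p' unfolding on by (metis (full_types))+
    define c where "c = coeff (p k) k / coeff (p' k) k"
    define r where "r = p k - smult c (p' k)"
    have c: "c > 0" using a by (simp add: c_def)
    have rn: "coeff r k = 0" using a by (simp add: r_def c_def)
    have rb: "coeff r i = 0" if "k < i" for i
      using that a by (simp add: r_def coeff_eq_0)
    have "r = 0 \<or> degree r < k"
      by (metis leading_coeff_0_iff linorder_neqE_nat rn rb)
    then have "ip (p k) r = 0" "ip (p' k) r = 0" using orth p p' by blast+
    then have "ip r r = 0" by (subst (1) r_def) (simp add: ip_diff ip_smult)
    then have "r = 0" using ip_pos[of r] by auto
    then have e: "p k = smult c (p' k)" by (simp add: r_def)
    then have "ip (p k) (p k) = c * (c * ip (p' k) (p' k))"
      using ip_comm by (metis ip_smult)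
    then have "c * c = 1" using a by simp
    then have "c = 1" using c by (simp add: square_eq_1_iff)
    then show "p k = p' k" using e by simp
  qed
  show ?thesis using ex uniq by blast
qed

lemma density1_pos: "-1 < t \<Longrightarrow> t < 1 \<Longrightarrow> 0 < density1 B t"
proof -
  assume "-1 < t" "t < 1"
  then have "t\<^sup>2 < 1" by (simp add: abs_square_less_1)
  then show ?thesis by (cases B) auto
qed

lemma density1_measurable [measurable]: "density1 B \<in> borel_measurable borel"
proof (cases B)
  case Legendre
  then have "density1 B = (\<lambda>t. 1 / 2)" by (intro ext) simp
  then show ?thesis by simp
next
  case Chebyshev
  then have "density1 B = (\<lambda>t. 1 / (pi * sqrt (1 - t\<^sup>2)))" by (intro ext) simp
  then show ?thesis by simp
qed

lemma density1_integral:
  "set_integrable lborel {-1<..<1} (density1 B)"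
  "set_lebesgue_integral lborel {-1<..<1} (density1 B) = 1"
proof -
  define F where "F = (case B of Legendre \<Rightarrow> (\<lambda>t::real. t / 2) | Chebyshev \<Rightarrow> (\<lambda>t. arcsin t / pi))"
  have 1: "DERIV F x :> density1 B x" if "-1 < x" "x < 1" for x
    using that by (cases B) (auto simp: F_def intro!: derivative_eq_intros simp: field_simps)
  have 2: "isCont (density1 B) x" if "-1 < x" "x < 1" for x
  proof (cases B)
    case Legendre
    then have "density1 B = (\<lambda>t. 1 / 2)" by (intro ext) simp
    then show ?thesis by simp
  next
    case Chebyshev
    then have e: "density1 B = (\<lambda>t. 1 / (pi * sqrt (1 - t\<^sup>2)))" by (intro ext) simp
    have "x\<^sup>2 < 1" using that by (simp add: abs_square_less_1)
    then show ?thesis unfolding e by (intro continuous_intros) auto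
  qed
  have c: "continuous_on {-1..1} F"
    by (cases B) (auto simp: F_def intro!: continuous_intros)
  have l: "(F \<longlongrightarrow> F (-1)) (at_right (-1))"
    using c by (metis continuous_on_Icc_at_rightD less_minus_one_simps(3) one_less_numeral_iff zero_less_one less_trans minus_less_iff neg_less_0_iff_less)
  have r: "(F \<longlongrightarrow> F 1) (at_left 1)"
    using c by (intro continuous_on_Icc_at_leftD[of "-1" 1]) auto
  have l': "((F \<circ> real_of_ereal) \<longlongrightarrow> F (-1)) (at_right (-1))"
    and r': "((F \<circ> real_of_ereal) \<longlongrightarrow> F 1) (at_left 1)"
    using l r ereal_tendsto_simps1(2)[of F "F (-1)" "-1"] ereal_tendsto_simps1(1)[of F "F 1" 1]
    by (simp_all add: one_ereal_def)
  have nonneg: "AE x in lborel. - 1 < ereal x \<longrightarrow> ereal x < 1 \<longrightarrow> 0 \<le> density1 B x"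
    by (intro AE_I2) (auto simp: one_ereal_def less_imp_le density1_pos)
  have "set_integrable lborel (einterval (-1) 1) (density1 B)"
    by (rule interval_integral_FTC_nonneg(1)[OF _ _ _ nonneg l' r'])
      (use 1 2 in \<open>auto simp: one_ereal_def\<close>)
  moreover have "(LBINT x=-1..1. density1 B x) = F 1 - F (-1)"
    by (rule interval_integral_FTC_nonneg(2)[OF _ _ _ nonneg l' r'])
      (use 1 2 in \<open>auto simp: one_ereal_def\<close>)
  moreover have "einterval (-1) 1 = {-1<..<1}" by (auto simp: einterval_def one_ereal_def)
  moreover have "F 1 - F (-1) = 1" by (cases B) (simp_all add: F_def)
  ultimately show "set_integrable lborel {-1<..<1} (density1 B)"
    "set_lebesgue_integral lborel {-1<..<1} (density1 B) = 1"
    by (simp_all add: interval_lebesgue_integral_def one_ereal_def)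
qed

lemma space_nu1: "space (nu1 B) = {-1<..<1}"
  by (simp add: nu1_def space_restrict_space)

lemma prob_space_nu1: "prob_space (nu1 B)"
proof
  have "emeasure (nu1 B) (space (nu1 B)) =
      (\<integral>\<^sup>+t. ennreal (density1 B t) \<partial>restrict_space lborel {-1<..<1})"
    unfolding nu1_def by (subst emeasure_density) 
      (auto intro!: nn_integral_cong simp: indicator_def sets_restrict_space space_restrict_space
        intro: measurable_restrict_space1)
  also have "\<dots> = (\<integral>\<^sup>+t. ennreal (indicator {-1<..<1} t * density1 B t) \<partial>lborel)"
    by (subst nn_integral_restrict_space) (auto intro!: nn_integral_cong simp: indicator_def)
  also have "\<dots> = ennreal 1"
    using density1_integral[of B] density1_pos[of _ B]
    by (subst nn_integral_eq_integral)
      (auto simp: set_integrable_def set_lebesgue_integral_def indicator_def less_imp_le)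
  finally show "emeasure (nu1 B) (space (nu1 B)) = 1" by simp
qed

lemma ex1_orthonormal_polys_nu1: "\<exists>!p. orthonormal_polys (nu1 B) p"
proof (rule ex1_orthonormal_polys)
  interpret prob_space "nu1 B" by (rule prob_space_nu1)
  have sets: "sets (nu1 B) = sets (restrict_space borel {-1<..<1})"
    by (simp add: nu1_def cong: sets_restrict_space_cong)
  have meas: "poly p \<in> borel_measurable (nu1 B)" for p :: "real poly"
    by (subst measurable_cong_sets[OF sets refl]) 
      (intro measurable_restrict_space1 borel_measurable_continuous_onI continuous_intros)
  show int: "integrable (nu1 B) (poly p)" for p
  proof -
    have "compact (poly p ` {-1..1})" by (intro compact_continuous_image continuous_intros) auto
    then obtain C where "\<forall>x\<in>poly p ` {-1..1}. norm x \<le> C"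
      using compact_imp_bounded bounded_iff by metis
    then show ?thesis
      by (intro integrable_const_bound[where B = C] meas AE_I2) (auto simp: space_nu1)
  qed
  fix p :: "real poly" assume p: "p \<noteq> 0"
  have int2: "integrable (nu1 B) (\<lambda>t. poly p t * poly p t)"
    using int[of "p * p"] by (simp add: poly_mult[abs_def])
  have "(LINT t|nu1 B. poly p t * poly p t) \<noteq> 0"
  proof
    assume "(LINT t|nu1 B. poly p t * poly p t) = 0"
    then have "AE t in nu1 B. poly p t * poly p t = 0"
      using integral_nonneg_eq_0_iff_AE[OF int2] by simp
    then have "AE t in restrict_space lborel {-1<..<1}. 0 < density1 B t \<longrightarrow> poly p t = 0"
      unfolding nu1_def by (subst (asm) AE_density) (auto intro: measurable_restrict_space1)
    then have "AE t in lborel. t \<in> {-1<..<1} \<longrightarrow> poly p t = 0"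
      by (subst (asm) AE_restrict_space_iff) (auto elim!: AE_mp simp: density1_pos)
    moreover have "AE t in lborel. t \<notin> {t. poly p t = 0}"
      by (intro AE_not_in finite_imp_null_set_lborel poly_roots_finite p)
    ultimately have "AE t in lborel. t \<notin> {-1<..<1::real}" by eventually_elim auto
    then have "emeasure lborel {t \<in> space lborel. \<not> t \<notin> {-1<..<1::real}} = 0"
      by (subst (asm) AE_iff_measurable[OF _ refl]) auto
    moreover have "{t \<in> space lborel. \<not> t \<notin> {-1<..<1::real}} = {-1<..<1}" by auto
    ultimately have "emeasure lborel {-1<..<1::real} = 0" by simp
    then show False by (subst (asm) emeasure_lborel_Ioo) auto
  qed
  moreover have "0 \<le> (LINT t|nu1 B. poly p t * poly p t)" by simp
  ultimately show "0 < (LINT t|nu1 B. poly p t * poly p t)" by linarith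
qed

lemma orthonormal_polys_phi1:
  obtains p where "orthonormal_polys (nu1 B) p" "\<And>k. phi1 B k = poly (p k)"
  using theI'[OF ex1_orthonormal_polys_nu1[of B]] by (auto simp: phi1_def)

end

theory Submission
  imports Defs
begin

text \<open>
  Write \<open>h\<close> for the error of the computed coefficients on \<open>\<Lambda>\<close> and \<open>g = A h\<close> for the error of the
  computed noise, and put \<open>a = sqrt K\<close>, \<open>b = lam * sqrt H\<close>, \<open>X = \<parallel>h\<parallel>\<^sub>1\<^sub>,\<^sub>u / a\<close>, \<open>Y = \<parallel>g\<parallel>\<^sub>1\<^sub>,\<^sub>v / sqrt H\<close>.
  Then \<open>N = a X + b Y\<close> is the quantity that the first estimate has to bound. The proof combines a
  random, a deterministic and an optimisation argument.

  \<^item> One-sided isometry. With \<open>R = 200 a / \<delta>\<close>, with probability \<open>1 - \<epsilon>\<close> every \<open>h\<close> satisfies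
    \<open>\<parallel>h\<parallel>\<^sub>2 \<le> 2 \<parallel>h\<parallel>\<^sub>1\<^sub>,\<^sub>u / R + 40 \<parallel>A h\<parallel>\<^sub>2\<close>. This is a lower bound for \<open>A\<close> on vectors of effective sparsity
    \<open>R\<^sup>2\<close>, which is of order \<open>K / \<delta>\<^sup>2\<close>, with an absolute constant; it costs about \<open>K / \<delta>\<^sup>2\<close> samples, times
    logarithms. It follows from \<open>lower_isometry\<close>, a statement about arbitrary functions bounded by 1:
    the energy of a function is split into dyadic levels \<open>2^k\<close>; a function whose coefficients have
    \<open>l\<^sup>1\<close>-norm at most \<open>R\<close> is approximated up to \<open>2^k / 8\<close>, outside a very small set, by an average of \<open>R\<^sup>2 / 4^k\<close> basis functions,
    up to a logarithm (Maurey); and for each of these finitely many averages the sample frequency of its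
    large values is at least half of their probability, unless this is negligible (Chernoff). At a high
    level large values are rare but there are few averages, at a low level large values are frequent but
    there are many averages; as a result every level asks for the same number of samples.

  \<^item> Size of the residual. As \<open>\<bar>g\<^sub>i\<bar> \<le> \<parallel>h\<parallel>\<^sub>1\<^sub>,\<^sub>u / sqrt m\<close>, the bound
    \<open>\<parallel>g\<parallel>\<^sub>2\<^sup>2 \<le> (MAX i. \<bar>g\<^sub>i\<bar>) * \<parallel>g\<parallel>\<^sub>1\<close> and \<open>m \<ge> c K H / \<delta>\<^sup>2\<close> give \<open>\<parallel>g\<parallel>\<^sub>2\<^sup>2 \<le> \<delta> X Y / 10^6\<close>.
    Since \<open>X Y \<le> N\<^sup>2 / (4 a b)\<close> and \<open>max a b \<le> \<Theta> * min a b\<close>, only the square root of \<open>\<delta> \<Theta>\<close>, which is at most \<open>1 / 2\<close>,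
    enters the estimates (\<open>null_space_bound\<close> and \<open>l2_bound\<close>).

  \<^item> Optimality. For index sets \<open>S\<close>, \<open>T\<close> of weighted cardinality at most \<open>K\<close> and \<open>H\<close> the first two items bound
    the part of \<open>N\<close> on \<open>S\<close> and \<open>T\<close> by \<open>N / 10\<close>. Comparing the minimiser with the true coefficients
    yields \<open>N \<le> 5 / 2 * (\<sigma> + lam * \<tau>)\<close> with the best approximation errors \<open>\<sigma>\<close>, \<open>\<tau>\<close>. Inserted into the
    first two items, this bounds \<open>\<parallel>h\<parallel>\<^sub>2 + \<parallel>g\<parallel>\<^sub>2\<close> as well (\<open>lad_lasso_recovery\<close>).

  To return to functions, orthonormality turns \<open>\<parallel>h\<parallel>\<^sub>2\<close> into an \<open>L\<^sup>2\<close>-norm, and completeness of the basis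
  bounds the uniform norm by the weighted \<open>l\<^sup>1\<close>-norm of the coefficients (\<open>Linf_norm_le_coeff_sum\<close>).
  The powers of \<open>s\<close> enter through \<open>K(s) \<le> s^\<gamma> \<le> 4 K(s)\<close> (\<open>Kfun_bounds\<close>). As the basis is given only by its
  orthonormality, its uniform norms, on which \<open>K\<close> depends, are derived from the Jacobi differential
  equation (\<open>onp_sup_bound\<close>).
\<close>

section \<open>Univariate orthonormal polynomials\<close>

lemma sets_nu1: "sets (nu1 B) = sets (restrict_space borel {-1<..<1})"
  by (simp add: nu1_def cong: sets_restrict_space_cong)

lemma measurable_nu1 [measurable_dest]: "f \<in> borel_measurable borel \<Longrightarrow> f \<in> borel_measurable (nu1 B)"
  by (subst measurable_cong_sets[OF sets_nu1 refl]) (rule measurable_restrict_space1)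

lemma borel_measurable_poly: "poly p \<in> borel_measurable (borel :: real measure)"
  by (intro borel_measurable_continuous_onI continuous_intros)

lemma integrable_nu1_poly: "integrable (nu1 B) (poly p)"
proof -
  interpret prob_space "nu1 B" by (rule prob_space_nu1)
  have "compact (poly p ` {-1..1})" by (intro compact_continuous_image continuous_intros) auto
  then obtain C where "\<forall>x\<in>poly p ` {-1..1}. norm x \<le> C"
    using compact_imp_bounded bounded_iff by metis
  then show ?thesis
    by (intro integrable_const_bound[where B = C] measurable_nu1 borel_measurable_poly AE_I2) (auto simp: space_nu1)
qed

lemma nu1_lborel:
  assumes f [measurable]: "f \<in> borel_measurable borel"
  shows integrable_nu1_iff: "integrable (nu1 B) f \<longleftrightarrow> set_integrable lborel {-1<..<1} (\<lambda>t. density1 B t * f t)"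
    and integral_nu1: "(LINT t|nu1 B. f t) = (LINT t:{-1<..<1}|lborel. density1 B t * f t)"
proof -
  have pos: "AE x in restrict_space lborel {-1<..<1}. 0 \<le> density1 B x"
    by (intro AE_I2) (auto simp: space_restrict_space intro!: less_imp_le density1_pos)
  have [measurable]: "f \<in> borel_measurable (restrict_space lborel {-1<..<1})"
     "density1 B \<in> borel_measurable (restrict_space lborel {-1<..<1})"
    by (auto intro!: measurable_restrict_space1)
  show "integrable (nu1 B) f \<longleftrightarrow> set_integrable lborel {-1<..<1} (\<lambda>t. density1 B t * f t)"
    unfolding nu1_def using pos
    by (subst integrable_density) (auto simp: integrable_restrict_space set_integrable_def)
  show "(LINT t|nu1 B. f t) = (LINT t:{-1<..<1}|lborel. density1 B t * f t)"
    unfolding nu1_def using pos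
    by (subst integral_density) (auto simp: integral_restrict_space set_lebesgue_integral_def)
qed

text \<open>The Chebyshev density is unbounded at \<open>\<plusminus>1\<close>; the derivative may therefore
  be singular at the end points, where only the antiderivative has to be continuous.\<close>

lemma FTC_open_interval:
  fixes P G :: "real \<Rightarrow> real"
  assumes P: "continuous_on {-1..1} P"
    and D: "\<And>x. -1 < x \<Longrightarrow> x < 1 \<Longrightarrow> DERIV P x :> G x"
    and G: "\<And>x. -1 < x \<Longrightarrow> x < 1 \<Longrightarrow> isCont G x"
    and int: "set_integrable lborel {-1<..<1} G"
  shows "(LINT t:{-1<..<1}|lborel. G t) = P 1 - P (-1)"
proof -
  have ei: "einterval (-1) 1 = {-1<..<1}" by (auto simp: einterval_def one_ereal_def)
  have "((P \<circ> real_of_ereal) \<longlongrightarrow> P (-1)) (at_right (ereal (-1)))"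
    unfolding ereal_tendsto_simps1 using P by (intro continuous_on_Icc_at_rightD[of "-1" 1]) auto
  moreover have "((P \<circ> real_of_ereal) \<longlongrightarrow> P 1) (at_left (ereal 1))"
    unfolding ereal_tendsto_simps1 using P by (intro continuous_on_Icc_at_leftD[of "-1" 1]) auto
  ultimately have "(LBINT x=-1..1. G x) = P 1 - P (-1)"
    using int D G
    by (intro interval_integral_FTC_integrable)
      (auto simp: one_ereal_def ei[unfolded one_ereal_def] has_real_derivative_iff_has_vector_derivative[symmetric])
  then show ?thesis by (simp add: interval_lebesgue_integral_def one_ereal_def ei[unfolded one_ereal_def])
qed

text \<open>With \<open>w\<close> the density, \<open>((1 - t\<^sup>2) w)' = - alpha t w\<close>.\<close>

fun alpha :: "poly_basis \<Rightarrow> real" where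
  "alpha Legendre = 2"
| "alpha Chebyshev = 1"

definition nu1_mean :: "poly_basis \<Rightarrow> real poly \<Rightarrow> real" where
  "nu1_mean B p = (LINT t|nu1 B. poly p t)"

lemma nu1_mean_add: "nu1_mean B (p + q) = nu1_mean B p + nu1_mean B q"
  and nu1_mean_diff: "nu1_mean B (p - q) = nu1_mean B p - nu1_mean B q"
  and nu1_mean_smult: "nu1_mean B (smult c p) = c * nu1_mean B p"
  and nu1_mean_minus: "nu1_mean B (- p) = - nu1_mean B p"
  using integrable_nu1_poly[of B] by (simp_all add: nu1_mean_def)

lemma nu1_mean_sum: "nu1_mean B (\<Sum>i\<in>A. p i) = (\<Sum>i\<in>A. nu1_mean B (p i))"
  using integrable_nu1_poly[of B] by (simp add: nu1_mean_def poly_sum)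

lemma nu1_mean_const: "nu1_mean B [:c:] = c"
proof -
  interpret prob_space "nu1 B" by (rule prob_space_nu1)
  show ?thesis by (simp add: nu1_mean_def prob_space)
qed

lemma nu1_mean_deriv_Legendre: "nu1_mean Legendre (pderiv r) = (poly r 1 - poly r (-1)) / 2"
proof -
  have "nu1_mean Legendre (pderiv r) = (LINT t:{-1<..<1}|lborel. density1 Legendre t * poly (pderiv r) t)"
    unfolding nu1_mean_def by (rule integral_nu1) (rule borel_measurable_poly)
  also have "\<dots> = (\<lambda>t. poly r t / 2) 1 - (\<lambda>t. poly r t / 2) (-1)"
  proof (rule FTC_open_interval)
    show "set_integrable lborel {- 1<..<1} (\<lambda>t. density1 Legendre t * poly (pderiv r) t)"
      using integrable_nu1_poly integrable_nu1_iff[OF borel_measurable_poly] by blast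
  qed (auto intro!: derivative_eq_intros continuous_intros)
  finally show ?thesis by (simp add: diff_divide_distrib)
qed

text \<open>Times the density, the integrand is the derivative of \<open>(1 - t\<^sup>2) w r\<close>, where
  \<open>w\<close> is the density, and this function vanishes at both end points.\<close>

lemma nu1_integration_by_parts:
  "nu1_mean B ([:1, 0, -1:] * pderiv r - smult (alpha B) ([:0, 1:] * r)) = 0"
proof -
  let ?q = "[:1, 0, -1:] * pderiv r - smult (alpha B) ([:0, 1:] * r)"
  define W where "W t = (case B of Legendre \<Rightarrow> (1 - t\<^sup>2) / 2 | Chebyshev \<Rightarrow> sqrt (1 - t\<^sup>2) / pi)" for t :: real
  have pq: "poly ?q t = (1 - t\<^sup>2) * poly (pderiv r) t - alpha B * t * poly r t" for t
    by (simp add: algebra_simps power2_eq_square)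
  have "nu1_mean B ?q = (LINT t:{-1<..<1}|lborel. density1 B t * poly ?q t)"
    unfolding nu1_mean_def by (rule integral_nu1) (rule borel_measurable_poly)
  also have "\<dots> = (\<lambda>t. W t * poly r t) 1 - (\<lambda>t. W t * poly r t) (-1)"
  proof (rule FTC_open_interval)
    show "continuous_on {- 1..1} (\<lambda>t. W t * poly r t)"
      unfolding W_def by (cases B) (auto intro!: continuous_intros)
    show "set_integrable lborel {- 1<..<1} (\<lambda>t. density1 B t * poly ?q t)"
      using integrable_nu1_poly integrable_nu1_iff[OF borel_measurable_poly] by blast
  next
    fix x :: real assume x: "-1 < x" "x < 1"
    then have x2: "x\<^sup>2 < 1" by (simp add: abs_square_less_1)
    show "isCont (\<lambda>t. density1 B t * poly ?q t) x"
    proof (cases B)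
      case Legendre
      then have "density1 B = (\<lambda>t. 1 / 2)" by (intro ext) simp
      then show ?thesis by (auto intro!: continuous_intros)
    next
      case Chebyshev
      then have e: "density1 B = (\<lambda>t. 1 / (pi * sqrt (1 - t\<^sup>2)))" by (intro ext) simp
      show ?thesis unfolding e using x2 by (intro continuous_intros) auto
    qed
    show "DERIV (\<lambda>t. W t * poly r t) x :> density1 B x * poly ?q x"
    proof (cases B)
      case Legendre
      then have "W = (\<lambda>t. (1 - t\<^sup>2) / 2)" by (auto simp: W_def)
      then show ?thesis unfolding pq using Legendre
        by (auto intro!: derivative_eq_intros simp: field_simps)
    next
      case Chebyshev
      then have W: "W = (\<lambda>t. sqrt (1 - t\<^sup>2) / pi)" by (auto simp: W_def)
      define s where "s = sqrt (1 - x\<^sup>2)"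
      have s: "0 < s" "s * s = 1 - x\<^sup>2" using x2 by (auto simp: s_def)
      have "DERIV (\<lambda>t. sqrt (1 - t\<^sup>2)) x :> - x / s"
        unfolding s_def using x2 by (auto intro!: derivative_eq_intros simp: field_simps)
      then have "DERIV (\<lambda>t. sqrt (1 - t\<^sup>2) / pi * poly r t) x :> (- x / s) / pi * poly r x + poly (pderiv r) x * (s / pi)"
        unfolding s_def using DERIV_mult[OF DERIV_cdivide poly_DERIV] by blast
      moreover have "(- x / s) / pi * poly r x + poly (pderiv r) x * (s / pi) = density1 B x * poly ?q x"
        unfolding pq using Chebyshev s(1) unfolding s(2)[symmetric] by (simp add: s_def[symmetric] field_simps)
      ultimately show ?thesis unfolding W by simp
    qed
  qed
  also have "\<dots> = 0" by (cases B) (auto simp: W_def)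
  finally show ?thesis .
qed

definition onp :: "poly_basis \<Rightarrow> nat \<Rightarrow> real poly" where
  "onp B = (THE p. orthonormal_polys (nu1 B) p)"

lemma phi1_eq: "phi1 B k = poly (onp B k)"
  by (simp add: phi1_def onp_def)

lemma onp:
  shows degree_onp: "degree (onp B k) = k" and lead_coeff_onp: "0 < coeff (onp B k) k"
    and onp_orthonormal: "nu1_mean B (onp B j * onp B k) = (if j = k then 1 else 0)"
proof -
  have "orthonormal_polys (nu1 B) (onp B)"
    unfolding onp_def by (rule theI'[OF ex1_orthonormal_polys_nu1])
  then show "degree (onp B k) = k" "0 < coeff (onp B k) k"
    "nu1_mean B (onp B j * onp B k) = (if j = k then 1 else 0)"
    unfolding orthonormal_polys_def nu1_mean_def poly_mult by metis+
qed

text \<open>The degrees \<open>0, \<dots>, n\<close> all occur, so leading terms can be removed one after the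
  other.\<close>

lemma onp_span:
  assumes "degree q \<le> n"
  shows "\<exists>c. q = (\<Sum>j\<le>n. smult (c j) (onp B j))"
  using assms
proof (induction n arbitrary: q)
  case 0
  obtain a where a: "onp B 0 = [:a:]" using degree_onp[of B 0] degree_eq_zeroE by metis
  have "a \<noteq> 0" using lead_coeff_onp[of B 0] a by simp
  obtain b where "q = [:b:]" using 0 degree_eq_zeroE by auto
  then have "q = smult (b / a) (onp B 0)" using a \<open>a \<noteq> 0\<close> by simp
  then show ?case by auto
next
  case (Suc n)
  define d where "d = coeff q (Suc n) / coeff (onp B (Suc n)) (Suc n)"
  have "degree (q - smult d (onp B (Suc n))) \<le> n"
  proof (rule degree_le, intro allI impI)
    fix i assume i: "n < i"
    show "coeff (q - smult d (onp B (Suc n))) i = 0"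
    proof (cases "i = Suc n")
      case True
      then show ?thesis using lead_coeff_onp[of B "Suc n"] by (simp add: d_def)
    next
      case False
      then have "degree q < i" "degree (onp B (Suc n)) < i" using i Suc.prems by (auto simp: degree_onp)
      then show ?thesis by (simp add: coeff_eq_0)
    qed
  qed
  then obtain c where c: "q - smult d (onp B (Suc n)) = (\<Sum>j\<le>n. smult (c j) (onp B j))"
    using Suc.IH by blast
  have "q = (\<Sum>j\<le>Suc n. smult ((c(Suc n := d)) j) (onp B j))"
    using c by (simp add: algebra_simps)
  then show ?case by blast
qed

lemma onp_orthogonal_lower:
  assumes "q = 0 \<or> degree q < n"
  shows "nu1_mean B (onp B n * q) = 0"
proof (cases "q = 0")
  case True then show ?thesis using nu1_mean_const[of B 0] by simp
next
  case False
  then obtain k where n: "n = Suc k" "degree q \<le> k" using assms by (cases n) auto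
  then obtain c where "q = (\<Sum>j\<le>k. smult (c j) (onp B j))" using onp_span by blast
  then have "nu1_mean B (onp B n * q) = (\<Sum>j\<le>k. c j * nu1_mean B (onp B n * onp B j))"
    by (simp add: sum_distrib_left nu1_mean_sum nu1_mean_smult)
  then show ?thesis using n by (simp add: onp_orthonormal)
qed

text \<open>The Jacobi differential operator \<open>((1 - t\<^sup>2) w q')' / w\<close> for the density
  \<open>w\<close>.\<close>

definition jacobi_op :: "poly_basis \<Rightarrow> real poly \<Rightarrow> real poly" where
  "jacobi_op B q = [:1, 0, -1:] * pderiv (pderiv q) - smult (alpha B) ([:0, 1:] * pderiv q)"

text \<open>Green's formula for the divergence form of the operator; in particular the operator is
  symmetric.\<close>

lemma jacobi_op_green: "nu1_mean B (jacobi_op B q * r) = - nu1_mean B ([:1, 0, -1:] * (pderiv q * pderiv r))"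
proof -
  have "[:1, 0, -1:] * pderiv (pderiv q * r) - smult (alpha B) ([:0, 1:] * (pderiv q * r))
     = jacobi_op B q * r + [:1, 0, -1:] * (pderiv q * pderiv r)"
    unfolding jacobi_op_def pderiv_mult by (simp add: algebra_simps)
  then show ?thesis using nu1_integration_by_parts[of B "pderiv q * r"] by (simp only: nu1_mean_add) 
qed

lemma jacobi_op_symmetric: "nu1_mean B (jacobi_op B q * r) = nu1_mean B (q * jacobi_op B r)"
  using jacobi_op_green[of B q r] jacobi_op_green[of B r q] by (simp only: mult.commute)

lemma coeff_jacobi_op:
  "coeff (jacobi_op B q) n = (real n + 2) * (real n + 1) * coeff q (n + 2)
     - real n * (real n - 1 + alpha B) * coeff q n"
proof -
  define q1 q2 where "q1 = pderiv q" and "q2 = pderiv q1"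
  have "jacobi_op B q = q2 - pCons 0 (pCons 0 q2) - smult (alpha B) (pCons 0 q1)"
    by (simp add: jacobi_op_def q1_def q2_def)
  then have "coeff (jacobi_op B q) n = coeff q2 n - (case n of 0 \<Rightarrow> 0 | Suc k \<Rightarrow> (case k of 0 \<Rightarrow> 0 | Suc l \<Rightarrow> coeff q2 l))
      - alpha B * (case n of 0 \<Rightarrow> 0 | Suc k \<Rightarrow> coeff q1 k)"
    by (cases n) (simp_all add: coeff_pCons)
  then show ?thesis
    unfolding q2_def coeff_pderiv unfolding q1_def coeff_pderiv
    by (simp only: numeral_2_eq_2 add_Suc_right add_0_right) (simp split: nat.split add: algebra_simps)
qed

text \<open>The operator is symmetric and does not raise degrees. Hence the difference of the two sides, which
  has degree below \<open>n\<close> by the choice of the eigenvalue, is orthogonal to all polynomials of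
  degree below \<open>n\<close>.\<close>

lemma jacobi_equation: "jacobi_op B (onp B n) = smult (- (real n * (real n - 1 + alpha B))) (onp B n)"
proof -
  define \<mu> where "\<mu> = real n * (real n - 1 + alpha B)"
  define D where "D = jacobi_op B (onp B n) + smult \<mu> (onp B n)"
  have D0: "coeff D i = 0" if "n \<le> i" for i
    using that degree_onp[of B n] coeff_eq_0[of "onp B n" i] coeff_eq_0[of "onp B n" "i + 2"]
    unfolding D_def by (cases "i = n") (auto simp: coeff_jacobi_op \<mu>_def)
  have "D = 0"
  proof (cases n)
    case 0
    then show ?thesis using D0 by (intro poly_eqI) auto
  next
    case (Suc k)
    have "degree D \<le> k" using D0 Suc by (intro degree_le) auto
    then obtain c where c: "D = (\<Sum>j\<le>k. smult (c j) (onp B j))" using onp_span by blast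
    have "c j = 0" if j: "j \<le> k" for j
    proof -
      have "nu1_mean B (D * onp B j) = (\<Sum>i\<le>k. c i * (if i = j then 1 else 0))"
        unfolding c by (simp add: sum_distrib_right nu1_mean_sum nu1_mean_smult onp_orthonormal)
      also have "\<dots> = c j" using j by (simp add: if_distrib[where f = "\<lambda>x. _ * x"] cong: if_cong)
      finally have 1: "nu1_mean B (D * onp B j) = c j" .
      have "degree (jacobi_op B (onp B j)) \<le> j"
        by (intro degree_le) (auto simp: coeff_jacobi_op coeff_eq_0 degree_onp)
      then have "nu1_mean B (onp B n * jacobi_op B (onp B j)) = 0"
        using j Suc by (intro onp_orthogonal_lower) auto
      moreover have "nu1_mean B (onp B n * onp B j) = 0" using j Suc by (simp add: onp_orthonormal)
      ultimately have "nu1_mean B (D * onp B j) = 0"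
        unfolding D_def by (simp add: distrib_right nu1_mean_add nu1_mean_smult jacobi_op_symmetric)
      then show ?thesis using 1 by simp
    qed
    then show ?thesis unfolding c by (intro sum.neutral) auto
  qed
  then show ?thesis unfolding D_def \<mu>_def by (simp add: eq_neg_iff_add_eq_0)
qed

text \<open>The squared uniform norms of the univariate orthonormal polynomials.\<close>

fun sup_sq :: "poly_basis \<Rightarrow> nat \<Rightarrow> real" where
  "sup_sq Legendre k = 2 * real k + 1"
| "sup_sq Chebyshev k = (if k = 0 then 1 else 2)"

lemma onp_0: "onp B 0 = 1"
proof -
  obtain a where a: "onp B 0 = [:a:]" using degree_onp[of B 0] degree_eq_zeroE by metis
  have "0 < a" "a * a = 1" using lead_coeff_onp[of B 0] onp_orthonormal[of B 0 0] a
    by (auto simp: nu1_mean_const)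
  then have "a = 1" by (simp add: square_eq_1_iff)
  then show ?thesis using a by (simp add: one_pCons)
qed

text \<open>Integration by parts with \<open>r = 1\<close> and \<open>r = t\<close> gives the first two
  moments \<open>0\<close> and \<open>1 / (1 + alpha)\<close>.\<close>

lemma onp_1: "onp B 1 = [:0, sqrt (1 + alpha B):]"
proof -
  have al: "0 < alpha B" by (cases B) auto
  define a b where "a = coeff (onp B 1) 1" and "b = coeff (onp B 1) 0"
  have p: "onp B 1 = [:b, a:]"
  proof (rule poly_eqI)
    fix i show "coeff (onp B 1) i = coeff [:b, a:] i"
    proof (cases "i \<le> 1")
      case True
      then have "i = 0 \<or> i = 1" by auto
      then show ?thesis by (auto simp: a_def b_def)
    next
      case False
      then show ?thesis by (simp add: coeff_eq_0 degree_onp)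
    qed
  qed
  have a0: "0 < a" using lead_coeff_onp[of B 1] by (simp add: a_def)
  have "nu1_mean B (- smult (alpha B) [:0, 1:]) = 0"
    using nu1_integration_by_parts[of B 1] by simp
  then have m1: "nu1_mean B [:0, 1:] = 0"
    using al by (simp only: nu1_mean_minus nu1_mean_smult) simp
  have "nu1_mean B ([:1:] - smult (1 + alpha B) [:0, 0, 1:]) = 0"
    using nu1_integration_by_parts[of B "[:0, 1:]"] by (simp add: pderiv_pCons algebra_simps)
  then have m2: "(1 + alpha B) * nu1_mean B [:0, 0, 1:] = 1"
    by (simp only: nu1_mean_diff nu1_mean_smult nu1_mean_const)
  have "nu1_mean B ([:b, a:] * 1) = 0"
    using onp_orthonormal[of B 1 0] unfolding onp_0 p by simp
  moreover have "[:b, a:] * 1 = [:b:] + smult a [:0, 1:]" by simp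
  ultimately have "b = 0" using m1 by (simp only: nu1_mean_add nu1_mean_smult nu1_mean_const)
  have "nu1_mean B ([:b, a:] * [:b, a:]) = 1"
    using onp_orthonormal[of B 1 1] unfolding p by simp
  moreover have "[:b, a:] * [:b, a:] = smult (a * a) [:0, 0, 1:]" using \<open>b = 0\<close> by simp
  ultimately have "a * a * nu1_mean B [:0, 0, 1:] = 1" by (simp only: nu1_mean_smult)
  then have "a * a = 1 + alpha B" using m2 by algebra
  then have "a = sqrt (1 + alpha B)" using a0 by (metis less_imp_le real_sqrt_mult_self real_sqrt_mult abs_of_pos real_sqrt_abs2)
  then show ?thesis using p \<open>b = 0\<close> by simp
qed

text \<open>In the integral of \<open>((t \<plusminus> 1) p\<^sup>2)'\<close> the boundary term isolates one
  end point; the rest is known because \<open>t p'\<close> is \<open>n p\<close> up to terms of lower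
  degree.\<close>

lemma onp_boundary_Legendre:
  "(poly (onp Legendre n) 1)\<^sup>2 = 2 * real n + 1" "(poly (onp Legendre n) (-1))\<^sup>2 = 2 * real n + 1"
proof -
  define p where "p = onp Legendre n"
  define x where "x = ([:0, 1:] :: real poly)"
  have n1: "nu1_mean Legendre (p * p) = 1" unfolding p_def by (simp add: onp_orthonormal)
  have o1: "nu1_mean Legendre (p * pderiv p) = 0" unfolding p_def
    by (intro onp_orthogonal_lower) (cases n; auto simp: degree_pderiv degree_onp onp_0)
  have "nu1_mean Legendre (p * (x * pderiv p - smult (real n) p)) = 0" unfolding p_def
  proof (intro onp_orthogonal_lower)
    let ?q = "x * pderiv (onp Legendre n) - smult (real n) (onp Legendre n)"
    have "coeff ?q i = 0" if "n \<le> i" for i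
      using that degree_onp[of Legendre n]
      by (cases i; cases "i = n") (auto simp: x_def coeff_pderiv coeff_eq_0)
    then show "?q = 0 \<or> degree ?q < n"
      by (metis leading_coeff_0_iff not_le)
  qed
  then have o2: "nu1_mean Legendre (p * (x * pderiv p)) = real n"
    using n1 by (simp add: right_diff_distrib nu1_mean_diff nu1_mean_smult)
  have A: "pderiv ([:a, 1:] * (p * p)) = p * p + smult (2 * a) (p * pderiv p) + smult 2 (p * (x * pderiv p))" for a
  proof -
    have "poly (pderiv ([:a, 1:] * (p * p))) y = poly (p * p + smult (2 * a) (p * pderiv p) + smult 2 (p * (x * pderiv p))) y" for y
      unfolding pderiv_mult poly_add poly_mult poly_smult x_def by (simp add: pderiv_pCons algebra_simps)
    then show ?thesis using poly_eq_poly_eq_iff by blast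
  qed
  have "nu1_mean Legendre (pderiv ([:a, 1:] * (p * p))) = 1 + 2 * real n" for a
    unfolding A by (simp add: nu1_mean_add nu1_mean_smult n1 o1 o2)
  then have "(poly ([:a, 1:] * (p * p)) 1 - poly ([:a, 1:] * (p * p)) (-1)) / 2 = 1 + 2 * real n" for a
    unfolding nu1_mean_deriv_Legendre .
  from this[of 1] this[of "-1"]
  show "(poly (onp Legendre n) 1)\<^sup>2 = 2 * real n + 1" "(poly (onp Legendre n) (-1))\<^sup>2 = 2 * real n + 1"
    unfolding p_def by (simp_all add: power2_eq_square algebra_simps)
qed

text \<open>Sonin's function \<open>F = p\<^sup>2 + (1 - t\<^sup>2) p'\<^sup>2 / \<mu>\<close> dominates
  \<open>p\<^sup>2\<close>, and by the Jacobi equation \<open>F' = 2 (alpha - 1) t p'\<^sup>2 / \<mu>\<close>.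
  In the Chebyshev case \<open>F\<close> is therefore constant, equal to its mean \<open>2\<close>. In the
  Legendre case it is largest at the end points, where it agrees with \<open>p\<^sup>2\<close>.\<close>

lemma onp_sup_bound:
  assumes x: "-1 \<le> x" "x \<le> 1"
  shows "(poly (onp B n) x)\<^sup>2 \<le> sup_sq B n"
proof (cases "n = 0")
  case True
  then show ?thesis by (cases B) (auto simp: onp_0)
next
  case False
  define \<mu> where "\<mu> = real n * (real n - 1 + alpha B)"
  have \<mu>0: "0 < \<mu>" unfolding \<mu>_def using False by (cases B) auto
  define p where "p = onp B n"
  define F where "F = p * p + smult (1 / \<mu>) ([:1, 0, -1:] * (pderiv p * pderiv p))"
  have jac: "jacobi_op B p = smult (- \<mu>) p" unfolding p_def \<mu>_def by (rule jacobi_equation)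
  have ode: "(1 - y\<^sup>2) * poly (pderiv (pderiv p)) y = alpha B * y * poly (pderiv p) y - \<mu> * poly p y" for y
  proof -
    have "poly (jacobi_op B p) y = - \<mu> * poly p y" unfolding jac by simp
    then show ?thesis by (simp add: jacobi_op_def algebra_simps power2_eq_square)
  qed
  have F': "poly (pderiv F) y = 2 * (alpha B - 1) / \<mu> * (y * (poly (pderiv p) y)\<^sup>2)" for y
  proof -
    have "poly (pderiv F) y = 2 * poly p y * poly (pderiv p) y
        + 1 / \<mu> * (2 * poly (pderiv p) y * ((1 - y\<^sup>2) * poly (pderiv (pderiv p)) y) - 2 * y * (poly (pderiv p) y)\<^sup>2)"
      unfolding F_def pderiv_mult pderiv_add pderiv_smult poly_add poly_mult poly_smult
      by (simp add: pderiv_pCons algebra_simps power2_eq_square)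
    also have "\<dots> = 2 * (alpha B - 1) / \<mu> * (y * (poly (pderiv p) y)\<^sup>2)"
      unfolding ode using \<mu>0 by (simp add: field_simps power2_eq_square flip: distrib_left)
    finally show ?thesis .
  qed
  have Fv: "poly F y = (poly p y)\<^sup>2 + (1 - y\<^sup>2) * (poly (pderiv p) y)\<^sup>2 / \<mu>" for y
    unfolding F_def poly_add poly_mult poly_smult by (simp add: power2_eq_square)
  have "x\<^sup>2 \<le> 1" using x by (simp add: abs_square_le_1)
  then have le: "(poly p x)\<^sup>2 \<le> poly F x" unfolding Fv using \<mu>0 by simp
  show ?thesis
  proof (cases B)
    case Chebyshev
    have "poly (pderiv F) = poly 0" using F' Chebyshev by auto
    then have "pderiv F = 0" using poly_eq_poly_eq_iff by blast
    then obtain c where c: "F = [:c:]" using pderiv_iszero by blast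
    have "nu1_mean B ([:1, 0, -1:] * (pderiv p * pderiv p)) = \<mu>"
      using jacobi_op_green[of B p p] unfolding jac
      by (simp add: nu1_mean_minus nu1_mean_smult p_def onp_orthonormal)
    then have "nu1_mean B F = 2"
      unfolding F_def nu1_mean_add nu1_mean_smult using \<mu>0 by (simp add: p_def onp_orthonormal)
    then have "c = 2" unfolding c nu1_mean_const .
    then show ?thesis using le False Chebyshev unfolding c p_def by simp
  next
    case Legendre
    have "poly F x \<le> 2 * real n + 1"
    proof (cases "0 \<le> x")
      case True
      have "poly F x \<le> poly F 1"
      proof (rule DERIV_nonneg_imp_nondecreasing[OF x(2)])
        fix y assume "x \<le> y" "y \<le> 1"
        then have "0 \<le> poly (pderiv F) y" unfolding F' using True Legendre \<mu>0 by simp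
        then show "\<exists>d. DERIV (poly F) y :> d \<and> 0 \<le> d" using poly_DERIV by blast
      qed
      also have "poly F 1 = 2 * real n + 1" unfolding Fv using onp_boundary_Legendre(1)[of n] Legendre by (simp add: p_def)
      finally show ?thesis .
    next
      case False
      have "poly F x \<le> poly F (-1)"
      proof (rule DERIV_nonpos_imp_nonincreasing[OF x(1)])
        fix y assume "-1 \<le> y" "y \<le> x"
        then have "y * (poly (pderiv p) y)\<^sup>2 \<le> 0" using False by (simp add: mult_nonpos_nonneg)
        then have "poly (pderiv F) y \<le> 0" unfolding F' using Legendre \<mu>0 by (simp add: divide_nonpos_pos mult_nonneg_nonpos)
        then show "\<exists>d. DERIV (poly F) y :> d \<and> d \<le> 0" using poly_DERIV by blast
      qed
      also have "poly F (-1) = 2 * real n + 1" unfolding Fv using onp_boundary_Legendre(2)[of n] Legendre by (simp add: p_def)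
      finally show ?thesis .
    qed
    then show ?thesis using le Legendre unfolding p_def by simp
  qed
qed

section \<open>Weighted cardinality of lower sets\<close>

lemma gam_pos: "0 < gam B"
  by (cases B) auto

lemma two_powr_gam: "2 powr gam B = 2 + alpha B"
  by (cases B) (simp, simp add: powr_def)

lemma sup_sq_pos: "1 \<le> sup_sq B k"
  by (cases B) auto

text \<open>Equality holds for \<open>x = y\<close> since \<open>2 powr \<gamma> = 3\<close>, and after
  scaling the difference of the two sides grows with \<open>y / x\<close>.\<close>

lemma powr_add_ge:
  fixes x y \<gamma> :: real
  assumes "0 \<le> x" "x \<le> y" "1 \<le> \<gamma>" "2 powr \<gamma> = 3"
  shows "y powr \<gamma> + 2 * x powr \<gamma> \<le> (y + x) powr \<gamma>"
proof (cases "x = 0")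
  case True
  then show ?thesis using assms by simp
next
  case False
  then have x: "0 < x" using assms by simp
  define g where "g t = (t + 1) powr \<gamma> - t powr \<gamma>" for t :: real
  have "g 1 \<le> g (y / x)"
  proof (rule DERIV_nonneg_imp_nondecreasing[where f = g])
    show "1 \<le> y / x" using x assms by simp
    fix t :: real assume t: "1 \<le> t" "t \<le> y / x"
    have "DERIV g t :> \<gamma> * (t + 1) powr (\<gamma> - 1) - \<gamma> * t powr (\<gamma> - 1)"
      unfolding g_def using t by (auto intro!: derivative_eq_intros)
    moreover have "0 \<le> \<gamma> * (t + 1) powr (\<gamma> - 1) - \<gamma> * t powr (\<gamma> - 1)"
      using t assms by (simp add: powr_mono2 mult_left_mono)
    ultimately show "\<exists>d. DERIV g t :> d \<and> 0 \<le> d" by blast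
  qed
  then have "2 \<le> (y / x + 1) powr \<gamma> - (y / x) powr \<gamma>" using assms by (simp add: g_def)
  then have "2 * x powr \<gamma> \<le> ((y / x + 1) powr \<gamma> - (y / x) powr \<gamma>) * x powr \<gamma>"
    by (intro mult_right_mono) auto
  also have "\<dots> = ((y / x + 1) * x) powr \<gamma> - (y / x * x) powr \<gamma>"
    using x assms by (simp add: left_diff_distrib powr_mult powr_divide)
  also have "(y / x + 1) * x = y + x" using x by (simp add: field_simps)
  also have "y / x * x = y" using x by simp
  finally show ?thesis by simp
qed

text \<open>A new last term \<open>x\<close> satisfies \<open>N x \<le> A\<close> with the sum
  \<open>A\<close> of the preceding \<open>N\<close> terms. For Legendre weights it thus raises
  \<open>A\<^sup>2\<close> by \<open>2 A x + x\<^sup>2 \<ge> (2 N + 1) x\<^sup>2\<close>; for Chebyshev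
  weights this is \<open>powr_add_ge\<close>.\<close>

lemma weighted_powr_sum_le:
  fixes a :: "nat \<Rightarrow> real"
  assumes a0: "\<And>k. 0 \<le> a k" and dec: "antimono a"
  shows "(\<Sum>k<N. sup_sq B k * a k powr gam B) \<le> (\<Sum>k<N. a k) powr gam B"
proof (induction N)
  case 0
  show ?case by simp
next
  case (Suc N)
  define A x where "A = (\<Sum>k<N. a k)" and "x = a N"
  have "(\<Sum>k<N. a N) \<le> A" unfolding A_def by (intro sum_mono) (use dec in \<open>auto simp: antimono_def\<close>)
  then have A: "real N * x \<le> A" by (simp add: x_def)
  have x0: "0 \<le> x" using a0 by (simp add: x_def)
  have A0: "0 \<le> A" using a0 by (simp add: A_def sum_nonneg)
  have "A powr gam B + sup_sq B N * x powr gam B \<le> (A + x) powr gam B"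
  proof (cases B)
    case Legendre
    have "real N * x * x \<le> A * x" using A x0 by (intro mult_right_mono)
    then show ?thesis using Legendre A0 x0 by (simp add: power2_eq_square algebra_simps)
  next
    case Chebyshev
    show ?thesis
    proof (cases "N = 0")
      case True
      then show ?thesis using Chebyshev by (simp add: A_def)
    next
      case False
      then have "x \<le> A" using A x0 mult_right_mono[of 1 "real N" x] by simp
      moreover have "1 \<le> gam Chebyshev" by simp
      ultimately show ?thesis
        using powr_add_ge[of x A "gam B"] x0 Chebyshev False two_powr_gam[of B] by simp
    qed
  qed
  then show ?case using Suc.IH by (simp add: A_def x_def)
qed

text \<open>Induction on the dimension: the slices of a lower set along the last coordinate are lower sets of
  decreasing cardinality, as required by \<open>weighted_powr_sum_le\<close>.\<close>

lemma lower_set_weight_le: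
  assumes "lower_set d S" "finite S"
  shows "(\<Sum>i\<in>S. \<Prod>l<d. sup_sq B (i l)) \<le> real (card S) powr gam B"
  using assms
proof (induction d arbitrary: S)
  case 0
  have "S \<subseteq> {\<lambda>_. 0}" using 0 by (auto simp: lower_set_def mindices_def)
  then have "S = {} \<or> S = {\<lambda>_. 0}" by auto
  then show ?case by auto
next
  case (Suc d)
  define T where "T k = {j \<in> mindices d. j(d := k) \<in> S}" for k
  define N where "N = Suc (Max ((\<lambda>i. i d) ` S \<union> {0}))"
  have N: "i d < N" if "i \<in> S" for i
    unfolding N_def less_Suc_eq_le using that Suc.prems by (intro Max_ge) auto
  have inj: "inj_on (\<lambda>(k, j). j(d := k)) (UNIV \<times> mindices d)"
  proof (rule inj_onI, clarify)
    fix k j k' j' assume j: "j \<in> mindices d" "j' \<in> mindices d" and e: "j(d := k) = j'(d := k' :: nat)"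
    have "k = k'" using fun_cong[OF e, of d] by simp
    moreover have "j x = j' x" for x
      using fun_cong[OF e, of x] j by (cases "x = d") (auto simp: mindices_def)
    ultimately show "k = k' \<and> j = j'" by auto
  qed
  have img: "(\<lambda>(k, j). j(d := k)) ` (SIGMA k:{..<N}. T k) = S"
  proof (intro equalityI subsetI)
    fix i assume i: "i \<in> S"
    have "i(d := 0) \<in> mindices d" using i Suc.prems(1) by (auto simp: lower_set_def mindices_def)
    then have "(i d, i(d := 0)) \<in> (SIGMA k:{..<N}. T k)" using N[OF i] i by (auto simp: T_def)
    moreover have "i = (\<lambda>(k, j). j(d := k)) (i d, i(d := 0))" by simp
    ultimately show "i \<in> (\<lambda>(k, j). j(d := k)) ` (SIGMA k:{..<N}. T k)" by (rule rev_image_eqI)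
  qed (auto simp: T_def)
  have inj': "inj_on (\<lambda>(k, j). j(d := k)) (SIGMA k:{..<N}. T k)"
    by (rule inj_on_subset[OF inj]) (auto simp: T_def)
  have finT: "finite (T k)" for k
  proof (rule inj_on_finite)
    show "inj_on (\<lambda>j. j(d := k)) (T k)"
    proof (rule inj_onI)
      fix j j' assume "j \<in> T k" "j' \<in> T k" "j(d := k) = j'(d := k)"
      then have "(k, j) = (k, j')" by (intro inj_onD[OF inj]) (auto simp: T_def)
      then show "j = j'" by simp
    qed
    show "(\<lambda>j. j(d := k)) ` T k \<subseteq> S" by (auto simp: T_def)
  qed (use Suc.prems in auto)
  have lowT: "lower_set d (T k)" for k
    unfolding lower_set_def
  proof (intro conjI ballI impI)
    fix i j assume i: "i \<in> T k" and j: "j \<in> mindices d" "j \<le> i"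
    have "j(d := k) \<in> S"
      using Suc.prems(1) i j unfolding lower_set_def T_def mindices_def le_fun_def by (auto simp: le_fun_def mindices_def)
    then show "j \<in> T k" using j by (simp add: T_def)
  qed (auto simp: T_def)
  have decT: "T k' \<subseteq> T k" if "k \<le> k'" for k k'
  proof
    fix j assume j: "j \<in> T k'"
    have "j(d := k) \<in> mindices (Suc d)" using j by (auto simp: T_def mindices_def)
    moreover have "j(d := k) \<le> j(d := k')" using that by (auto simp: le_fun_def)
    ultimately have "j(d := k) \<in> S" using Suc.prems(1) j by (auto simp: T_def lower_set_def)
    then show "j \<in> T k" using j by (simp add: T_def)
  qed
  have card_S: "real (card S) = (\<Sum>k<N. real (card (T k)))"
    using card_image[OF inj'] finT by (simp add: img card_SigmaI)
  have "(\<Sum>i\<in>S. \<Prod>l<Suc d. sup_sq B (i l))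
      = (\<Sum>(k, j)\<in>(SIGMA k:{..<N}. T k). \<Prod>l<Suc d. sup_sq B ((j(d := k)) l))"
    by (subst img[symmetric], subst sum.reindex[OF inj']) (simp add: split_beta)
  also have "\<dots> = (\<Sum>k<N. \<Sum>j\<in>T k. \<Prod>l<Suc d. sup_sq B ((j(d := k)) l))"
    using finT by (subst sum.Sigma) auto
  also have "\<dots> = (\<Sum>k<N. sup_sq B k * (\<Sum>j\<in>T k. \<Prod>l<d. sup_sq B (j l)))"
    by (simp add: sum_distrib_left mult.commute)
  also have "\<dots> \<le> (\<Sum>k<N. sup_sq B k * real (card (T k)) powr gam B)"
    using sup_sq_pos[of B] by (intro sum_mono mult_left_mono Suc.IH lowT finT) (auto intro: order.trans[of 0 1])
  also have "\<dots> \<le> (\<Sum>k<N. real (card (T k))) powr gam B"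
    by (rule weighted_powr_sum_le) (auto simp: antimono_def intro!: card_mono finT decT)
  finally show ?case by (simp add: card_S)
qed

lemma finite_hyp_cross: "finite (hyp_cross d s)"
proof (rule finite_subset)
  show "finite {f. \<forall>x. (x \<in> {..<d} \<longrightarrow> f x \<in> {..s}) \<and> (x \<notin> {..<d} \<longrightarrow> f x = (0::nat))}"
    by (rule finite_set_of_finite_funs) auto
  show "hyp_cross d s \<subseteq> {f. \<forall>x. (x \<in> {..<d} \<longrightarrow> f x \<in> {..s}) \<and> (x \<notin> {..<d} \<longrightarrow> f x = (0::nat))}"
  proof (clarsimp simp: hyp_cross_def mindices_def)
    fix i l assume le: "(\<Prod>l<d. Suc (i l)) \<le> s" and l: "l < d"
    have "i l + 1 dvd (\<Prod>l<d. Suc (i l))" using l dvd_prod_eqI[of "{..<d}" l] by auto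
    then have "i l + 1 \<le> (\<Prod>l<d. Suc (i l))" by (rule dvd_imp_le) (simp add: prod_pos)
    then show "i l \<le> s" using le by linarith
  qed
qed

text \<open>With \<open>i\<close> a lower set contains the box below \<open>i\<close>, whose cardinality is
  the product in the definition of the hyperbolic cross.\<close>

lemma lower_set_subset_hyp_cross:
  assumes S: "lower_set d S" "finite S" "card S \<le> s"
  shows "S \<subseteq> hyp_cross d s"
proof
  fix i assume i: "i \<in> S"
  have im: "i \<in> mindices d" using S i by (auto simp: lower_set_def)
  define e where "e g = (\<lambda>l. if l < d then g l else 0)" for g :: mindex
  have inj: "inj_on e (PiE {..<d} (\<lambda>l. {..i l}))"
  proof (rule inj_onI)
    fix g h assume gh: "g \<in> PiE {..<d} (\<lambda>l. {..i l})" "h \<in> PiE {..<d} (\<lambda>l. {..i l})" "e g = e h"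
    have "g l = h l" if "l \<in> {..<d}" for l using fun_cong[OF gh(3), of l] that by (simp add: e_def)
    then show "g = h" by (rule PiE_ext[OF gh(1,2)])
  qed
  have "e ` (PiE {..<d} (\<lambda>l. {..i l})) \<subseteq> S"
  proof (clarify)
    fix g assume g: "g \<in> PiE {..<d} (\<lambda>l. {..i l})"
    have "e g \<in> mindices d" by (simp add: e_def mindices_def)
    moreover have "e g l \<le> i l" for l using g by (auto simp: e_def)
    ultimately show "e g \<in> S" using S(1) i by (auto simp: lower_set_def le_fun_def)
  qed
  then have "card (PiE {..<d} (\<lambda>l. {..i l})) \<le> card S"
    using card_image[OF inj] card_mono[OF S(2)] by metis
  then show "i \<in> hyp_cross d s" using im S(3) by (simp add: card_PiE hyp_cross_def)
qed

lemma card_hyp_cross_ge_2: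
  assumes "1 \<le> d" "2 \<le> s"
  shows "2 \<le> card (hyp_cross d s)"
proof -
  define e where "e = (\<lambda>l::nat. if l = 0 then 1 else 0 :: nat)"
  have "(\<Prod>l<d. e l + 1) = (\<Prod>l\<in>{0}. e l + 1)"
    using assms by (intro prod.mono_neutral_right) (auto simp: e_def)
  then have "e \<in> hyp_cross d s" using assms by (auto simp: hyp_cross_def mindices_def e_def)
  moreover have "(\<lambda>_. 0) \<in> hyp_cross d s" using assms by (auto simp: hyp_cross_def mindices_def)
  moreover have "e \<noteq> (\<lambda>_. 0)" by (auto simp: e_def fun_eq_iff)
  ultimately have "card {e, \<lambda>_. 0} \<le> card (hyp_cross d s)"
    by (intro card_mono finite_hyp_cross) auto
  then show ?thesis using \<open>e \<noteq> (\<lambda>_. 0)\<close> by simp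
qed

text \<open>The Boolean cube \<open>{0,1}^k\<close> as a set of multi-indices.\<close>

definition cube :: "nat \<Rightarrow> mindex set" where
  "cube k = (\<lambda>T l. if l \<in> T then 1 else 0) ` Pow {..<k}"

lemma cube_inj: "inj (\<lambda>T (l::nat). if l \<in> T then 1 else (0::nat))"
  by (rule injI) (auto simp: fun_eq_iff split: if_splits)

lemma cube_lower:
  assumes "k \<le> d"
  shows "lower_set d (cube k)" "finite (cube k)" "card (cube k) = 2 ^ k"
proof -
  show "finite (cube k)" by (simp add: cube_def)
  show "card (cube k) = 2 ^ k"
    unfolding cube_def by (subst card_image) (auto intro: inj_on_subset[OF cube_inj] simp: card_Pow)
  show "lower_set d (cube k)"
    unfolding lower_set_def
  proof (intro conjI ballI impI subsetI)
    fix i assume "i \<in> cube k" then show "i \<in> mindices d" using assms by (auto simp: cube_def mindices_def)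
  next
    fix i j assume i: "i \<in> cube k" and j: "j \<in> mindices d" "j \<le> i"
    have "j = (\<lambda>l. if l \<in> {l. j l = 1} then 1 else 0)" "{l. j l = 1} \<in> Pow {..<k}"
    proof -
      have le: "j l \<le> (if l < k then 1 else 0)" for l
        using i le_funD[OF j(2), of l] by (auto simp: cube_def split: if_splits)
      show "{l. j l = 1} \<in> Pow {..<k}" using le by (fastforce split: if_splits)
      have "j l \<le> 1" for l using le[of l] by (auto split: if_splits)
      then show "j = (\<lambda>l. if l \<in> {l. j l = 1} then 1 else 0)"
        by (auto simp: fun_eq_iff) (metis One_nat_def le_Suc_eq le_zero_eq)
    qed
    then show "j \<in> cube k" unfolding cube_def by (rule image_eqI)
  qed
qed

lemma cube_weight:
  fixes c :: real
  shows "(\<Sum>i\<in>cube k. c ^ card {l. i l = 1}) = (1 + c) ^ k"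
proof -
  have "(\<Sum>i\<in>cube k. c ^ card {l. i l = 1}) = (\<Sum>T\<in>Pow {..<k}. c ^ card T)"
    unfolding cube_def by (subst sum.reindex) (auto intro: inj_on_subset[OF cube_inj])
  also have "\<dots> = (\<Prod>l<k. c + 1)" by (subst prod_add) auto
  finally show ?thesis by (simp add: add.commute)
qed

section \<open>The tensor basis and its weights\<close>

interpretation nu1s: product_prob_space "\<lambda>_::nat. nu1 B" UNIV for B
proof -
  interpret prob_space "nu1 B" for B by (rule prob_space_nu1)
  show "product_prob_space (\<lambda>_::nat. nu1 B)" by unfold_locales
qed

lemma prob_space_nu: "prob_space (nu B d)"
  unfolding nu_def by (intro prob_space_PiM prob_space_nu1)

lemma space_nu: "space (nu B d) = PiE {..<d} (\<lambda>_. {-1<..<1})"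
  by (simp add: nu_def space_PiM space_nu1)

definition rphi :: "poly_basis \<Rightarrow> nat \<Rightarrow> mindex \<Rightarrow> (nat \<Rightarrow> real) \<Rightarrow> real" where
  "rphi B d i t = (\<Prod>l<d. phi1 B (i l) (t l))"

lemma phi_eq: "phi B d i t = complex_of_real (rphi B d i t)"
  by (simp add: phi_def rphi_def)

lemma rphi_measurable [measurable]: "rphi B d i \<in> borel_measurable (nu B d)"
proof -
  have [measurable]: "phi1 B k \<in> borel_measurable (nu1 B)" for k
    unfolding phi1_eq by (intro measurable_nu1 borel_measurable_poly)
  show ?thesis unfolding rphi_def[abs_def] nu_def by measurable
qed

lemma phi_measurable [measurable]: "phi B d i \<in> borel_measurable (nu B d)"
  unfolding phi_eq[abs_def] by measurable

lemma rphi_sq_le: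
  assumes "t \<in> space (nu B d)"
  shows "(rphi B d i t)\<^sup>2 \<le> (\<Prod>l<d. sup_sq B (i l))"
  unfolding rphi_def prod_power_distrib phi1_eq
proof (intro prod_mono conjI)
  fix l assume "l \<in> {..<d}"
  then have "-1 < t l" "t l < 1" using assms by (auto simp: space_nu PiE_iff)
  then show "(poly (onp B (i l)) (t l))\<^sup>2 \<le> sup_sq B (i l)" by (intro onp_sup_bound) auto
qed auto

lemma rphi_orthonormal:
  assumes "i \<in> mindices d" "j \<in> mindices d"
  shows "(LINT t|nu B d. rphi B d i t * rphi B d j t) = (if i = j then 1 else 0)"
proof -
  have "(LINT t|nu B d. rphi B d i t * rphi B d j t) = (LINT t|nu B d. (\<Prod>l<d. phi1 B (i l) (t l) * phi1 B (j l) (t l)))"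
    by (simp add: rphi_def prod.distrib)
  also have "\<dots> = (\<Prod>l<d. (LINT x|nu1 B. phi1 B (i l) x * phi1 B (j l) x))"
    unfolding nu_def phi1_eq poly_mult[symmetric]
    by (intro nu1s.product_integral_prod integrable_nu1_poly) auto
  also have "\<dots> = (\<Prod>l<d. if i l = j l then 1 else 0)"
    using onp_orthonormal[of B "i _" "j _"] by (simp add: nu1_mean_def phi1_eq)
  also have "\<dots> = (if i = j then 1 else 0)"
  proof (cases "i = j")
    case False
    then obtain l where l: "i l \<noteq> j l" by auto
    have "l < d"
    proof (rule ccontr)
      assume "\<not> l < d"
      then have "i l = 0" "j l = 0" using assms unfolding mindices_def by auto
      then show False using l by simp
    qed
    then show ?thesis using l False by (intro trans[OF prod_zero]) auto
  qed simp
  finally show ?thesis .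
qed

lemma Linf_phi:
  shows Linf_phi_le: "Linf_norm (nu B d) (phi B d i) \<le> ennreal (sqrt (\<Prod>l<d. sup_sq B (i l)))"
    and Linf_phi_eq: "Linf_norm (nu B d) (phi B d i) = ennreal (uweight B d i)"
proof -
  show le: "Linf_norm (nu B d) (phi B d i) \<le> ennreal (sqrt (\<Prod>l<d. sup_sq B (i l)))"
    unfolding Linf_norm_def
  proof (rule esssup_I)
    show "AE t in nu B d. ennreal (cmod (phi B d i t)) \<le> ennreal (sqrt (\<Prod>l<d. sup_sq B (i l)))"
      using rphi_sq_le[of _ B d i]
      by (intro AE_I2 ennreal_leI) (auto simp: phi_eq intro!: real_le_rsqrt)
  qed measurable
  then have "Linf_norm (nu B d) (phi B d i) < \<infinity>" by (metis ennreal_less_top infinity_ennreal_def order_le_less_trans)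
  then show "Linf_norm (nu B d) (phi B d i) = ennreal (uweight B d i)"
    by (simp add: uweight_def ennreal_enn2real less_top)
qed

lemma uweight_nonneg: "0 \<le> uweight B d i"
  by (simp add: uweight_def)

lemma uweight_sq_le: "(uweight B d i)\<^sup>2 \<le> (\<Prod>l<d. sup_sq B (i l))"
proof -
  have p: "0 \<le> (\<Prod>l<d. sup_sq B (i l))" using sup_sq_pos by (intro prod_nonneg) (auto intro: order.trans[of 0 1])
  have "uweight B d i \<le> sqrt (\<Prod>l<d. sup_sq B (i l))"
    using Linf_phi_le[of B d i] p unfolding Linf_phi_eq by (subst (asm) ennreal_le_iff) auto
  then have "(uweight B d i)\<^sup>2 \<le> (sqrt (\<Prod>l<d. sup_sq B (i l)))\<^sup>2"
    using uweight_nonneg by (intro power_mono)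
  then show ?thesis using p by simp
qed

lemma AE_rphi_le: "AE t in nu B d. \<bar>rphi B d i t\<bar> \<le> uweight B d i"
proof -
  have "AE t in nu B d. ennreal (cmod (phi B d i t)) \<le> Linf_norm (nu B d) (phi B d i)"
    unfolding Linf_norm_def by (rule esssup_AE)
  then show ?thesis unfolding Linf_phi_eq using uweight_nonneg[of B d i] by (auto simp: phi_eq)
qed

lemma uweight_ge_1:
  assumes "i \<in> mindices d"
  shows "1 \<le> uweight B d i"
proof -
  interpret prob_space "nu B d" by (rule prob_space_nu)
  have ae: "AE t in nu B d. (rphi B d i t)\<^sup>2 \<le> (uweight B d i)\<^sup>2"
    using AE_rphi_le[of B d i]
  proof eventually_elim
    case (elim t)
    then show ?case using uweight_nonneg[of B d i] by (simp add: abs_le_square_iff[symmetric])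
  qed
  have "1 = (LINT t|nu B d. (rphi B d i t)\<^sup>2)"
    using rphi_orthonormal[OF assms assms, of B] by (simp add: power2_eq_square)
  also have "\<dots> \<le> (LINT t|nu B d. (uweight B d i)\<^sup>2)"
  proof (rule integral_mono_AE)
    show "integrable (nu B d) (\<lambda>t. (rphi B d i t)\<^sup>2)"
      using ae by (intro integrable_const_bound[where B = "(uweight B d i)\<^sup>2"]) auto
  qed (use ae in auto)
  also have "\<dots> = (uweight B d i)\<^sup>2" by (simp add: prob_space)
  finally have "1\<^sup>2 \<le> (uweight B d i)\<^sup>2" by simp
  then show ?thesis using uweight_nonneg by (rule power2_le_imp_le)
qed

lemma emeasure_nu1_interval_pos:
  assumes "-1 \<le> a" "a < 1"
  shows "emeasure (nu1 B) {a<..<1} \<noteq> 0"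
proof
  have sets: "{a<..<1} \<in> sets (nu1 B)"
    unfolding sets_nu1 by (subst sets_restrict_space_iff) (use assms in auto)
  assume "emeasure (nu1 B) {a<..<1} = 0"
  then have "AE t in nu1 B. t \<notin> {a<..<1}" using sets by (intro AE_not_in) auto
  then have "AE t in restrict_space lborel {-1<..<1}. 0 < density1 B t \<longrightarrow> t \<notin> {a<..<1}"
    unfolding nu1_def by (subst (asm) AE_density) (auto intro: measurable_restrict_space1)
  then have "AE t in lborel. t \<in> {-1<..<1} \<longrightarrow> t \<notin> {a<..<1}"
    by (subst (asm) AE_restrict_space_iff) (auto elim!: AE_mp simp: density1_pos)
  then have "AE t in lborel. t \<notin> {a<..<1}"
  proof eventually_elim
    case (elim t)
    then show ?case using assms by auto
  qed
  then have "emeasure lborel {t \<in> space lborel. \<not> t \<notin> {a<..<1}} = 0"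
    by (subst (asm) AE_iff_measurable[OF _ refl]) auto
  moreover have "{t \<in> space lborel. \<not> t \<notin> {a<..<1}} = {a<..<1}" by auto
  ultimately show False using assms by simp
qed

text \<open>Near the corner \<open>(1, \<dots>, 1)\<close> of the cube the basis function is close to the
  square root of the left-hand side, and every neighbourhood of the corner has positive measure.\<close>

lemma uweight_binary_ge:
  assumes i: "i \<in> mindices d" "\<And>l. i l \<le> 1"
  shows "(1 + alpha B) ^ card {l. i l = 1} \<le> (uweight B d i)\<^sup>2"
proof -
  interpret prob_space "nu B d" by (rule prob_space_nu)
  define c where "c = card {l. i l = 1}"
  define \<kappa> where "\<kappa> = sqrt (1 + alpha B)"
  have \<kappa>: "0 < \<kappa>" unfolding \<kappa>_def by (cases B) auto
  have set: "{l. i l = 1} = {l \<in> {..<d}. i l = 1}"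
    using i(1) by (auto simp: mindices_def) (metis not_less zero_neq_one One_nat_def)
  have step: "(\<kappa> * a) ^ c \<le> uweight B d i" if a: "0 < a" "a < 1" for a
  proof -
    define Q where "Q = PiE {..<d} (\<lambda>_. {a<..<1})"
    have sets: "{a<..<1} \<in> sets (nu1 B)"
      unfolding sets_nu1 by (subst sets_restrict_space_iff) (use a in auto)
    have "emeasure (nu B d) Q = (\<Prod>l<d. emeasure (nu1 B) {a<..<1})"
      unfolding nu_def Q_def using sets by (intro nu1s.emeasure_PiM) auto
    then have Q0: "emeasure (nu B d) Q \<noteq> 0"
      using emeasure_nu1_interval_pos[of a B] a by simp
    have "\<exists>t\<in>Q. \<bar>rphi B d i t\<bar> \<le> uweight B d i"
    proof (rule ccontr)
      assume neg: "\<not> ?thesis"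
      have "AE t in nu B d. t \<notin> Q" using AE_rphi_le[of B d i]
      proof eventually_elim
        case (elim t)
        then show ?case using neg by auto
      qed
      moreover have "Q \<in> sets (nu B d)" unfolding nu_def Q_def using sets by (intro sets_PiM_I_finite) auto
      ultimately have "emeasure (nu B d) Q = 0" by (subst (asm) AE_iff_null_sets[symmetric]) auto
      then show False using Q0 by simp
    qed
    then obtain t where t: "t \<in> Q" "\<bar>rphi B d i t\<bar> \<le> uweight B d i" by blast
    have "(\<kappa> * a) ^ c = (\<Prod>l<d. if i l = 1 then \<kappa> * a else 1)"
      unfolding c_def set by (subst prod.If_cases) (auto simp: Int_def)
    also have "\<dots> \<le> rphi B d i t" unfolding rphi_def
    proof (rule prod_mono)
      fix l assume l: "l \<in> {..<d}"
      have tl: "a < t l" using PiE_mem[OF t(1)[unfolded Q_def] l] by simp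
      show "0 \<le> (if i l = 1 then \<kappa> * a else 1) \<and> (if i l = 1 then \<kappa> * a else 1) \<le> phi1 B (i l) (t l)"
      proof (cases "i l = 1")
        case True
        have "phi1 B (i l) (t l) = \<kappa> * t l" unfolding True phi1_eq onp_1 \<kappa>_def by simp
        then show ?thesis using True \<kappa> a tl by simp
      next
        case False
        then have "i l = 0" using i(2)[of l] by auto
        then show ?thesis by (simp add: phi1_eq onp_0)
      qed
    qed
    also have "\<dots> \<le> uweight B d i" using t(2) by simp
    finally show ?thesis .
  qed
  have "((\<lambda>a. (\<kappa> * a) ^ c) \<longlongrightarrow> (\<kappa> * 1) ^ c) (at_left 1)"
    by (intro tendsto_intros)
  moreover have "\<forall>\<^sub>F a in at_left (1::real). (\<kappa> * a) ^ c \<le> uweight B d i"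
    using eventually_at_left_real[of 0 1] by (auto elim!: eventually_mono intro!: step)
  ultimately have "\<kappa> ^ c \<le> uweight B d i"
    by (intro tendsto_upperbound) (auto simp: trivial_limit_at_left_real)
  then have "(\<kappa> ^ c)\<^sup>2 \<le> (uweight B d i)\<^sup>2" using \<kappa> by (intro power_mono) auto
  moreover have "(\<kappa> ^ c)\<^sup>2 = (1 + alpha B) ^ c"
  proof -
    have "(\<kappa> ^ c)\<^sup>2 = (\<kappa>\<^sup>2) ^ c" by (simp add: power_mult[symmetric] mult.commute)
    moreover have "\<kappa>\<^sup>2 = 1 + alpha B" unfolding \<kappa>_def by (cases B) auto
    ultimately show ?thesis by simp
  qed
  ultimately show ?thesis unfolding c_def by simp
qed

text \<open>The lower bound on \<open>Kfun\<close> comes from the largest cube \<open>{0,1}^k\<close> with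
  \<open>k \<le> d\<close> and \<open>2^k \<le> s\<close>. It satisfies \<open>s \<le> 2^(k + 1)\<close>, by
  the assumption on \<open>s\<close> if \<open>k = d\<close> and by maximality otherwise, and its weight is at
  least \<open>(2 + alpha)^k\<close>, where \<open>2 + alpha = 2 powr gam\<close>.\<close>

lemma Kfun_bounds:
  shows wcard_le_Kfun: "\<lbrakk>lower_set d S; finite S; card S \<le> s\<rbrakk> \<Longrightarrow> wcard (uweight B d) S \<le> Kfun B d s"
    and Kfun_le: "Kfun B d s \<le> real s powr gam B"
    and Kfun_ge: "1 \<le> s \<Longrightarrow> s \<le> 2 ^ (d + 1) \<Longrightarrow> real s powr gam B \<le> 4 * Kfun B d s"
proof -
  define W where "W = {wcard (uweight B d) S |S. lower_set d S \<and> finite S \<and> card S \<le> s}"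
  have "W \<subseteq> wcard (uweight B d) ` Pow (hyp_cross d s)"
    unfolding W_def using lower_set_subset_hyp_cross by blast
  then have fin: "finite W" by (rule finite_subset) (simp add: finite_hyp_cross)
  have "wcard (uweight B d) {} \<in> W" unfolding W_def by (force simp: lower_set_def)
  then have ne: "W \<noteq> {}" by blast
  have K: "Kfun B d s = Max W" by (simp add: Kfun_def W_def)
  show up: "wcard (uweight B d) S \<le> Kfun B d s" if "lower_set d S" "finite S" "card S \<le> s" for S
    unfolding K using fin that by (intro Max_ge) (auto simp: W_def)
  have "w \<le> real s powr gam B" if "w \<in> W" for w
  proof -
    obtain S where S: "w = wcard (uweight B d) S" "lower_set d S" "finite S" "card S \<le> s"
      using \<open>w \<in> W\<close> unfolding W_def by blast
    have "w \<le> (\<Sum>i\<in>S. \<Prod>l<d. sup_sq B (i l))" unfolding S(1) wcard_def by (intro sum_mono uweight_sq_le)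
    also have "\<dots> \<le> real (card S) powr gam B" by (rule lower_set_weight_le[OF S(2,3)])
    also have "\<dots> \<le> real s powr gam B" using S(4) gam_pos[of B] by (intro powr_mono2) auto
    finally show ?thesis .
  qed
  then show "Kfun B d s \<le> real s powr gam B" unfolding K using fin ne by simp
  show "real s powr gam B \<le> 4 * Kfun B d s" if s: "1 \<le> s" "s \<le> 2 ^ (d + 1)"
  proof -
    define k where "k = (GREATEST k. k \<le> d \<and> 2 ^ k \<le> s)"
    have "k \<le> d \<and> 2 ^ k \<le> s" unfolding k_def by (rule GreatestI_nat[of _ 0 d]) (use s in auto)
    then have k: "k \<le> d" "2 ^ k \<le> s" by auto
    have "s \<le> 2 ^ (k + 1)"
    proof (rule ccontr)
      assume neg: "\<not> ?thesis"
      then have "k \<noteq> d" using s(2) by auto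
      then have "k + 1 \<le> d \<and> 2 ^ (k + 1) \<le> s" using k neg by auto
      then have "k + 1 \<le> k" unfolding k_def by (intro Greatest_le_nat[of _ "k + 1" d, unfolded k_def]) auto
      then show False by simp
    qed
    then have "real s \<le> 2 ^ (k + 1)" by (metis of_nat_le_iff of_nat_numeral of_nat_power)
    then have "real s powr gam B \<le> (2 ^ (k + 1)) powr gam B" using gam_pos[of B] by (intro powr_mono2) auto
    also have "\<dots> = (2 powr gam B) ^ (k + 1)"
    proof -
      have "(2 ^ (k + 1)) powr gam B = 2 powr (real (k + 1) * gam B)"
        using powr_realpow[of 2 "k + 1"] powr_powr[of 2 "real (k + 1)" "gam B"] by simp
      also have "\<dots> = (2 powr gam B) ^ (k + 1)"
        using powr_powr[of 2 "gam B" "real (k + 1)"] powr_realpow[of "2 powr gam B" "k + 1"] by (simp add: mult.commute)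
      finally show ?thesis .
    qed
    also have "\<dots> = (2 + alpha B) * (1 + (1 + alpha B)) ^ k" by (simp add: two_powr_gam algebra_simps)
    also have "\<dots> \<le> 4 * (1 + (1 + alpha B)) ^ k" by (cases B) auto
    also have "(1 + (1 + alpha B)) ^ k = (\<Sum>i\<in>cube k. (1 + alpha B) ^ card {l. i l = 1})" by (rule cube_weight[symmetric])
    also have "\<dots> \<le> wcard (uweight B d) (cube k)"
      unfolding wcard_def
    proof (intro sum_mono uweight_binary_ge)
      show "i \<in> mindices d" if "i \<in> cube k" for i using cube_lower(1)[OF k(1)] that by (auto simp: lower_set_def)
      show "i l \<le> 1" if "i \<in> cube k" for i l using that by (auto simp: cube_def)
    qed
    also have "\<dots> \<le> Kfun B d s" using cube_lower[OF k(1)] k(2) by (intro up) auto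
    finally show ?thesis by simp
  qed
qed

section \<open>Completeness of the tensor basis and the uniform norm\<close>

text \<open>The law of \<open>X\<close> under \<open>M\<close> and its law under the probability measure with
  density \<open>1 + G / C\<close> have the same moments. Both live on \<open>[-1,1]\<close>, so the
  exponential series shows that their characteristic functions agree, and Levy's theorem identifies the two
  laws.\<close>

lemma (in prob_space) orthogonal_to_polys_imp_indicator:
  fixes G X :: "'a \<Rightarrow> real"
  assumes G [measurable]: "G \<in> borel_measurable M" and X [measurable]: "X \<in> borel_measurable M"
    and Gb: "AE x in M. \<bar>G x\<bar> \<le> C" and C: "0 < C"
    and Xb: "\<And>x. x \<in> space M \<Longrightarrow> \<bar>X x\<bar> \<le> 1"
    and orth: "\<And>j. (LINT x|M. G x * poly (onp B j) (X x)) = 0"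
    and A [measurable]: "A \<in> sets borel"
  shows "(LINT x|M. G x * indicator A (X x)) = 0"
proof -
  have Gi: "integrable M G" using Gb by (intro integrable_const_bound[where B = C]) auto
  have GXi: "integrable M (\<lambda>x. G x * h x)" if [measurable]: "h \<in> borel_measurable M" and h: "\<And>x. x \<in> space M \<Longrightarrow> \<bar>h x\<bar> \<le> K" for h K
  proof (rule integrable_const_bound[where B = "C * K"])
    show "AE x in M. norm (G x * h x) \<le> C * K"
      using Gb AE_space by eventually_elim (auto simp: abs_mult intro!: mult_mono h)
  qed measurable
  have pm [measurable]: "(\<lambda>x. poly p (X x)) \<in> borel_measurable M" for p
    by (rule measurable_compose[OF X borel_measurable_poly])
  have pb: "\<exists>K. \<forall>x\<in>space M. \<bar>poly p (X x)\<bar> \<le> K" for p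
  proof -
    have "compact (poly p ` {-1..1})" by (intro compact_continuous_image continuous_intros) auto
    then obtain K where K: "\<forall>y\<in>poly p ` {-1..1}. norm y \<le> K"
      using compact_imp_bounded bounded_iff by metis
    have "\<bar>poly p (X x)\<bar> \<le> K" if "x \<in> space M" for x
      using K Xb[OF that] by (auto simp: abs_le_iff)
    then show ?thesis by blast
  qed
  have poly0: "(LINT x|M. G x * poly p (X x)) = 0" for p
  proof -
    obtain c where c: "p = (\<Sum>j\<le>degree p. smult (c j) (onp B j))" using onp_span[of p "degree p" B] by blast
    have i: "integrable M (\<lambda>x. G x * poly (onp B j) (X x))" for j
      using pb[of "onp B j"] GXi[OF pm] by blast
    have "(LINT x|M. G x * poly p (X x)) = (LINT x|M. (\<Sum>j\<le>degree p. c j * (G x * poly (onp B j) (X x))))"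
      by (subst (1) c) (simp add: poly_sum sum_distrib_left mult_ac)
    also have "\<dots> = 0" using i by (simp add: orth)
    finally show ?thesis .
  qed
  \<comment> \<open>the density of the perturbed measure; its mean is 1 because \<open>G\<close> is orthogonal to the constants\<close>
  define r where "r x = 1 + G x / C" for x
  have [measurable]: "r \<in> borel_measurable M" unfolding r_def by measurable
  have r0: "AE x in M. 0 \<le> r x"
    using Gb
  proof eventually_elim
    case (elim x)
    then have "- (G x / C) \<le> 1" using C by (simp add: field_simps abs_le_iff)
    then show ?case by (simp add: r_def)
  qed
  have ri: "integrable M r" unfolding r_def using Gi by simp
  have "(LINT x|M. G x) = 0" using orth[of 0] by (simp add: onp_0)
  then have r1: "(LINT x|M. r x) = 1" unfolding r_def using Gi by (simp add: prob_space)
  define D where "D = density M (\<lambda>x. ennreal (r x))"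
  have D: "prob_space D"
  proof
    have "emeasure D (space D) = (\<integral>\<^sup>+x. ennreal (r x) \<partial>M)"
      unfolding D_def by (subst emeasure_density) (auto intro!: nn_integral_cong simp: indicator_def)
    also have "\<dots> = ennreal (LINT x|M. r x)" using ri r0 by (intro nn_integral_eq_integral) auto
    finally show "emeasure D (space D) = 1" using r1 by simp
  qed
  have XD [measurable]: "X \<in> borel_measurable D" unfolding D_def by simp
  define \<mu>1 \<mu>2 where "\<mu>1 = distr D borel X" and "\<mu>2 = distr M borel X"
  have rd: "real_distribution \<mu>1" "real_distribution \<mu>2"
    unfolding \<mu>1_def \<mu>2_def
    using prob_space.real_distribution_distr[OF D XD] real_distribution_distr[OF X] by auto
  have "char \<mu>1 = char \<mu>2"
  proof
    fix \<theta> :: real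
    have im: "(\<lambda>x::real. iexp (\<theta> * x)) \<in> borel_measurable borel" by measurable
    have iX [measurable]: "(\<lambda>x. iexp (\<theta> * X x)) \<in> borel_measurable M" by measurable
    have c1: "char \<mu>1 \<theta> = (LINT x|M. r x *\<^sub>R iexp (\<theta> * X x))"
    proof -
      have "char \<mu>1 \<theta> = (LINT x|D. iexp (\<theta> * X x))"
        unfolding char_def \<mu>1_def by (rule integral_distr[OF XD im])
      also have "\<dots> = (LINT x|M. r x *\<^sub>R iexp (\<theta> * X x))"
        unfolding D_def by (rule integral_density) (use r0 in auto)
      finally show ?thesis .
    qed
    have c2: "char \<mu>2 \<theta> = (LINT x|M. iexp (\<theta> * X x))"
      unfolding char_def \<mu>2_def by (rule integral_distr[OF X im])
    have ii: "integrable M (\<lambda>x. iexp (\<theta> * X x))" by (rule integrable_const_bound[where B = 1]) auto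
    have Gii: "integrable M (\<lambda>x. complex_of_real (G x) * iexp (\<theta> * X x))"
    proof (rule integrable_const_bound[where B = C])
      show "AE x in M. norm (complex_of_real (G x) * iexp (\<theta> * X x)) \<le> C"
        using Gb by eventually_elim (simp add: norm_mult)
    qed measurable
    define I where "I = (LINT x|M. complex_of_real (G x) * iexp (\<theta> * X x))"
    have small: "cmod I \<le> C * (\<bar>\<theta>\<bar> ^ Suc n / fact (Suc n))" for n
    proof -
      define T where "T x = (\<Sum>k\<le>n. (\<i> * complex_of_real (\<theta> * X x)) ^ k / fact k)" for x
      define P where "P k x = G x * poly (monom 1 k) (X x)" for k x
      have Te: "complex_of_real (G x) * T x = (\<Sum>k\<le>n. (\<i> * \<theta>) ^ k / fact k * complex_of_real (P k x))" for x
        by (simp add: T_def P_def sum_distrib_left poly_monom power_mult_distrib field_simps)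
      have Pi: "integrable M (\<lambda>x. complex_of_real (P k x))" for k
        unfolding P_def using pb[of "monom 1 k"] GXi[OF pm] by (intro integrable_of_real) blast
      have P0: "(LINT x|M. P k x) = 0" for k
        unfolding P_def by (rule poly0)
      have Ti: "integrable M (\<lambda>x. complex_of_real (G x) * T x)"
        unfolding Te using Pi by (intro Bochner_Integration.integrable_sum integrable_mult_right) auto
      have T0: "(LINT x|M. complex_of_real (G x) * T x) = 0"
        unfolding Te using Pi by (subst Bochner_Integration.integral_sum) (auto simp: P0)
      have "cmod I = cmod (LINT x|M. complex_of_real (G x) * (iexp (\<theta> * X x) - T x))"
        unfolding I_def right_diff_distrib using Gii Ti T0 by (subst Bochner_Integration.integral_diff) auto
      also have "\<dots> \<le> (LINT x|M. C * (\<bar>\<theta>\<bar> ^ Suc n / fact (Suc n)))"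
      proof (rule order.trans[OF integral_norm_bound], rule integral_mono_AE)
        show "integrable M (\<lambda>x. cmod (complex_of_real (G x) * (iexp (\<theta> * X x) - T x)))"
          unfolding right_diff_distrib using Gii Ti by (intro integrable_norm Bochner_Integration.integrable_diff)
        show "AE x in M. cmod (complex_of_real (G x) * (iexp (\<theta> * X x) - T x)) \<le> C * (\<bar>\<theta>\<bar> ^ Suc n / fact (Suc n))"
          using Gb AE_space
        proof eventually_elim
          case (elim x)
          have "cmod (iexp (\<theta> * X x) - T x) \<le> \<bar>\<theta> * X x\<bar> ^ Suc n / fact (Suc n)"
            unfolding T_def by (rule iexp_approx1)
          also have "\<dots> \<le> \<bar>\<theta>\<bar> ^ Suc n / fact (Suc n)"
            using Xb[of x] elim by (intro divide_right_mono power_mono) (auto simp: abs_mult mult_left_le)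
          finally have "cmod (iexp (\<theta> * X x) - T x) \<le> \<bar>\<theta>\<bar> ^ Suc n / fact (Suc n)" .
          then show ?case unfolding norm_mult using elim C by (intro mult_mono) auto
        qed
      qed auto
      also have "\<dots> = C * (\<bar>\<theta>\<bar> ^ Suc n / fact (Suc n))" by (simp add: prob_space)
      finally show ?thesis .
    qed
    have "(\<lambda>n. \<bar>\<theta>\<bar> ^ n / fact n) \<longlonglongrightarrow> 0"
      using summable_LIMSEQ_zero[OF summable_exp[of "\<bar>\<theta>\<bar>"]] by (simp add: field_simps)
    then have "(\<lambda>n. C * (\<bar>\<theta>\<bar> ^ Suc n / fact (Suc n))) \<longlonglongrightarrow> C * 0"
      by (intro tendsto_mult tendsto_const LIMSEQ_Suc)
    then have "cmod I \<le> C * 0" using small by (intro LIMSEQ_le_const) auto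
    then have I0: "I = 0" by simp
    have "char \<mu>1 \<theta> = (LINT x|M. iexp (\<theta> * X x) + complex_of_real (G x) * iexp (\<theta> * X x) / complex_of_real C)"
      unfolding c1 r_def by (intro Bochner_Integration.integral_cong) (auto simp: scaleR_conv_of_real algebra_simps add_divide_distrib)
    also have "\<dots> = char \<mu>2 \<theta>"
      using ii Gii I0 unfolding c2 I_def by (subst Bochner_Integration.integral_add) auto
    finally show "char \<mu>1 \<theta> = char \<mu>2 \<theta>" .
  qed
  then have eq: "\<mu>1 = \<mu>2" using Levy_uniqueness rd by blast
  have iA: "integrable M (\<lambda>x. indicat_real A (X x))" by (rule integrable_const_bound[where B = 1]) (auto simp: indicator_def)
  have GiA: "integrable M (\<lambda>x. G x * indicat_real A (X x))" by (rule GXi[of _ 1]) (auto simp: indicator_def)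
  have "(LINT y|\<mu>1. indicat_real A y) = (LINT x|M. r x *\<^sub>R indicat_real A (X x))"
    unfolding \<mu>1_def D_def using r0
    by (subst integral_distr) (auto simp: integral_density)
  also have "\<dots> = (LINT x|M. indicat_real A (X x) + G x * indicat_real A (X x) / C)"
    by (intro Bochner_Integration.integral_cong) (auto simp: r_def algebra_simps)
  also have "\<dots> = (LINT x|M. indicat_real A (X x)) + (LINT x|M. G x * indicat_real A (X x)) / C"
    using iA GiA by (subst Bochner_Integration.integral_add) auto
  also have "(LINT x|M. indicat_real A (X x)) = (LINT y|\<mu>2. indicat_real A y)"
    unfolding \<mu>2_def by (subst integral_distr) auto
  finally show ?thesis using eq C by simp
qed

text \<open>The basis functions are replaced by indicators one coordinate at a time; all factors in the other
  coordinates are part of the bounded function \<open>G\<close> of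
  \<open>orthogonal_to_polys_imp_indicator\<close>.\<close>

lemma orthogonal_to_basis_imp_boxes:
  fixes g :: "(nat \<Rightarrow> real) \<Rightarrow> real"
  assumes g [measurable]: "g \<in> borel_measurable (nu B d)" and gb: "AE t in nu B d. \<bar>g t\<bar> \<le> C" and C: "0 < C"
    and orth: "\<And>i. i \<in> mindices d \<Longrightarrow> (LINT t|nu B d. g t * rphi B d i t) = 0"
    and A: "\<And>l. l < d \<Longrightarrow> A l \<in> sets borel" and k: "k \<le> d"
  shows "(LINT t|nu B d. g t * (\<Prod>l<k. indicator (A l) (t l)) * (\<Prod>l\<in>{k..<d}. phi1 B (i l) (t l))) = 0"
  using k
proof (induction k arbitrary: i)
  case 0
  define i' where "i' l = (if l < d then i l else 0)" for l
  have "i' \<in> mindices d" by (simp add: i'_def mindices_def)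
  moreover have "(\<Prod>l\<in>{0..<d}. phi1 B (i l) (t l)) = rphi B d i' t" for t
    unfolding rphi_def i'_def lessThan_atLeast0 by (intro prod.cong) auto
  ultimately show ?case using orth by simp
next
  case (Suc k)
  interpret prob_space "nu B d" by (rule prob_space_nu)
  have comp: "(\<lambda>t. t l) \<in> measurable (nu B d) (nu1 B)" if "l < d" for l
    unfolding nu_def using that by (intro measurable_component_singleton) simp
  have compb: "(\<lambda>t. h (t l)) \<in> borel_measurable (nu B d)" if "l < d" "h \<in> borel_measurable borel" for l and h :: "real \<Rightarrow> real"
    by (rule measurable_compose[OF comp[OF that(1)] measurable_nu1[OF that(2)]])
  define G where "G t = g t * (\<Prod>l<k. indicator (A l) (t l)) * (\<Prod>l\<in>{Suc k..<d}. phi1 B (i l) (t l))" for t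
  define K where "K = (\<Prod>l\<in>{Suc k..<d}. sqrt (sup_sq B (i l)))"
  have K1: "1 \<le> K" unfolding K_def using sup_sq_pos by (intro prod_ge_1) auto
  have Gm: "G \<in> borel_measurable (nu B d)"
    unfolding G_def using A Suc.prems
    by (intro borel_measurable_times borel_measurable_prod compb g) (auto simp: phi1_eq borel_measurable_poly)
  have Gb: "AE t in nu B d. \<bar>G t\<bar> \<le> C * K"
    using gb AE_space
  proof eventually_elim
    case (elim t)
    have a: "\<bar>(\<Prod>l<k. indicat_real (A l) (t l))\<bar> \<le> 1"
      unfolding abs_prod by (intro prod_le_1) (auto simp: indicator_def)
    have b: "\<bar>(\<Prod>l\<in>{Suc k..<d}. phi1 B (i l) (t l))\<bar> \<le> K"
      unfolding abs_prod K_def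
    proof (intro prod_mono conjI)
      fix l assume "l \<in> {Suc k..<d}"
      then have "-1 < t l" "t l < 1" using elim by (auto simp: space_nu PiE_iff)
      then have "(phi1 B (i l) (t l))\<^sup>2 \<le> sup_sq B (i l)" unfolding phi1_eq by (intro onp_sup_bound) auto
      then show "\<bar>phi1 B (i l) (t l)\<bar> \<le> sqrt (sup_sq B (i l))" by (metis real_sqrt_abs real_sqrt_le_iff)
    qed auto
    have "\<bar>G t\<bar> \<le> C * 1 * K" unfolding G_def abs_mult using elim a b C
      by (intro mult_mono) auto
    then show ?case by simp
  qed
  have kd: "k < d" using Suc.prems by simp
  have split: "{k..<d} = insert k {Suc k..<d}" using kd by auto
  have "(LINT t|nu B d. G t * indicator (A k) (t k)) = 0"
  proof (rule orthogonal_to_polys_imp_indicator[OF Gm _ Gb])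
    show "(\<lambda>t. t k) \<in> borel_measurable (nu B d)" using compb[OF kd, of "\<lambda>x. x"] by simp
    show "0 < C * K" using C K1 by simp
    show "\<bar>t k\<bar> \<le> 1" if "t \<in> space (nu B d)" for t using that kd by (force simp: space_nu PiE_iff)
    show "A k \<in> sets borel" using A kd .
    fix j
    have "(LINT t|nu B d. g t * (\<Prod>l<k. indicator (A l) (t l)) * (\<Prod>l\<in>{k..<d}. phi1 B ((i(k := j)) l) (t l))) = 0"
      using Suc.prems by (intro Suc.IH) simp
    moreover have "(\<Prod>l\<in>{k..<d}. phi1 B ((i(k := j)) l) (t l)) = poly (onp B j) (t k) * (\<Prod>l\<in>{Suc k..<d}. phi1 B (i l) (t l))" for t
      unfolding split by (subst prod.insert) (auto simp: phi1_eq intro!: prod.cong)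
    ultimately show "(LINT t|nu B d. G t * poly (onp B j) (t k)) = 0"
      unfolding G_def by (simp add: mult_ac)
  qed
  then show ?case unfolding G_def by (simp add: mult_ac)
qed

text \<open>For large \<open>K\<close> the probability measure with density \<open>1 + g / K\<close> agrees
  with \<open>nu B d\<close> on all boxes, hence everywhere.\<close>

theorem basis_complete:
  fixes g :: "(nat \<Rightarrow> real) \<Rightarrow> real"
  assumes g [measurable]: "g \<in> borel_measurable (nu B d)" and gb: "AE t in nu B d. \<bar>g t\<bar> \<le> C"
    and orth: "\<And>i. i \<in> mindices d \<Longrightarrow> (LINT t|nu B d. g t * rphi B d i t) = 0"
  shows "AE t in nu B d. g t = 0"
proof -
  interpret prob_space "nu B d" by (rule prob_space_nu)
  define K where "K = \<bar>C\<bar> + 1"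
  have K: "0 < K" by (simp add: K_def)
  have gK: "AE t in nu B d. \<bar>g t\<bar> \<le> K" using gb by eventually_elim (simp add: K_def)
  define r where "r t = 1 + g t / K" for t
  have [measurable]: "r \<in> borel_measurable (nu B d)" unfolding r_def by measurable
  have r0: "AE t in nu B d. 0 \<le> r t"
    using gK
  proof eventually_elim
    case (elim x)
    then have "- (g x / K) \<le> 1" using K by (simp add: field_simps abs_le_iff)
    then show ?case by (simp add: r_def)
  qed
  have "density (nu B d) (\<lambda>t. ennreal (r t)) = PiM {..<d} (\<lambda>_. nu1 B)"
  proof (rule nu1s.PiM_eqI)
    show "sets (density (nu B d) (\<lambda>t. ennreal (r t))) = sets (PiM {..<d} (\<lambda>_. nu1 B))"
      by (simp add: nu_def)
    fix A :: "nat \<Rightarrow> real set" assume A: "\<And>i. i \<in> {..<d} \<Longrightarrow> A i \<in> sets (nu1 B)"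
    have Ab: "A l \<in> sets borel" if "l < d" for l
    proof -
      have "A l \<in> sets (restrict_space borel {-1<..<1})" using A[of l] that sets_nu1 by auto
      then show ?thesis by (subst (asm) sets_restrict_space_iff) auto
    qed
    define Q where "Q = PiE {..<d} A"
    have Qm [measurable]: "Q \<in> sets (nu B d)" unfolding Q_def nu_def using A by (intro sets_PiM_I_finite) auto
    have ind: "indicator Q t = (\<Prod>l<d. indicat_real (A l) (t l))" if "t \<in> space (nu B d)" for t
    proof (cases "t \<in> Q")
      case True
      then have "\<forall>l\<in>{..<d}. indicat_real (A l) (t l) = 1"
        using PiE_mem[of t "{..<d}" A] unfolding Q_def by simp
      then show ?thesis using True by (simp add: prod.neutral)
    next
      case False
      then obtain l where "l \<in> {..<d}" "t l \<notin> A l" using \<open>t \<in> space (nu B d)\<close> unfolding Q_def space_nu PiE_iff by blast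
      then have "(\<Prod>l<d. indicat_real (A l) (t l)) = 0" by (intro prod_zero bexI[of _ l]) auto
      then show ?thesis using False by simp
    qed
    have z: "(LINT t|nu B d. g t * indicator Q t) = 0"
    proof -
      have "(LINT t|nu B d. g t * indicator Q t) = (LINT t|nu B d. g t * (\<Prod>l<d. indicator (A l) (t l)) * (\<Prod>l\<in>{d..<d}. phi1 B 0 (t l)))"
        by (intro Bochner_Integration.integral_cong) (auto simp: ind)
      also have "\<dots> = 0" by (rule orthogonal_to_basis_imp_boxes[where i = "\<lambda>_. 0", OF g gK K]) (use orth Ab in auto)
      finally show ?thesis .
    qed
    have gi: "integrable (nu B d) (\<lambda>t. g t * indicator Q t)"
    proof (rule integrable_const_bound[where B = K])
      show "AE t in nu B d. norm (g t * indicator Q t) \<le> K" using gK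
        by eventually_elim (use K in \<open>auto simp: indicator_def\<close>)
    qed measurable
    have Qi: "integrable (nu B d) (indicat_real Q)" by (rule integrable_const_bound[where B = 1]) (auto simp: indicator_def)
    have "emeasure (density (nu B d) (\<lambda>t. ennreal (r t))) Q = (\<integral>\<^sup>+t. ennreal (r t * indicator Q t) \<partial>nu B d)"
      by (subst emeasure_density) (auto intro!: nn_integral_cong simp: indicator_def)
    also have "\<dots> = ennreal (LINT t|nu B d. r t * indicator Q t)"
    proof (rule nn_integral_eq_integral)
      have "(\<lambda>t. r t * indicator Q t) = (\<lambda>t. indicator Q t + g t * indicator Q t / K)"
        by (auto simp: r_def algebra_simps)
      then show "integrable (nu B d) (\<lambda>t. r t * indicator Q t)" using gi Qi by simp
      show "AE t in nu B d. 0 \<le> r t * indicator Q t" using r0 by eventually_elim auto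
    qed
    also have "(LINT t|nu B d. r t * indicator Q t) = (LINT t|nu B d. indicator Q t + g t * indicator Q t / K)"
      by (intro Bochner_Integration.integral_cong) (auto simp: r_def algebra_simps)
    also have "\<dots> = measure (nu B d) Q" using gi Qi z by (subst Bochner_Integration.integral_add) auto
    also have "ennreal (measure (nu B d) Q) = emeasure (nu B d) Q" by (simp add: emeasure_eq_measure)
    also have "\<dots> = (\<Prod>i\<in>{..<d}. emeasure (nu1 B) (A i))"
      unfolding nu_def Q_def using A by (intro nu1s.emeasure_PiM) auto
    finally show "emeasure (density (nu B d) (\<lambda>t. ennreal (r t))) (Pi\<^sub>E {..<d} A) = (\<Prod>i\<in>{..<d}. emeasure (nu1 B) (A i))"
      unfolding Q_def .
  qed auto
  then have "density (nu B d) (\<lambda>t. ennreal (r t)) = density (nu B d) (\<lambda>t. 1)"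
    by (simp add: nu_def density_1)
  then have "AE t in nu B d. ennreal (r t) = 1"
    by (intro density_unique) auto
  then show ?thesis using r0
  proof eventually_elim
    case (elim t)
    then have "r t = 1" by (simp add: ennreal_eq_1)
    then show ?case using K by (simp add: r_def)
  qed
qed

lemma bij_nat_mindices:
  assumes "1 \<le> d"
  obtains e :: "nat \<Rightarrow> mindex" where "bij_betw e UNIV (mindices d)"
proof -
  have "mindices d = (\<Union>N. hyp_cross d N)" by (auto simp: hyp_cross_def)
  then have c: "countable (mindices d)"
    by (simp add: countable_finite finite_hyp_cross)
  have "inj (\<lambda>k l. if l = 0 then k else (0::nat))"
    by (rule injI) (metis (mono_tags))
  moreover have "range (\<lambda>k l. if l = 0 then k else (0::nat)) \<subseteq> mindices d"
    using assms by (auto simp: mindices_def)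
  ultimately have "infinite (mindices d)"
    using finite_subset range_inj_infinite by blast
  then show ?thesis using bij_betw_from_nat_into[OF c] that by blast
qed

lemma cnj_phi: "cnj (phi B d i t) = phi B d i t"
  by (simp add: phi_eq)

lemma integral_phi_cnj_phi:
  assumes "i \<in> mindices d" "j \<in> mindices d"
  shows "(LINT t|nu B d. phi B d i t * cnj (phi B d j t)) = (if i = j then 1 else 0)"
proof -
  have "(LINT t|nu B d. phi B d i t * cnj (phi B d j t)) = (LINT t|nu B d. complex_of_real (rphi B d i t * rphi B d j t))"
    by (simp add: phi_eq)
  also have "\<dots> = complex_of_real (LINT t|nu B d. rphi B d i t * rphi B d j t)"
    by (rule integral_complex_of_real)
  finally show ?thesis using rphi_orthonormal[OF assms, of B] by simp
qed

lemma integrable_mult_cnj_phi: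
  assumes [measurable]: "f \<in> borel_measurable (nu B d)" and fb: "AE t in nu B d. cmod (f t) \<le> C"
  shows "integrable (nu B d) (\<lambda>t. f t * cnj (phi B d i t))"
proof -
  interpret prob_space "nu B d" by (rule prob_space_nu)
  show ?thesis
  proof (rule integrable_const_bound[where B = "C * uweight B d i"])
    show "AE t in nu B d. norm (f t * cnj (phi B d i t)) \<le> C * uweight B d i"
      using fb AE_rphi_le[of B d i]
    proof eventually_elim
      case (elim t)
      then show ?case unfolding norm_mult by (intro mult_mono order.trans[OF norm_ge_zero elim(1)]) (auto simp: phi_eq)
    qed
  qed (unfold cnj_phi, measurable)
qed

text \<open>If the sum on the right is finite, the expansion of \<open>g\<close> converges uniformly, outside
  a null set, to a function bounded by this sum. That function has the same coefficients as \<open>g\<close>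
  and agrees with \<open>g\<close> almost everywhere by completeness.\<close>

lemma Linf_norm_le_coeff_sum:
  fixes g :: "(nat \<Rightarrow> real) \<Rightarrow> complex"
  assumes d: "1 \<le> d" and g [measurable]: "g \<in> borel_measurable (nu B d)" and gb: "AE t in nu B d. cmod (g t) \<le> C"
  shows "Linf_norm (nu B d) g \<le> (\<Sum>\<^sub>\<infinity>i\<in>mindices d. ennreal (uweight B d i * cmod (coeffs_of B d g i)))"
    (is "_ \<le> ?W")
proof (cases "?W = \<infinity>")
  case True
  then show ?thesis by simp
next
  case False
  interpret prob_space "nu B d" by (rule prob_space_nu)
  obtain e :: "nat \<Rightarrow> mindex" where e: "bij_betw e UNIV (mindices d)" using bij_nat_mindices[OF d] .
  have em: "e n \<in> mindices d" for n using e by (auto simp: bij_betw_def)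
  define z where "z n = coeffs_of B d g (e n)" for n
  define a where "a n = uweight B d (e n) * cmod (z n)" for n
  have a0: "0 \<le> a n" for n by (simp add: a_def uweight_nonneg)
  have "?W = (\<Sum>\<^sub>\<infinity>n\<in>UNIV. ennreal (a n))"
    unfolding a_def z_def by (rule infsum_reindex_bij_betw[OF e, symmetric])
  also have "\<dots> = (\<Sum>n. ennreal (a n))"
    by (intro sums_unique has_sum_imp_sums has_sum_infsum nonneg_summable_on_complete) auto
  finally have W: "?W = (\<Sum>n. ennreal (a n))" .
  have sa: "summable a" 
  proof (rule summable_suminf_not_top[OF a0])
    show "(\<Sum>n. ennreal (a n)) \<noteq> top" using False unfolding W infinity_ennreal_def .
  qed
  define S where "S = (\<Sum>n. a n)"
  have WS: "?W = ennreal S" unfolding W S_def using a0 sa by (rule suminf_ennreal2)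
  have S0: "0 \<le> S" unfolding S_def using sa a0 by (rule suminf_nonneg)
  have good: "AE t in nu B d. \<forall>n. \<bar>rphi B d (e n) t\<bar> \<le> uweight B d (e n)"
    using AE_rphi_le by (simp add: AE_all_countable)
  define T where "T N t = (\<Sum>n<N. z n * phi B d (e n) t)" for N t
  define G where "G t = (\<Sum>n. z n * phi B d (e n) t)" for t
  have [measurable]: "T N \<in> borel_measurable (nu B d)" for N unfolding T_def by measurable
  have [measurable]: "G \<in> borel_measurable (nu B d)" unfolding G_def by measurable
  have term_le: "cmod (z n * phi B d (e n) t) \<le> a n" if "\<forall>n. \<bar>rphi B d (e n) t\<bar> \<le> uweight B d (e n)" for n t
    using that mult_left_mono[of "\<bar>rphi B d (e n) t\<bar>" "uweight B d (e n)" "cmod (z n)"]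
    by (simp add: norm_mult phi_eq a_def mult.commute)
  have lim: "AE t in nu B d. (\<lambda>N. T N t) \<longlonglongrightarrow> G t"
    using good
  proof eventually_elim
    case (elim t)
    have "summable (\<lambda>n. z n * phi B d (e n) t)"
      by (rule summable_comparison_test[OF _ sa]) (use term_le[OF elim] in auto)
    then show ?case unfolding T_def G_def by (rule summable_LIMSEQ)
  qed
  have Tb: "AE t in nu B d. cmod (T N t) \<le> S" for N
    using good
  proof eventually_elim
    case (elim t)
    have "cmod (T N t) \<le> (\<Sum>n<N. a n)" unfolding T_def
      by (intro order.trans[OF norm_sum] sum_mono term_le[OF elim])
    also have "\<dots> \<le> S" unfolding S_def using sa a0 by (intro sum_le_suminf) auto
    finally show ?case .
  qed
  have Gb: "AE t in nu B d. cmod (G t) \<le> S"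
  proof -
    have "AE t in nu B d. \<forall>N. cmod (T N t) \<le> S" using Tb by (simp add: AE_all_countable)
    then show ?thesis using lim
    proof eventually_elim
      case (elim t)
      then show ?case by (intro LIMSEQ_le_const2[OF tendsto_norm[OF elim(2)]]) auto
    qed
  qed
  have coeffG: "(LINT t|nu B d. G t * cnj (phi B d (e k) t)) = z k" for k
  proof -
    have 1: "(\<lambda>N. LINT t|nu B d. T N t * cnj (phi B d (e k) t)) \<longlonglongrightarrow> (LINT t|nu B d. G t * cnj (phi B d (e k) t))"
    proof (rule integral_dominated_convergence[where w = "\<lambda>_. S * uweight B d (e k)"])
      show "AE t in nu B d. (\<lambda>N. T N t * cnj (phi B d (e k) t)) \<longlonglongrightarrow> G t * cnj (phi B d (e k) t)"
        using lim by eventually_elim (intro tendsto_mult tendsto_const)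
      show "AE t in nu B d. norm (T N t * cnj (phi B d (e k) t)) \<le> S * uweight B d (e k)" for N
        using Tb[of N] AE_rphi_le[of B d "e k"]
      proof eventually_elim
        case (elim t)
        then show ?case unfolding norm_mult using S0 by (intro mult_mono) (auto simp: phi_eq)
      qed
    qed (unfold cnj_phi, auto)
    have 2: "(LINT t|nu B d. T N t * cnj (phi B d (e k) t)) = z k" if "k < N" for N
    proof -
      have i: "integrable (nu B d) (\<lambda>t. phi B d (e n) t * cnj (phi B d (e k) t))" for n
        using AE_rphi_le[of B d "e n"] by (intro integrable_mult_cnj_phi[where C = "uweight B d (e n)"]) (auto simp: phi_eq)
      have "(LINT t|nu B d. T N t * cnj (phi B d (e k) t)) = (LINT t|nu B d. (\<Sum>n<N. z n * (phi B d (e n) t * cnj (phi B d (e k) t))))"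
        unfolding T_def by (simp add: sum_distrib_right mult.assoc)
      also have "\<dots> = (\<Sum>n<N. z n * (if e n = e k then 1 else 0))"
        using i em by (subst Bochner_Integration.integral_sum) (auto simp: integral_phi_cnj_phi)
      also have "\<dots> = (\<Sum>n<N. if n = k then z n else 0)"
        using e by (intro sum.cong) (auto simp: bij_betw_def inj_eq)
      also have "\<dots> = z k" using that by simp
      finally show ?thesis .
    qed
    have "(\<lambda>N. LINT t|nu B d. T N t * cnj (phi B d (e k) t)) \<longlonglongrightarrow> z k"
      using eventually_mono[OF eventually_gt_at_top[of k] 2] by (rule tendsto_eventually)
    then show ?thesis using 1 LIMSEQ_unique by blast
  qed
  have diffb: "AE t in nu B d. cmod (g t - G t) \<le> C + S"
    using gb Gb
  proof eventually_elim
    case (elim t)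
    then show ?case using norm_triangle_ineq4[of "g t" "G t"] by linarith
  qed
  have diff0: "(LINT t|nu B d. (g t - G t) * cnj (phi B d i t)) = 0" if "i \<in> mindices d" for i
  proof -
    obtain k where k: "i = e k" using \<open>i \<in> mindices d\<close> e by (auto simp: bij_betw_def)
    have "(LINT t|nu B d. (g t - G t) * cnj (phi B d (e k) t)) = z k - z k"
      unfolding left_diff_distrib using integrable_mult_cnj_phi[OF g gb] integrable_mult_cnj_phi[OF _ Gb] coeffG[of k]
      by (subst Bochner_Integration.integral_diff) (auto simp: z_def coeffs_of_def)
    then show ?thesis by (simp add: k)
  qed
  have di: "integrable (nu B d) (\<lambda>t. (g t - G t) * cnj (phi B d i t))" for i
    using diffb by (intro integrable_mult_cnj_phi) auto
  have "AE t in nu B d. Re (g t - G t) = 0"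
  proof (rule basis_complete)
    show "AE t in nu B d. \<bar>Re (g t - G t)\<bar> \<le> C + S"
      using diffb by eventually_elim (rule order.trans[OF abs_Re_le_cmod])
    show "(LINT t|nu B d. Re (g t - G t) * rphi B d i t) = 0" if "i \<in> mindices d" for i
    proof -
      have "(LINT t|nu B d. Re (g t - G t) * rphi B d i t) = (LINT t|nu B d. Re ((g t - G t) * cnj (phi B d i t)))"
        by (simp add: phi_eq)
      also have "\<dots> = 0" using integral_Re[OF di[of i]] diff0[OF that] by simp
      finally show ?thesis .
    qed
  qed measurable
  moreover have "AE t in nu B d. Im (g t - G t) = 0"
  proof (rule basis_complete)
    show "AE t in nu B d. \<bar>Im (g t - G t)\<bar> \<le> C + S"
      using diffb by eventually_elim (rule order.trans[OF abs_Im_le_cmod])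
    show "(LINT t|nu B d. Im (g t - G t) * rphi B d i t) = 0" if "i \<in> mindices d" for i
    proof -
      have "(LINT t|nu B d. Im (g t - G t) * rphi B d i t) = (LINT t|nu B d. Im ((g t - G t) * cnj (phi B d i t)))"
        by (simp add: phi_eq)
      also have "\<dots> = 0" using integral_Im[OF di[of i]] diff0[OF that] by simp
      finally show ?thesis .
    qed
  qed measurable
  ultimately have "AE t in nu B d. ennreal (cmod (g t)) \<le> ennreal S"
    using Gb
  proof eventually_elim
    case (elim t)
    then have "g t = G t" by (simp add: complex_eq_iff)
    then show ?case using elim(3) by (simp add: ennreal_leI)
  qed
  then show ?thesis unfolding WS Linf_norm_def by (intro esssup_I) measurable
qed

section \<open>A one-sided isometry for random sampling of bounded functions\<close>

lemma exp_le_quadratic: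
  fixes y :: real
  assumes "\<bar>y\<bar> \<le> 1"
  shows "exp y \<le> 1 + y + y\<^sup>2"
proof (cases "0 \<le> y")
  case True
  then show ?thesis using assms by (intro exp_bound) auto
next
  case False
  define z where "z = - y"
  have z: "0 < z" using False by (simp add: z_def)
  have l: "1 + z + z\<^sup>2 / 2 \<le> exp z" using z by (intro exp_lower_Taylor_quadratic) auto
  have pos: "0 < 1 + z + z\<^sup>2 / 2" using z by (simp add: add_pos_nonneg)
  have "1 \<le> 1 + z\<^sup>2 / 2 + z ^ 3 / 2 + z ^ 4 / 2" using z by simp
  also have "\<dots> = (1 - z + z\<^sup>2) * (1 + z + z\<^sup>2 / 2)" by (simp add: field_simps power_numeral_reduce)
  also have "\<dots> \<le> (1 - z + z\<^sup>2) * exp z"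
  proof (rule mult_left_mono[OF l])
    have "0 \<le> (1 - z / 2)\<^sup>2 + 3 / 4 * z\<^sup>2" by simp
    then show "0 \<le> 1 - z + z\<^sup>2" by (simp add: power2_eq_square field_simps)
  qed
  finally have "exp (- z) \<le> 1 - z + z\<^sup>2" by (simp add: exp_minus field_simps)
  then show ?thesis by (simp add: z_def)
qed

text \<open>A form of Hoeffding's lemma for centred variables with finitely many values.\<close>

lemma weighted_mgf_bound:
  fixes w x :: "'b \<Rightarrow> real"
  assumes "finite A" "\<And>a. a \<in> A \<Longrightarrow> 0 \<le> w a" "sum w A = 1" "(\<Sum>a\<in>A. w a * x a) = 0"
    and "\<And>a. a \<in> A \<Longrightarrow> \<bar>x a\<bar> \<le> M" and "M \<le> 1"
  shows "(\<Sum>a\<in>A. w a * exp (x a)) \<le> exp (M\<^sup>2)"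
proof -
  have "(\<Sum>a\<in>A. w a * exp (x a)) \<le> (\<Sum>a\<in>A. w a * (1 + x a + M\<^sup>2))"
  proof (intro sum_mono mult_left_mono)
    fix a assume a: "a \<in> A"
    have "exp (x a) \<le> 1 + x a + (x a)\<^sup>2" using assms(5)[OF a] assms(6) by (intro exp_le_quadratic) auto
    also have "(x a)\<^sup>2 \<le> M\<^sup>2" using assms(5)[OF a] abs_le_square_iff by fastforce
    finally show "exp (x a) \<le> 1 + x a + M\<^sup>2" by simp
  qed (use assms in auto)
  also have "\<dots> = 1 + M\<^sup>2"
    using assms(3,4) by (simp add: distrib_left sum.distrib sum_distrib_right[symmetric])
  also have "\<dots> \<le> exp (M\<^sup>2)" by simp
  finally show ?thesis .
qed

lemma weighted_mean_attained:
  fixes w F :: "'b \<Rightarrow> real"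
  assumes "finite A" "\<And>a. a \<in> A \<Longrightarrow> 0 \<le> w a" "sum w A = 1" "(\<Sum>a\<in>A. w a * F a) \<le> c"
  shows "\<exists>a\<in>A. F a \<le> c"
proof (rule ccontr)
  assume "\<not> ?thesis"
  then have gt: "\<And>a. a \<in> A \<Longrightarrow> c < F a" by (auto simp: not_le)
  obtain b where b: "b \<in> A" "0 < w b"
    using assms(2,3) by (metis less_eq_real_def sum.neutral zero_neq_one)
  have "(\<Sum>a\<in>A. w a * c) < (\<Sum>a\<in>A. w a * F a)"
  proof (rule sum_strict_mono_ex1[OF assms(1)])
    show "\<forall>a\<in>A. w a * c \<le> w a * F a"
      using assms(2) gt by (auto intro!: mult_left_mono dest: less_imp_le)
    show "\<exists>a\<in>A. w a * c < w a * F a" using gt b by (intro bexI[of _ b] mult_strict_left_mono) auto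
  qed
  then show False using assms(3,4) by (simp add: sum_distrib_right[symmetric])
qed

context prob_space
begin

text \<open>The sum of the mean over the population and the mean over the sample. Estimates for it provide a
  single approximant that is good in both senses.\<close>

definition mixed_mean :: "nat \<Rightarrow> (nat \<Rightarrow> 'a) \<Rightarrow> ('a \<Rightarrow> real) \<Rightarrow> real" where
  "mixed_mean m t h = integral\<^sup>L M h + (\<Sum>i<m. h (t i)) / real m"

lemma mixed_mean_mono:
  assumes "integrable M h" "integrable M h'" "\<And>x. x \<in> space M \<Longrightarrow> h x \<le> h' x"
    and "\<And>i. i < m \<Longrightarrow> t i \<in> space M"
  shows "mixed_mean m t h \<le> mixed_mean m t h'"
  unfolding mixed_mean_def using assms
  by (intro add_mono integral_mono divide_right_mono sum_mono) auto

lemma mixed_mean_sum: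
  assumes "\<And>a. a \<in> A \<Longrightarrow> integrable M (h a)"
  shows "mixed_mean m t (\<lambda>x. \<Sum>a\<in>A. w a * h a x) = (\<Sum>a\<in>A. w a * mixed_mean m t (h a))"
proof -
  have "(\<Sum>i<m. \<Sum>a\<in>A. w a * h a (t i)) = (\<Sum>a\<in>A. w a * (\<Sum>i<m. h a (t i)))"
    by (subst sum.swap) (simp add: sum_distrib_left)
  then have "(\<Sum>i<m. \<Sum>a\<in>A. w a * h a (t i)) / real m = (\<Sum>a\<in>A. w a * ((\<Sum>i<m. h a (t i)) / real m))"
    by (simp only: sum_divide_distrib[of _ A] times_divide_eq_right)
  then show ?thesis
    unfolding mixed_mean_def using assms by (simp add: sum.distrib distrib_left)
qed

lemma mixed_mean_cmult: "mixed_mean m t (\<lambda>x. c * h x) = c * mixed_mean m t h"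
  by (simp add: mixed_mean_def sum_distrib_left[symmetric] distrib_left)

lemma integrable_bounded:
  fixes h :: "'a \<Rightarrow> real"
  assumes "h \<in> borel_measurable M" "\<And>x. x \<in> space M \<Longrightarrow> \<bar>h x\<bar> \<le> C"
  shows "integrable M h"
  using assms by (intro integrable_const_bound[where B = C]) auto

text \<open>Markov's inequality for \<open>exp (- X)\<close>, where \<open>X\<close> counts the sample points
  in \<open>S\<close>; the constant is due to \<open>1 - exp (- 1) - 1 / 2 \<ge> 1 / 8\<close>.\<close>

lemma chernoff_lower_tail:
  assumes S [measurable]: "S \<in> sets M"
  shows "measure (\<Pi>\<^sub>M i\<in>{..<m}. M) {t \<in> space (\<Pi>\<^sub>M i\<in>{..<m}. M).
     real (card {i\<in>{..<m}. t i \<in> S}) < real m * measure M S / 2} \<le> exp (- (real m * measure M S / 8))"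
proof -
  define P where "P = measure M S"
  let ?PM = "\<Pi>\<^sub>M i\<in>{..<m}. M"
  interpret PM: prob_space ?PM by (rule prob_space_PiM) (rule prob_space_axioms)
  interpret pp: product_prob_space "\<lambda>_::nat. M" "{..<m}" by unfold_locales
  have P1: "0 \<le> P" "P \<le> 1" by (auto simp: P_def)
  define h :: "'a \<Rightarrow> real" where "h x = exp (- indicator S x)" for x
  have hm [measurable]: "h \<in> borel_measurable M" unfolding h_def by measurable
  have heq: "h x = 1 - (1 - exp (- 1)) * indicator S x" for x by (auto simp: h_def indicator_def)
  have hi: "integrable M h" unfolding heq
    by (intro integrable_bounded[where C=1]) (measurable, auto simp: indicator_def)
  have "integral\<^sup>L M h = 1 - (1 - exp (- 1)) * P"
    unfolding heq P_def
    by (subst Bochner_Integration.integral_diff) (auto simp: prob_space intro!: integrable_mult_right integrable_real_indicator S simp: emeasure_eq_measure)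
  also have "\<dots> \<le> exp (- ((1 - exp (- 1)) * P))" using exp_ge_add_one_self[of "- ((1 - exp (- 1)) * P)"] by simp
  finally have h1: "integral\<^sup>L M h \<le> exp (- ((1 - exp (- 1)) * P))" .
  have h0: "0 \<le> integral\<^sup>L M h" by (simp add: h_def)
  have prodint: "(LINT t|?PM. (\<Prod>i<m. h (t i))) = (integral\<^sup>L M h) ^ m"
    using pp.product_integral_prod[of "{..<m}" "\<lambda>_. h"] hi by simp
  \<comment> \<open>that is \<open>exp 1 \<ge> 8 / 3\<close>, from the quadratic Taylor bound at \<open>1 / 4\<close>\<close>
  have e1: "exp (- 1 :: real) \<le> 3 / 8"
  proof -
    have "(41 / 32 :: real) \<le> exp (1 / 4)" using exp_lower_Taylor_quadratic[of "1/4::real"] by (simp add: power2_eq_square)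
    then have "(41 / 32 :: real) ^ 4 \<le> exp (1 / 4) ^ 4" by (intro power_mono) auto
    also have "\<dots> = exp 1" by (simp add: exp_of_nat_mult[symmetric])
    finally have "8 / 3 \<le> exp (1::real)" by (simp add: power4_eq_xxxx)
    then show ?thesis by (simp add: exp_minus field_simps)
  qed
  define B where "B = {t \<in> space ?PM. real (card {i\<in>{..<m}. t i \<in> S}) < real m * P / 2}"
  have pr: "(\<Prod>i<m. h (t i)) = exp (- real (card {i\<in>{..<m}. t i \<in> S}))" for t
  proof -
    have "(\<Sum>i<m. indicat_real S (t i)) = real (card {i\<in>{..<m}. t i \<in> S})"
      by (simp add: indicator_def sum.If_cases Int_def)
    moreover have "(\<Prod>i<m. h (t i)) = exp (\<Sum>i<m. - indicator S (t i))" by (simp add: h_def exp_sum)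
    ultimately show ?thesis by (simp add: sum_negf)
  qed
  have pm [measurable]: "(\<lambda>t. \<Prod>i<m. h (t i)) \<in> borel_measurable ?PM" by measurable
  have Bm: "B \<in> sets ?PM"
  proof -
    have "B = {t \<in> space ?PM. exp (- (real m * P / 2)) < (\<Prod>i<m. h (t i))}"
      unfolding B_def pr by auto
    also have "\<dots> \<in> sets ?PM" by measurable
    finally show ?thesis .
  qed
  have pint: "integrable ?PM (\<lambda>t. \<Prod>i<m. h (t i))"
    by (rule PM.integrable_const_bound[where B=1]) (auto simp: pr)
  have "measure ?PM B = (LINT t|?PM. indicator B t)" using Bm by simp
  also have "\<dots> \<le> (LINT t|?PM. exp (real m * P / 2) * (\<Prod>i<m. h (t i)))"
  proof (rule integral_mono)
    show "integrable ?PM (indicat_real B)" using Bm by (intro PM.integrable_const_bound[where B=1]) (auto simp: indicator_def)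
    show "indicator B t \<le> exp (real m * P / 2) * (\<Prod>i<m. h (t i))" for t
      unfolding pr by (auto simp: B_def indicator_def exp_add[symmetric])
  qed (use pint in auto)
  also have "\<dots> = exp (real m * P / 2) * (integral\<^sup>L M h) ^ m" by (simp add: prodint)
  also have "\<dots> \<le> exp (real m * P / 2) * exp (- ((1 - exp (- 1)) * P)) ^ m"
    by (intro mult_left_mono power_mono h1 h0) auto
  also have "\<dots> = exp (real m * P / 2 - real m * ((1 - exp (- 1)) * P))"
    by (simp add: exp_of_nat_mult[symmetric] exp_add[symmetric])
  also have "\<dots> \<le> exp (- (real m * P / 8))"
  proof -
    have "real m * P * (1 / 2 - (1 - exp (- 1))) \<le> real m * P * (- (1 / 8))"
      using e1 P1 by (intro mult_left_mono) auto
    then show ?thesis by (simp add: algebra_simps)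
  qed
  finally show ?thesis by (simp add: B_def P_def)
qed

end

text \<open>A function \<open>f\<close> in the convex hull of finitely many atoms bounded by \<open>R\<close>.
  By Maurey's method \<open>f\<close> is approximated by an average of \<open>q\<close> atoms, drawn with the
  probabilities \<open>w\<close>. The random choice is replaced by a successive choice of atoms that keeps an
  exponential moment of the deviation small.\<close>

locale convex_combination = prob_space M for M :: "'a measure" +
  fixes A :: "'b set" and w :: "'b \<Rightarrow> real" and \<Psi> :: "'b \<Rightarrow> 'a \<Rightarrow> real" and f :: "'a \<Rightarrow> real" and R :: real
  assumes A: "finite A" and w: "\<And>a. a \<in> A \<Longrightarrow> 0 \<le> w a" "sum w A = 1"
    and \<Psi>_measurable [measurable]: "\<And>a. a \<in> A \<Longrightarrow> \<Psi> a \<in> borel_measurable M"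
    and \<Psi>_bound: "\<And>a x. a \<in> A \<Longrightarrow> x \<in> space M \<Longrightarrow> \<bar>\<Psi> a x\<bar> \<le> R"
    and f: "\<And>x. f x = (\<Sum>a\<in>A. w a * \<Psi> a x)"
begin

lemma f_measurable [measurable]: "f \<in> borel_measurable M"
  unfolding f by measurable

lemma f_bound:
  assumes "x \<in> space M"
  shows "\<bar>f x\<bar> \<le> R"
proof -
  have "\<bar>f x\<bar> \<le> (\<Sum>a\<in>A. w a * R)" unfolding f
    by (intro order.trans[OF sum_abs] sum_mono) (auto simp: abs_mult w intro!: mult_left_mono \<Psi>_bound assms)
  then show ?thesis using w(2) by (simp add: sum_distrib_right[symmetric])
qed

definition deviation :: "nat \<Rightarrow> (nat \<Rightarrow> 'b) \<Rightarrow> 'a \<Rightarrow> real" where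
  "deviation q a x = (\<Sum>r<q. \<Psi> (a r) x - f x)"

lemma deviation_measurable: "a \<in> {..<q} \<rightarrow>\<^sub>E A \<Longrightarrow> deviation q a \<in> borel_measurable M"
  unfolding deviation_def[abs_def] by (intro borel_measurable_sum borel_measurable_diff f_measurable \<Psi>_measurable) auto

lemma atom_deviation: "b \<in> A \<Longrightarrow> x \<in> space M \<Longrightarrow> \<bar>\<Psi> b x - f x\<bar> \<le> 2 * R"
  using \<Psi>_bound[of b x] f_bound[of x] by linarith

lemma deviation_bound:
  assumes "a \<in> {..<q} \<rightarrow>\<^sub>E A" "x \<in> space M"
  shows "\<bar>deviation q a x\<bar> \<le> real q * (2 * R)"
proof -
  have "\<bar>deviation q a x\<bar> \<le> (\<Sum>r<q. 2 * R)" unfolding deviation_def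
    using assms by (intro order.trans[OF sum_abs] sum_mono atom_deviation) auto
  then show ?thesis by simp
qed

lemma deviation_Suc: "deviation (Suc q) (a(q := b)) x = deviation q a x + (\<Psi> b x - f x)"
  unfolding deviation_def by simp

definition two_sided_exp :: "real \<Rightarrow> real" where
  "two_sided_exp y = exp y + exp (- y)"

lemma two_sided_exp_le: "\<bar>y\<bar> \<le> C \<Longrightarrow> \<bar>two_sided_exp y\<bar> \<le> 2 * exp C"
proof -
  assume "\<bar>y\<bar> \<le> C"
  then have "exp y \<le> exp C" "exp (- y) \<le> exp C" by auto
  moreover have "0 < exp y" "0 < exp (- y)" by auto
  ultimately show ?thesis unfolding two_sided_exp_def by linarith
qed

lemma integrable_deviation:
  assumes a: "a \<in> {..<q} \<rightarrow>\<^sub>E A" and \<theta>: "0 \<le> \<theta>"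
  shows "integrable M (\<lambda>x. two_sided_exp (\<theta> * deviation q a x))"
proof (rule integrable_bounded[where C = "2 * exp (\<theta> * (real q * (2 * R)))"])
  show "(\<lambda>x. two_sided_exp (\<theta> * deviation q a x)) \<in> borel_measurable M"
    using deviation_measurable[OF a] unfolding two_sided_exp_def by measurable
  show "\<bar>two_sided_exp (\<theta> * deviation q a x)\<bar> \<le> 2 * exp (\<theta> * (real q * (2 * R)))" if "x \<in> space M" for x
    using deviation_bound[OF a that] \<theta> by (intro two_sided_exp_le) (simp add: abs_mult mult_left_mono)
qed

text \<open>Appending an atom drawn from \<open>w\<close> raises the expected exponential moment at most by
  the factor \<open>exp (4 * \<theta>\<^sup>2 * R\<^sup>2)\<close>; some atom does at least as well as this
  average.\<close>

lemma derandomised_mgf: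
  assumes \<theta>: "0 \<le> \<theta>" "2 * R * \<theta> \<le> 1" and m: "0 < m" and t: "\<And>i. i < m \<Longrightarrow> t i \<in> space M"
  shows "\<exists>a \<in> {..<q} \<rightarrow>\<^sub>E A. mixed_mean m t (\<lambda>x. two_sided_exp (\<theta> * deviation q a x))
      \<le> 4 * exp (4 * real q * \<theta>\<^sup>2 * R\<^sup>2)"
proof (induction q)
  case 0
  show ?case using m by (simp add: mixed_mean_def prob_space deviation_def two_sided_exp_def)
next
  case (Suc q)
  then obtain a where a: "a \<in> {..<q} \<rightarrow>\<^sub>E A"
    and IH: "mixed_mean m t (\<lambda>x. two_sided_exp (\<theta> * deviation q a x)) \<le> 4 * exp (4 * real q * \<theta>\<^sup>2 * R\<^sup>2)" by blast
  define P where "P b x = two_sided_exp (\<theta> * deviation (Suc q) (a(q := b)) x)" for b x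
  define Q where "Q x = two_sided_exp (\<theta> * deviation q a x)" for x
  have a': "a(q := b) \<in> {..<Suc q} \<rightarrow>\<^sub>E A" if "b \<in> A" for b
    using a that by (auto simp: PiE_iff extensional_def less_Suc_eq)
  have Qi: "integrable M Q" unfolding Q_def by (rule integrable_deviation[OF a \<theta>(1)])
  have Pi: "integrable M (P b)" if "b \<in> A" for b
    unfolding P_def by (rule integrable_deviation[OF a'[OF that] \<theta>(1)])
  have step: "(\<Sum>b\<in>A. w b * P b x) \<le> exp (4 * \<theta>\<^sup>2 * R\<^sup>2) * Q x" if x: "x \<in> space M" for x
  proof -
    let ?D = "deviation q a x"
    have z: "(\<Sum>b\<in>A. w b * (s * (\<Psi> b x - f x))) = 0" for s
    proof -
      have "(\<Sum>b\<in>A. w b * (s * (\<Psi> b x - f x))) = s * ((\<Sum>b\<in>A. w b * \<Psi> b x) - (\<Sum>b\<in>A. w b) * f x)"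
        by (simp add: sum_distrib_left sum_distrib_right sum_subtractf algebra_simps)
      then show ?thesis using f[of x] w(2) by simp
    qed
    have e: "(\<Sum>b\<in>A. w b * exp (s * (\<Psi> b x - f x))) \<le> exp (4 * \<theta>\<^sup>2 * R\<^sup>2)" if s: "\<bar>s\<bar> = \<theta>" for s
    proof -
      have "(\<Sum>b\<in>A. w b * exp (s * (\<Psi> b x - f x))) \<le> exp ((\<theta> * (2 * R))\<^sup>2)"
      proof (intro weighted_mgf_bound A w z)
        show "\<bar>s * (\<Psi> b x - f x)\<bar> \<le> \<theta> * (2 * R)" if "b \<in> A" for b
          unfolding abs_mult s using atom_deviation[OF that x] \<theta>(1) by (intro mult_left_mono) auto
        show "\<theta> * (2 * R) \<le> 1" using \<theta>(2) by (simp add: mult.commute)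
      qed
      then show ?thesis by (simp add: power_mult_distrib algebra_simps)
    qed
    have "(\<Sum>b\<in>A. w b * P b x) = exp (\<theta> * ?D) * (\<Sum>b\<in>A. w b * exp (\<theta> * (\<Psi> b x - f x)))
        + exp (- (\<theta> * ?D)) * (\<Sum>b\<in>A. w b * exp ((-\<theta>) * (\<Psi> b x - f x)))"
      by (simp add: P_def deviation_Suc two_sided_exp_def sum_distrib_left sum.distrib[symmetric] distrib_left exp_add[symmetric] algebra_simps)
    also have "\<dots> \<le> exp (\<theta> * ?D) * exp (4 * \<theta>\<^sup>2 * R\<^sup>2) + exp (- (\<theta> * ?D)) * exp (4 * \<theta>\<^sup>2 * R\<^sup>2)"
      using \<theta>(1) by (intro add_mono mult_left_mono e) auto
    finally show ?thesis by (simp add: Q_def two_sided_exp_def algebra_simps)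
  qed
  have "(\<Sum>b\<in>A. w b * mixed_mean m t (P b)) = mixed_mean m t (\<lambda>x. \<Sum>b\<in>A. w b * P b x)"
    using Pi by (simp add: mixed_mean_sum)
  also have "\<dots> \<le> mixed_mean m t (\<lambda>x. exp (4 * \<theta>\<^sup>2 * R\<^sup>2) * Q x)"
    using Pi Qi by (intro mixed_mean_mono step t) auto
  also have "\<dots> \<le> exp (4 * \<theta>\<^sup>2 * R\<^sup>2) * (4 * exp (4 * real q * \<theta>\<^sup>2 * R\<^sup>2))"
    using IH by (simp add: mixed_mean_cmult Q_def)
  also have "\<dots> = 4 * exp (4 * real (Suc q) * \<theta>\<^sup>2 * R\<^sup>2)"
    by (simp add: exp_add[symmetric] algebra_simps)
  finally have "\<exists>b\<in>A. mixed_mean m t (P b) \<le> 4 * exp (4 * real (Suc q) * \<theta>\<^sup>2 * R\<^sup>2)"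
    by (intro weighted_mean_attained[where w = w] A w)
  then show ?case unfolding P_def[abs_def] using a' by blast
qed

definition atom_mean :: "nat \<Rightarrow> (nat \<Rightarrow> 'b) \<Rightarrow> 'a \<Rightarrow> real" where
  "atom_mean q a x = (\<Sum>r<q. \<Psi> (a r) x) / real q"

text \<open>The exponential moment of \<open>derandomised_mgf\<close> turned into a tail bound by Markov's
  inequality, simultaneously for the population and for the sample.\<close>

lemma maurey_approximation:
  assumes \<tau>: "0 < \<tau>" "\<tau> \<le> R" and m: "0 < m" and t: "\<And>i. i < m \<Longrightarrow> t i \<in> space M" and q: "0 < q"
  shows "\<exists>a \<in> {..<q} \<rightarrow>\<^sub>E A. measure M {x \<in> space M. \<tau> / 4 \<le> \<bar>f x - atom_mean q a x\<bar>} +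
      real (card {i\<in>{..<m}. \<tau> / 4 \<le> \<bar>f (t i) - atom_mean q a (t i)\<bar>}) / real m
      \<le> 4 * exp (- (real q * \<tau>\<^sup>2 / (256 * R\<^sup>2)))"
proof -
  \<comment> \<open>minimises the exponent \<open>4 q \<theta>\<^sup>2 R\<^sup>2 - \<theta> q \<tau> / 4\<close>\<close>
  define \<theta> where "\<theta> = \<tau> / (32 * R\<^sup>2)"
  have R: "0 < R" using \<tau> by linarith
  have \<theta>0: "0 < \<theta>" using \<tau> R by (simp add: \<theta>_def)
  have "2 * R * \<theta> = (\<tau> / R) / 16" using R by (simp add: \<theta>_def power2_eq_square)
  also have "\<dots> \<le> 1" using \<tau> R by (simp add: divide_le_eq)
  finally have \<theta>1: "2 * R * \<theta> \<le> 1" .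
  obtain a where a: "a \<in> {..<q} \<rightarrow>\<^sub>E A"
    and le: "mixed_mean m t (\<lambda>x. two_sided_exp (\<theta> * deviation q a x)) \<le> 4 * exp (4 * real q * \<theta>\<^sup>2 * R\<^sup>2)"
    using derandomised_mgf[OF less_imp_le[OF \<theta>0] \<theta>1 m, of t q] t by blast
  let ?D = "deviation q a"
  have [measurable]: "?D \<in> borel_measurable M" by (rule deviation_measurable[OF a])
  define E where "E = {x \<in> space M. \<tau> / 4 \<le> \<bar>f x - atom_mean q a x\<bar>}"
  have Deq: "\<bar>?D x\<bar> = real q * \<bar>f x - atom_mean q a x\<bar>" for x
  proof -
    have "?D x = - (real q * (f x - atom_mean q a x))"
      using q by (simp add: deviation_def atom_mean_def sum_subtractf field_simps)
    then show ?thesis by (simp add: abs_mult)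
  qed
  have Eeq: "E = {x \<in> space M. real q * \<tau> / 4 \<le> \<bar>?D x\<bar>}"
    unfolding E_def Deq using q by (auto simp: field_simps)
  have Em [measurable]: "E \<in> sets M" unfolding Eeq by measurable
  define c where "c = exp (- (\<theta> * (real q * \<tau> / 4)))"
  have ind: "indicator E x \<le> c * two_sided_exp (\<theta> * ?D x)" for x
  proof (cases "x \<in> E")
    case True
    then have "real q * \<tau> / 4 \<le> ?D x \<or> real q * \<tau> / 4 \<le> - ?D x" unfolding Eeq by auto
    then have "\<theta> * (real q * \<tau> / 4) \<le> \<theta> * ?D x \<or> \<theta> * (real q * \<tau> / 4) \<le> - (\<theta> * ?D x)"
      using \<theta>0 by (metis mult_left_mono less_imp_le mult_minus_right)
    then have "1 \<le> c * exp (\<theta> * ?D x) \<or> 1 \<le> c * exp (- (\<theta> * ?D x))"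
      unfolding c_def exp_add[symmetric] one_le_exp_iff by argo
    moreover have "0 < c * exp (\<theta> * ?D x)" "0 < c * exp (- (\<theta> * ?D x))" by (simp_all add: c_def)
    ultimately show ?thesis using True by (auto simp: distrib_left two_sided_exp_def)
  next
    case False then show ?thesis by (simp add: c_def two_sided_exp_def add_nonneg_nonneg)
  qed
  have "measure M E + real (card {i\<in>{..<m}. \<tau> / 4 \<le> \<bar>f (t i) - atom_mean q a (t i)\<bar>}) / real m
     = mixed_mean m t (indicator E)"
  proof -
    have "(\<Sum>i<m. indicat_real E (t i)) = (\<Sum>i<m. if \<tau> / 4 \<le> \<bar>f (t i) - atom_mean q a (t i)\<bar> then 1 else 0)"
      using t by (intro sum.cong) (auto simp: E_def indicator_def)
    also have "\<dots> = real (card {i\<in>{..<m}. \<tau> / 4 \<le> \<bar>f (t i) - atom_mean q a (t i)\<bar>})"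
      by (simp add: sum.If_cases Int_def)
    finally show ?thesis by (simp add: mixed_mean_def)
  qed
  also have "\<dots> \<le> mixed_mean m t (\<lambda>x. c * two_sided_exp (\<theta> * ?D x))"
    using integrable_deviation[OF a, of \<theta>] \<theta>0
    by (intro mixed_mean_mono t ind integrable_mult_right) (auto intro!: integrable_bounded[where C=1] simp: indicator_def)
  also have "\<dots> \<le> c * (4 * exp (4 * real q * \<theta>\<^sup>2 * R\<^sup>2))"
    using le by (simp add: mixed_mean_cmult c_def)
  also have "\<dots> = 4 * exp (- (\<theta> * (real q * \<tau> / 4)) + 4 * real q * \<theta>\<^sup>2 * R\<^sup>2)"
    by (simp add: c_def exp_add[symmetric])
  also have "- (\<theta> * (real q * \<tau> / 4)) + 4 * real q * \<theta>\<^sup>2 * R\<^sup>2 = - (real q * \<tau>\<^sup>2 / (256 * R\<^sup>2))"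
    using R by (simp add: \<theta>_def field_simps power2_eq_square)
  finally show ?thesis using a unfolding E_def by blast
qed

text \<open>Values of \<open>f\<close> above \<open>\<tau>\<close> are values of an average \<open>g\<close>
  of atoms above \<open>3 / 4 * \<tau>\<close>, up to a set of measure at most \<open>p / 4\<close>. The
  frequency of the latter values in the sample is at least half of their probability, and they are in turn
  values of \<open>f\<close> above \<open>\<tau> / 2\<close> up to at most \<open>m p / 4\<close> sample
  points.\<close>

lemma level_transfer:
  assumes \<tau>: "0 < \<tau>" "\<tau> \<le> R" and m: "0 < m" and t: "\<And>i. i < m \<Longrightarrow> t i \<in> space M" and q: "0 < q"
    and good: "\<And>a. a \<in> {..<q} \<rightarrow>\<^sub>E A \<Longrightarrow>
       3 / 4 * pmin \<le> measure M {x \<in> space M. 3 / 4 * \<tau> \<le> \<bar>atom_mean q a x\<bar>} \<Longrightarrow>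
       real m * measure M {x \<in> space M. 3 / 4 * \<tau> \<le> \<bar>atom_mean q a x\<bar>} / 2 \<le>
       real (card {l\<in>{..<m}. t l \<in> {x \<in> space M. 3 / 4 * \<tau> \<le> \<bar>atom_mean q a x\<bar>}})"
    and p: "p = measure M {x \<in> space M. \<tau> \<le> \<bar>f x\<bar>}" and pmin: "pmin \<le> p"
    and q_large: "4 * exp (- (real q * \<tau>\<^sup>2 / (256 * R\<^sup>2))) \<le> pmin / 4"
  shows "real m * p / 8 \<le> real (card {l\<in>{..<m}. \<tau> / 2 \<le> \<bar>f (t l)\<bar>})"
proof -
  obtain a where a: "a \<in> {..<q} \<rightarrow>\<^sub>E A" and le:
     "measure M {x \<in> space M. \<tau> / 4 \<le> \<bar>f x - atom_mean q a x\<bar>} +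
      real (card {i\<in>{..<m}. \<tau> / 4 \<le> \<bar>f (t i) - atom_mean q a (t i)\<bar>}) / real m
      \<le> 4 * exp (- (real q * \<tau>\<^sup>2 / (256 * R\<^sup>2)))"
    using maurey_approximation[OF \<tau> m _ q, of t] t by blast
  define g where "g = atom_mean q a"
  have aA: "a r \<in> A" if "r < q" for r using a that by auto
  have [measurable]: "g \<in> borel_measurable M" unfolding g_def atom_mean_def[abs_def] using aA by measurable
  define c where "c = real (card {i\<in>{..<m}. \<tau> / 4 \<le> \<bar>f (t i) - g (t i)\<bar>})"
  have c0: "0 \<le> c / real m" by (simp add: c_def)
  have le': "measure M {x \<in> space M. \<tau> / 4 \<le> \<bar>f x - g x\<bar>} + c / real m \<le> p / 4"
    using le q_large pmin unfolding g_def c_def by linarith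
  have "p \<le> measure M ({x \<in> space M. 3 / 4 * \<tau> \<le> \<bar>g x\<bar>} \<union> {x \<in> space M. \<tau> / 4 \<le> \<bar>f x - g x\<bar>})"
  proof -
    have "3 / 4 * \<tau> \<le> \<bar>g x\<bar> \<or> \<tau> / 4 \<le> \<bar>f x - g x\<bar>" if "\<tau> \<le> \<bar>f x\<bar>" for x
      using that by linarith
    then show ?thesis unfolding p by (intro finite_measure_mono) auto
  qed
  also have "\<dots> \<le> measure M {x \<in> space M. 3 / 4 * \<tau> \<le> \<bar>g x\<bar>} + measure M {x \<in> space M. \<tau> / 4 \<le> \<bar>f x - g x\<bar>}"
    by (intro measure_Un_le) auto
  finally have pg: "3 / 4 * p \<le> measure M {x \<in> space M. 3 / 4 * \<tau> \<le> \<bar>g x\<bar>}"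
    using le' c0 by linarith
  have "real m * (3 / 4 * p) / 2 \<le> real m * measure M {x \<in> space M. 3 / 4 * \<tau> \<le> \<bar>g x\<bar>} / 2"
    using pg by (intro divide_right_mono mult_left_mono) auto
  also have "\<dots> \<le> real (card {l\<in>{..<m}. t l \<in> {x \<in> space M. 3 / 4 * \<tau> \<le> \<bar>g x\<bar>}})"
    using good[OF a] pg pmin unfolding g_def by simp
  also have "\<dots> \<le> real (card ({l\<in>{..<m}. \<tau> / 2 \<le> \<bar>f (t l)\<bar>} \<union> {i\<in>{..<m}. \<tau> / 4 \<le> \<bar>f (t i) - g (t i)\<bar>}))"
  proof (intro of_nat_mono card_mono)
    have "\<tau> / 2 \<le> \<bar>f x\<bar> \<or> \<tau> / 4 \<le> \<bar>f x - g x\<bar>" if "3 / 4 * \<tau> \<le> \<bar>g x\<bar>" for x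
      using that by linarith
    then show "{l \<in> {..<m}. t l \<in> {x \<in> space M. 3 / 4 * \<tau> \<le> \<bar>g x\<bar>}}
      \<subseteq> {l \<in> {..<m}. \<tau> / 2 \<le> \<bar>f (t l)\<bar>} \<union> {i \<in> {..<m}. \<tau> / 4 \<le> \<bar>f (t i) - g (t i)\<bar>}" by auto
  qed auto
  also have "\<dots> \<le> real (card {l\<in>{..<m}. \<tau> / 2 \<le> \<bar>f (t l)\<bar>}) + c"
    unfolding c_def of_nat_add[symmetric] by (intro of_nat_mono card_Un_le)
  finally have 1: "real m * (3 / 4 * p) / 2 \<le> real (card {l\<in>{..<m}. \<tau> / 2 \<le> \<bar>f (t l)\<bar>}) + c" .
  have "c / real m \<le> p / 4" using le' measure_nonneg[of M "{x \<in> space M. \<tau> / 4 \<le> \<bar>f x - g x\<bar>}"] by linarith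
  then have "c \<le> p / 4 * real m" using m by (simp add: pos_divide_le_eq)
  then show ?thesis using 1 by (simp add: algebra_simps)
qed

end

text \<open>If \<open>y \<ge> 1 / 2\<close>, the last level \<open>k\<close> that counts satisfies \<open>y <
  2^k\<close>.\<close>

lemma dyadic_upper:
  fixes y :: real
  assumes "0 \<le> y" "y < 2 ^ L / 2"
  shows "y\<^sup>2 \<le> 1 / 4 + (\<Sum>k<L. 4 ^ k * of_bool (2 ^ k / 2 \<le> y))"
  using assms(2)
proof (induction L)
  case 0
  then have "y < 1 / 2" by simp
  then have "y\<^sup>2 \<le> (1 / 2)\<^sup>2" using assms(1) by (intro power_mono) auto
  then show ?case by (simp add: power2_eq_square)
next
  case (Suc L)
  show ?case
  proof (cases "2 ^ L / 2 \<le> y")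
    case True
    have "y\<^sup>2 \<le> (2 ^ L)\<^sup>2" using assms(1) Suc.prems by (intro power_mono) auto
    also have "(2 ^ L)\<^sup>2 = (4 ^ L :: real)" by (simp add: power2_eq_square power_mult_distrib[symmetric])
    finally show ?thesis using True by (auto intro!: add_increasing sum_nonneg)
  next
    case False
    then show ?thesis using Suc.IH by simp
  qed
qed

text \<open>A geometric series is dominated by its last term.\<close>

lemma dyadic_lower:
  fixes y :: real
  assumes "0 \<le> y"
  shows "(\<Sum>k<L. 4 ^ k * of_bool (2 ^ k / 4 \<le> y)) \<le> 64 / 3 * y\<^sup>2"
proof -
  have geo: "(\<Sum>k<L. 4 ^ k :: real) \<le> 4 ^ L / 3" for L
    by (induction L) auto
  show ?thesis
  proof (induction L)
    case 0
    show ?case by simp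
  next
    case (Suc L)
    show ?case
    proof (cases "2 ^ L / 4 \<le> y")
      case True
      have "(\<Sum>k<Suc L. 4 ^ k * of_bool (2 ^ k / 4 \<le> y)) \<le> (\<Sum>k<Suc L. 4 ^ k :: real)"
        by (intro sum_mono) auto
      also have "\<dots> \<le> 64 / 3 * (2 ^ L / 4)\<^sup>2"
        using geo[of "Suc L"] by (simp add: power2_eq_square power_mult_distrib[symmetric])
      also have "\<dots> \<le> 64 / 3 * y\<^sup>2" using True by (intro mult_left_mono power_mono) auto
      finally show ?thesis .
    next
      case False
      then show ?thesis using Suc.IH by simp
    qed
  qed
qed

context prob_space
begin

text \<open>The union bound over the events of \<open>chernoff_lower_tail\<close>; sets that are too rare are
  exempt.\<close>

lemma empirical_frequency_lower_bound:
  fixes B :: "'i \<Rightarrow> 'a set" and m :: nat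
  assumes I: "finite I" and B: "\<And>i. i \<in> I \<Longrightarrow> B i \<in> sets M"
  defines "PM \<equiv> \<Pi>\<^sub>M i\<in>{..<m}. M"
  shows "\<exists>E \<in> sets PM. 1 - (\<Sum>i\<in>I. exp (- (real m * p i / 8))) \<le> measure PM E \<and>
    (\<forall>t\<in>E. \<forall>i\<in>I. p i \<le> measure M (B i) \<longrightarrow>
       real m * measure M (B i) / 2 \<le> real (card {l\<in>{..<m}. t l \<in> B i}))"
proof -
  interpret PM: prob_space PM unfolding PM_def by (rule prob_space_PiM) (rule prob_space_axioms)
  define F where "F i = (if p i \<le> measure M (B i) then {t \<in> space PM.
     real (card {l\<in>{..<m}. t l \<in> B i}) < real m * measure M (B i) / 2} else {})" for i
  have Fm: "F i \<in> sets PM" if "i \<in> I" for i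
  proof -
    have [measurable]: "B i \<in> sets M" using B that .
    have "(\<lambda>t. real (card {l\<in>{..<m}. t l \<in> B i})) = (\<lambda>t. \<Sum>l<m. indicator (B i) (t l))"
      by (simp add: indicator_def sum.If_cases Int_def)
    moreover have "(\<lambda>t. \<Sum>l<m. indicat_real (B i) (t l)) \<in> borel_measurable PM"
      unfolding PM_def by measurable
    ultimately have [measurable]: "(\<lambda>t. real (card {l\<in>{..<m}. t l \<in> B i})) \<in> borel_measurable PM"
      by simp
    have "{t \<in> space PM. real (card {l\<in>{..<m}. t l \<in> B i}) < real m * measure M (B i) / 2} \<in> sets PM"
      by measurable
    then show ?thesis unfolding F_def
      by (cases "p i \<le> measure M (B i)") (simp_all only: if_True if_False sets.empty_sets)
  qed
  have Fp: "measure PM (F i) \<le> exp (- (real m * p i / 8))" if "i \<in> I" for i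
  proof (cases "p i \<le> measure M (B i)")
    case True
    have "measure PM (F i) \<le> exp (- (real m * measure M (B i) / 8))"
      using chernoff_lower_tail[OF B[OF that], of m] True by (simp add: F_def PM_def)
    also have "\<dots> \<le> exp (- (real m * p i / 8))" using True by (simp add: mult_left_mono)
    finally show ?thesis .
  qed (simp add: F_def)
  define E where "E = space PM - (\<Union>i\<in>I. F i)"
  have UF: "(\<Union>i\<in>I. F i) \<in> sets PM" using I Fm by (intro sets.finite_UN) auto
  have "measure PM (\<Union>i\<in>I. F i) \<le> (\<Sum>i\<in>I. measure PM (F i))"
    using I Fm by (intro PM.finite_measure_subadditive_finite) auto
  also have "\<dots> \<le> (\<Sum>i\<in>I. exp (- (real m * p i / 8)))" by (intro sum_mono Fp)
  finally have "1 - (\<Sum>i\<in>I. exp (- (real m * p i / 8))) \<le> measure PM E"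
    unfolding E_def using PM.prob_compl[OF UF] by simp
  moreover have "E \<in> sets PM" unfolding E_def using UF by auto
  moreover have "real m * measure M (B i) / 2 \<le> real (card {l\<in>{..<m}. t l \<in> B i})"
    if "t \<in> E" "i \<in> I" "p i \<le> measure M (B i)" for t i
    using that by (auto simp: E_def F_def not_less)
  ultimately show ?thesis by blast
qed

text \<open>There are \<open>(2 * n) ^ q k\<close> averages at level \<open>k\<close>, each with a set of
  probability at least a constant over \<open>L * 4^k\<close>. As \<open>q k\<close> is of order
  \<open>R\<^sup>2 / 4^k\<close> up to a logarithm, the powers of \<open>4\<close> cancel and one bound on
  \<open>m\<close> serves all levels.\<close>

lemma net_union_bound:
  fixes R \<epsilon> :: real
  assumes R: "1 \<le> R" and L: "2 ^ L \<le> 4 * R" "0 < L" and \<epsilon>: "0 < \<epsilon>" "\<epsilon> < 1" and n: "0 < n"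
    and m: "44000 * real L * R\<^sup>2 * (ln (256 * real L * R\<^sup>2) * ln (2 * real n) + ln (real L / \<epsilon>)) \<le> real m"
    and q: "\<And>k. q k = nat \<lceil>1024 * R\<^sup>2 / 4 ^ k * ln (64 * real L * 4 ^ k)\<rceil>"
  shows "(\<Sum>k<L. (2 * real n) ^ q k * exp (- (real m * (3 / 4 * (1 / (4 * real L * 4 ^ k))) / 8))) \<le> \<epsilon>"
proof -
  define l where "l = ln (256 * real L * R\<^sup>2)"
  have each: "(2 * real n) ^ q k * exp (- (real m * (3 / 4 * (1 / (4 * real L * 4 ^ k))) / 8)) \<le> \<epsilon> / real L"
    if k: "k < L" for k
  proof -
    have "4 * (4::real) ^ k \<le> 4 ^ L" using k power_increasing[of "Suc k" L "4::real"] by simp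
    also have "(4::real) ^ L = (2 ^ L)\<^sup>2" by (simp add: power2_eq_square power_mult_distrib[symmetric])
    also have "\<dots> \<le> (4 * R)\<^sup>2" using L R by (intro power_mono) auto
    finally have k4: "(4::real) ^ k \<le> 4 * R\<^sup>2" by (simp add: power_mult_distrib)
    have "real L * 4 ^ k \<le> real L * (4 * R\<^sup>2)" using k4 by (intro mult_left_mono) auto
    moreover have L4: "1 \<le> real L * 4 ^ k"
      using L mult_mono[of 1 "real L" 1 "4 ^ k"] by simp
    ultimately have ll: "ln (64 * real L * 4 ^ k) \<le> l" and l0: "0 \<le> ln (64 * real L * 4 ^ k)" and "1 \<le> l"
    proof -
      assume a: "real L * 4 ^ k \<le> real L * (4 * R\<^sup>2)" and b: "1 \<le> real L * 4 ^ k"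
      show "ln (64 * real L * 4 ^ k) \<le> l" unfolding l_def using a b by (intro ln_mono) auto
      show "0 \<le> ln (64 * real L * 4 ^ k)" using b by (intro ln_ge_zero) auto
      have "exp 1 \<le> (3::real)" by (rule exp_le)
      also have "3 \<le> 256 * real L * R\<^sup>2" using a b by simp
      finally show "1 \<le> l" unfolding l_def using a b by (subst ln_ge_iff) auto
    qed
    have R4: "1 / 4 \<le> R\<^sup>2 / 4 ^ k" using k4 by (simp add: field_simps)
    have "real (q k) \<le> 1024 * R\<^sup>2 / 4 ^ k * ln (64 * real L * 4 ^ k) + 1"
    proof -
      have "0 \<le> 1024 * R\<^sup>2 / 4 ^ k * ln (64 * real L * 4 ^ k)" using l0 by simp
      then show ?thesis unfolding q by linarith
    qed
    also have "\<dots> \<le> 1024 * R\<^sup>2 / 4 ^ k * l + 4 * (R\<^sup>2 / 4 ^ k) * l"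
    proof (intro add_mono mult_left_mono ll)
      show "1 \<le> 4 * (R\<^sup>2 / 4 ^ k) * l" using R4 \<open>1 \<le> l\<close> mult_mono[of 1 "4 * (R\<^sup>2 / 4 ^ k)" 1 l] by simp
    qed auto
    finally have qk: "real (q k) \<le> 1028 * R\<^sup>2 / 4 ^ k * l" by (simp add: field_simps)
    define a where "a = ln (2 * real n)"
    have a0: "0 \<le> a" unfolding a_def using n by (intro ln_ge_zero) auto
    define b where "b = ln (real L / \<epsilon>)"
    have b0: "0 \<le> b" unfolding b_def using L \<epsilon> by (intro ln_ge_zero) (simp add: le_divide_eq)
    have LL: "0 < real L" using L by simp
    have "real (q k) * a + b \<le> 1028 * R\<^sup>2 / 4 ^ k * l * a + 4 * R\<^sup>2 / 4 ^ k * b"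
      using qk a0 b0 R4 mult_right_mono[of 1 "4 * (R\<^sup>2 / 4 ^ k)" b] by (intro add_mono mult_right_mono) auto
    also have "\<dots> \<le> 1028 * R\<^sup>2 / 4 ^ k * (l * a + b)"
      using b0 by (simp add: field_simps mult_right_mono)
    also have "\<dots> \<le> 3 * (44000 * real L * R\<^sup>2 * (l * a + b)) / (128 * real L * 4 ^ k)"
      using LL a0 b0 \<open>1 \<le> l\<close> by (simp add: field_simps)
    also have "\<dots> \<le> 3 * real m / (128 * real L * 4 ^ k)"
      using m LL unfolding l_def a_def b_def by (intro divide_right_mono mult_left_mono) auto
    finally have main: "real (q k) * a - 3 * real m / (128 * real L * 4 ^ k) \<le> - b" by simp
    have "(2 * real n) ^ q k = exp (real (q k) * a)"
      using n unfolding a_def by (simp add: exp_of_nat_mult)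
    then have "(2 * real n) ^ q k * exp (- (real m * (3 / 4 * (1 / (4 * real L * 4 ^ k))) / 8))
        = exp (real (q k) * a - 3 * real m / (128 * real L * 4 ^ k))"
      by (simp add: exp_add[symmetric] field_simps)
    also have "\<dots> \<le> exp (- b)" using main by simp
    also have "\<dots> = \<epsilon> / real L" unfolding b_def using LL \<epsilon> by (simp add: exp_minus)
    finally show ?thesis .
  qed
  have "(\<Sum>k<L. (2 * real n) ^ q k * exp (- (real m * (3 / 4 * (1 / (4 * real L * 4 ^ k))) / 8))) \<le> (\<Sum>k<L. \<epsilon> / real L)"
    by (intro sum_mono each) auto
  also have "\<dots> = \<epsilon>" using L by simp
  finally show ?thesis .
qed

text \<open>Levels of probability less than \<open>1 / (4 * L * 4^k)\<close> carry together at most a quarter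
  of the energy. On the remaining levels the sample frequency is, up to the factor \<open>8\<close>, at least
  the probability, and the energy of the sample is recovered by \<open>dyadic_lower\<close>.\<close>

lemma dyadic_energy_transfer:
  fixes f :: "'a \<Rightarrow> real"
  assumes [measurable]: "f \<in> borel_measurable M" and fb: "\<And>x. x \<in> space M \<Longrightarrow> \<bar>f x\<bar> \<le> R"
    and R: "R < 2 ^ L / 2" and L: "0 < L" and f1: "(LINT x|M. (f x)\<^sup>2) = 1"
    and trans: "\<And>k. k < L \<Longrightarrow> 1 / (4 * real L * 4 ^ k) \<le> measure M {x \<in> space M. 2 ^ k / 2 \<le> \<bar>f x\<bar>} \<Longrightarrow>
       real m * measure M {x \<in> space M. 2 ^ k / 2 \<le> \<bar>f x\<bar>} / 8 \<le> real (card {l\<in>{..<m}. 2 ^ k / 4 \<le> \<bar>f (t l)\<bar>})"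
  shows "real m / 400 \<le> (\<Sum>l<m. (f (t l))\<^sup>2)"
proof -
  define p where "p k = measure M {x \<in> space M. 2 ^ k / 2 \<le> \<bar>f x\<bar>}" for k :: nat
  define b where "b k x = (of_bool (2 ^ k / 2 \<le> \<bar>f x\<bar>) :: real)" for k :: nat and x
  have pint: "(LINT x|M. b k x) = p k" for k :: nat
  proof -
    have "(LINT x|M. b k x) = (LINT x|M. indicat_real {x \<in> space M. 2 ^ k / 2 \<le> \<bar>f x\<bar>} x)"
      by (intro Bochner_Integration.integral_cong refl) (simp add: b_def indicator_def)
    then show ?thesis by (simp add: p_def)
  qed
  have bi: "integrable M (b k)" for k :: nat
    unfolding b_def by (rule integrable_bounded[where C=1]) auto
  have fi: "integrable M (\<lambda>x. (f x)\<^sup>2)"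
  proof (rule integrable_bounded[where C="R\<^sup>2"])
    show "\<bar>(f x)\<^sup>2\<bar> \<le> R\<^sup>2" if "x \<in> space M" for x
      using fb[OF that] abs_le_square_iff[of "f x" R] by auto
  qed measurable
  have "(LINT x|M. (f x)\<^sup>2) \<le> (LINT x|M. 1 / 4 + (\<Sum>k<L. 4 ^ k * b k x))"
  proof (rule integral_mono)
    fix x assume "x \<in> space M"
    then show "(f x)\<^sup>2 \<le> 1 / 4 + (\<Sum>k<L. 4 ^ k * b k x)"
      using dyadic_upper[of "\<bar>f x\<bar>" L] fb[of x] R unfolding b_def by simp
  qed (use bi fi in auto)
  also have "\<dots> = 1 / 4 + (\<Sum>k<L. 4 ^ k * p k)"
    using bi by (simp add: prob_space pint)
  finally have s1: "3 / 4 \<le> (\<Sum>k<L. 4 ^ k * p k)" using f1 by simp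
  \<comment> \<open>light levels carry at most a quarter of the energy\<close>
  have lev: "4 ^ k * p k \<le> 1 / (4 * real L) + 8 * (4 ^ k * (real (card {l\<in>{..<m}. 2 ^ k / 4 \<le> \<bar>f (t l)\<bar>}) / real m))"
    if k: "k < L" and m: "0 < m" for k
  proof (cases "1 / (4 * real L * 4 ^ k) \<le> p k")
    case True
    have "p k \<le> 8 * (real (card {l\<in>{..<m}. 2 ^ k / 4 \<le> \<bar>f (t l)\<bar>}) / real m)"
      using trans[OF k] True m unfolding p_def by (simp add: field_simps)
    then have "4 ^ k * p k \<le> 4 ^ k * (8 * (real (card {l\<in>{..<m}. 2 ^ k / 4 \<le> \<bar>f (t l)\<bar>}) / real m))"
      by (intro mult_left_mono) auto
    moreover have "0 \<le> 1 / (4 * real L)" by simp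
    ultimately show ?thesis by linarith
  next
    case False
    have "4 ^ k * p k \<le> 4 ^ k * (1 / (4 * real L * 4 ^ k))" using False by (intro mult_left_mono) auto
    also have "\<dots> = 1 / (4 * real L)" by simp
    finally show ?thesis by (simp add: add_increasing2)
  qed
  show ?thesis
  proof (cases "m = 0")
    case False
    then have m: "0 < m" by simp
    have "(\<Sum>k<L. 4 ^ k * p k) \<le> (\<Sum>k<L. 1 / (4 * real L) + 8 * (4 ^ k * (real (card {l\<in>{..<m}. 2 ^ k / 4 \<le> \<bar>f (t l)\<bar>}) / real m)))"
      by (intro sum_mono lev m) auto
    also have "\<dots> = 1 / 4 + 8 * ((\<Sum>k<L. 4 ^ k * real (card {l\<in>{..<m}. 2 ^ k / 4 \<le> \<bar>f (t l)\<bar>})) / real m)"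
      using L by (simp add: sum.distrib sum_distrib_left sum_divide_distrib)
    finally have "1 / 2 \<le> 8 * ((\<Sum>k<L. 4 ^ k * real (card {l\<in>{..<m}. 2 ^ k / 4 \<le> \<bar>f (t l)\<bar>})) / real m)"
      using s1 by simp
    \<comment> \<open>with \<open>dyadic_lower\<close> the final constant is \<open>3 / 64 * (1 / 16)\<close>, which exceeds \<open>1 / 400\<close>\<close>
    then have "real m / 16 \<le> (\<Sum>k<L. 4 ^ k * real (card {l\<in>{..<m}. 2 ^ k / 4 \<le> \<bar>f (t l)\<bar>}))"
      using m by (simp add: field_simps)
    also have "\<dots> = (\<Sum>k<L. \<Sum>l<m. 4 ^ k * of_bool (2 ^ k / 4 \<le> \<bar>f (t l)\<bar>))"
      by (simp add: sum_distrib_left[symmetric] of_bool_def sum.If_cases Int_def)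
    also have "\<dots> = (\<Sum>l<m. \<Sum>k<L. 4 ^ k * of_bool (2 ^ k / 4 \<le> \<bar>f (t l)\<bar>))" by (rule sum.swap)
    also have "\<dots> \<le> (\<Sum>l<m. 64 / 3 * (f (t l))\<^sup>2)"
      using dyadic_lower[of "\<bar>f (t _)\<bar>" L] by (intro sum_mono) auto
    also have "\<dots> = 64 / 3 * (\<Sum>l<m. (f (t l))\<^sup>2)" by (simp add: sum_distrib_left)
    finally show ?thesis by simp
  qed simp
qed

text \<open>The atoms are \<open>\<plusminus> R \<psi> j\<close>, so that functions with coefficients of
  \<open>l\<^sup>1\<close>-norm at most \<open>R\<close> are convex combinations of them. The event does not
  depend on the function, since at each level it concerns only the finitely many averages of \<open>q
  k\<close> atoms.\<close>

theorem lower_isometry: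
  fixes \<psi> :: "'j \<Rightarrow> 'a \<Rightarrow> real" and R \<epsilon> :: real and m :: nat
  assumes J: "finite J" "J \<noteq> {}"
    and meas [measurable]: "\<And>j. j \<in> J \<Longrightarrow> \<psi> j \<in> borel_measurable M"
    and bd: "\<And>j x. j \<in> J \<Longrightarrow> x \<in> space M \<Longrightarrow> \<bar>\<psi> j x\<bar> \<le> 1"
    and R: "1 \<le> R" "R < 2 ^ L / 2" "2 ^ L \<le> 4 * R" and \<epsilon>: "0 < \<epsilon>" "\<epsilon> < 1"
    and m: "44000 * real L * R\<^sup>2 * (ln (256 * real L * R\<^sup>2) * ln (2 * real (card J)) + ln (real L / \<epsilon>)) \<le> real m"
    and m0: "0 < m"
  defines "PM \<equiv> \<Pi>\<^sub>M i\<in>{..<m}. M"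
  shows "\<exists>E \<in> sets PM. 1 - \<epsilon> \<le> measure PM E \<and>
    (\<forall>t\<in>E. \<forall>c. (\<Sum>j\<in>J. \<bar>c j\<bar>) \<le> R \<longrightarrow> (LINT x|M. (\<Sum>j\<in>J. c j * \<psi> j x)\<^sup>2) = 1 \<longrightarrow>
       real m / 400 \<le> (\<Sum>l<m. (\<Sum>j\<in>J. c j * \<psi> j (t l))\<^sup>2))"
proof -
  define A where "A = J \<times> {-1, 1 :: real}"
  define \<Psi> where "\<Psi> a x = snd a * R * \<psi> (fst a) x" for a x
  define q where "q k = nat \<lceil>1024 * R\<^sup>2 / 4 ^ k * ln (64 * real L * 4 ^ k)\<rceil>" for k :: nat
  define B where "B z = {x \<in> space M. 3 / 4 * (2 ^ fst z / 2) \<le> \<bar>(\<Sum>r<q (fst z). \<Psi> (snd z r) x) / real (q (fst z))\<bar>}"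
    for z :: "nat \<times> (nat \<Rightarrow> 'j \<times> real)"
  define I where "I = (SIGMA k:{..<L}. {..<q k} \<rightarrow>\<^sub>E A)"
  define p where "p z = 3 / 4 * (1 / (4 * real L * 4 ^ fst z))" for z :: "nat \<times> (nat \<Rightarrow> 'j \<times> real)"
  have L: "0 < L" using R by (cases L) auto
  have n: "0 < card J" using J by (simp add: card_gt_0_iff)
  have A: "finite A" "card A = 2 * card J" using J by (auto simp: A_def card_cartesian_product)
  have \<Psi>m [measurable]: "\<Psi> a \<in> borel_measurable M" if "a \<in> A" for a
    using that unfolding \<Psi>_def A_def by auto
  have \<Psi>b: "\<bar>\<Psi> a x\<bar> \<le> R" if "a \<in> A" "x \<in> space M" for a x
    using that bd[of "fst a" x] R(1) mult_left_mono[of "\<bar>\<psi> (fst a) x\<bar>" 1 R]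
    unfolding \<Psi>_def A_def by (auto simp: abs_mult)
  have If: "finite I" unfolding I_def using A by (auto intro!: finite_SigmaI finite_PiE)
  have Bm: "B z \<in> sets M" if "z \<in> I" for z
  proof -
    obtain k a where z: "z = (k, a)" "a \<in> {..<q k} \<rightarrow>\<^sub>E A"
      using \<open>z \<in> I\<close> unfolding I_def by (elim SigmaE)
    have [measurable]: "(\<lambda>x. \<Sum>r<q k. \<Psi> (a r) x) \<in> borel_measurable M"
      using z(2) by (intro borel_measurable_sum \<Psi>m) (rule PiE_mem)
    show ?thesis unfolding B_def z(1) fst_conv snd_conv by measurable
  qed
  have "\<exists>E \<in> sets PM. 1 - (\<Sum>z\<in>I. exp (- (real m * p z / 8))) \<le> measure PM E \<and>
    (\<forall>t\<in>E. \<forall>z\<in>I. p z \<le> measure M (B z) \<longrightarrow>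
       real m * measure M (B z) / 2 \<le> real (card {l\<in>{..<m}. t l \<in> B z}))"
    unfolding PM_def by (rule empirical_frequency_lower_bound[OF If Bm])
  then obtain E where E: "E \<in> sets PM" "1 - (\<Sum>z\<in>I. exp (- (real m * p z / 8))) \<le> measure PM E"
    and good: "\<And>t z. t \<in> E \<Longrightarrow> z \<in> I \<Longrightarrow> p z \<le> measure M (B z) \<Longrightarrow>
       real m * measure M (B z) / 2 \<le> real (card {l\<in>{..<m}. t l \<in> B z})"
by blast
  have "(\<Sum>z\<in>I. exp (- (real m * p z / 8))) = (\<Sum>k<L. \<Sum>a\<in>{..<q k} \<rightarrow>\<^sub>E A. exp (- (real m * (3 / 4 * (1 / (4 * real L * 4 ^ k))) / 8)))"
    unfolding I_def using A by (subst sum.Sigma) (auto intro!: finite_PiE simp: p_def split_beta)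
  also have "\<dots> = (\<Sum>k<L. (2 * real (card J)) ^ q k * exp (- (real m * (3 / 4 * (1 / (4 * real L * 4 ^ k))) / 8)))"
    using A by (simp add: card_PiE)
  also have "\<dots> \<le> \<epsilon>"
    by (rule net_union_bound[OF R(1) R(3) L \<epsilon> n m q_def])
  finally have pE: "1 - \<epsilon> \<le> measure PM E" using E(2) by linarith
  have main: "real m / 400 \<le> (\<Sum>l<m. (\<Sum>j\<in>J. c j * \<psi> j (t l))\<^sup>2)"
    if t: "t \<in> E" and c1: "(\<Sum>j\<in>J. \<bar>c j\<bar>) \<le> R" and c2: "(LINT x|M. (\<Sum>j\<in>J. c j * \<psi> j x)\<^sup>2) = 1" for t c
  proof -
    define f where "f x = (\<Sum>j\<in>J. c j * \<psi> j x)" for x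
    \<comment> \<open>the first fraction represents the coefficients; the mass that is left is spread evenly over all atoms, where opposite signs cancel\<close>
    define w where "w a = (\<bar>c (fst a)\<bar> + snd a * c (fst a)) / (2 * R) + (1 - (\<Sum>j\<in>J. \<bar>c j\<bar>) / R) / (2 * real (card J))" for a
    have sumA: "(\<Sum>a\<in>A. h a) = (\<Sum>j\<in>J. h (j, 1) + h (j, -1))" for h :: "'j \<times> real \<Rightarrow> real"
      unfolding A_def sum.cartesian_product' by (simp add: add.commute)
    have w0: "0 \<le> w a" if "a \<in> A" for a
    proof -
      have num: "0 \<le> \<bar>c (fst a)\<bar> + snd a * c (fst a)" using that by (auto simp: A_def)
      show ?thesis unfolding w_def using R(1) c1 n
        by (intro add_nonneg_nonneg[OF divide_nonneg_nonneg[OF num] divide_nonneg_nonneg]) auto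
    qed
    have w1: "sum w A = 1"
    proof -
      define s where "s = (\<Sum>j\<in>J. \<bar>c j\<bar>)"
      have "w (j, 1) + w (j, -1) = \<bar>c j\<bar> / R + (1 - s / R) / real (card J)" for j
        unfolding w_def s_def[symmetric] using R(1) n by (simp add: field_simps)
      then have "sum w A = s / R + real (card J) * ((1 - s / R) / real (card J))"
        unfolding sumA by (simp add: sum.distrib s_def sum_divide_distrib)
      then show ?thesis using n by simp
    qed
    have fe: "f x = (\<Sum>a\<in>A. w a * \<Psi> a x)" for x
      using R(1) unfolding sumA w_def \<Psi>_def f_def by (intro sum.cong refl) (simp add: field_simps)
    interpret convex_combination M A w \<Psi> f R
      by unfold_locales (use A w0 w1 \<Psi>m \<Psi>b fe in auto)
    have tsp: "t i \<in> space M" if "i < m" for i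
      using sets.sets_into_space[OF E(1)] t that by (auto simp: PM_def space_PiM PiE_iff)
    show ?thesis unfolding f_def[symmetric]
    proof (rule dyadic_energy_transfer[OF f_measurable f_bound R(2) L c2[folded f_def]])
      fix k assume k: "k < L" and heavy: "1 / (4 * real L * 4 ^ k) \<le> measure M {x \<in> space M. 2 ^ k / 2 \<le> \<bar>f x\<bar>}"
      have "2 * (2::real) ^ k \<le> 2 ^ L" using k power_increasing[of "Suc k" L "2::real"] by simp
      then have \<tau>R: "2 ^ k / 2 \<le> R" using R by linarith
      have L4: "1 \<le> real L * 4 ^ k"
        using L mult_mono[of 1 "real L" 1 "4 ^ k"] by simp
      have l0: "0 < ln (64 * real L * 4 ^ k)" using L4 by (intro ln_gt_zero) auto
      have q0: "0 < 1024 * R\<^sup>2 / 4 ^ k * ln (64 * real L * 4 ^ k)" using l0 R(1) by simp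
      then have qk: "0 < q k" unfolding q_def by simp
      have "1024 * R\<^sup>2 / 4 ^ k * ln (64 * real L * 4 ^ k) \<le> real (q k)"
        unfolding q_def by (rule real_nat_ceiling_ge)
      then have "ln (64 * real L * 4 ^ k) \<le> real (q k) * (2 ^ k / 2)\<^sup>2 / (256 * R\<^sup>2)"
        using R(1) by (simp add: field_simps power2_eq_square power_mult_distrib[symmetric])
      then have "exp (- (real (q k) * (2 ^ k / 2)\<^sup>2 / (256 * R\<^sup>2))) \<le> exp (- ln (64 * real L * 4 ^ k))" by simp
      also have "\<dots> = 1 / (64 * real L * 4 ^ k)" using L by (simp add: exp_minus inverse_eq_divide)
      finally have ql: "4 * exp (- (real (q k) * (2 ^ k / 2)\<^sup>2 / (256 * R\<^sup>2))) \<le> 1 / (4 * real L * 4 ^ k) / 4"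
        by (simp add: field_simps)
      have "real m * measure M {x \<in> space M. 2 ^ k / 2 \<le> \<bar>f x\<bar>} / 8 \<le> real (card {l\<in>{..<m}. 2 ^ k / 2 / 2 \<le> \<bar>f (t l)\<bar>})"
      proof (rule level_transfer[where q = "q k" and t = t and \<tau> = "2 ^ k / 2" and pmin = "1 / (4 * real L * 4 ^ k)"])
        fix a assume a: "a \<in> {..<q k} \<rightarrow>\<^sub>E A"
        assume "3 / 4 * (1 / (4 * real L * 4 ^ k)) \<le> prob {x \<in> space M. 3 / 4 * (2 ^ k / 2) \<le> \<bar>atom_mean (q k) a x\<bar>}"
        then show "real m * prob {x \<in> space M. 3 / 4 * (2 ^ k / 2) \<le> \<bar>atom_mean (q k) a x\<bar>} / 2
            \<le> real (card {l \<in> {..<m}. t l \<in> {x \<in> space M. 3 / 4 * (2 ^ k / 2) \<le> \<bar>atom_mean (q k) a x\<bar>}})"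
          using good[OF t, of "(k, a)"] a k unfolding B_def p_def I_def atom_mean_def by simp
      qed (use \<tau>R m0 tsp qk heavy ql in auto)
      then show "real m * measure M {x \<in> space M. 2 ^ k / 2 \<le> \<bar>f x\<bar>} / 8 \<le> real (card {l\<in>{..<m}. 2 ^ k / 4 \<le> \<bar>f (t l)\<bar>})"
        by simp
    qed
  qed
  show ?thesis using E(1) pE main by blast
qed

end

section \<open>Sampling the tensor basis\<close>

lemma integrable_rphi_mult: "integrable (nu B d) (\<lambda>t. rphi B d i t * rphi B d j t)"
proof -
  interpret prob_space "nu B d" by (rule prob_space_nu)
  show ?thesis
  proof (rule integrable_const_bound[where B = "uweight B d i * uweight B d j"])
    show "AE t in nu B d. norm (rphi B d i t * rphi B d j t) \<le> uweight B d i * uweight B d j"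
      using AE_rphi_le[of B d i] AE_rphi_le[of B d j]
    proof eventually_elim
      case (elim t)
      then show ?case using uweight_nonneg by (auto simp: abs_mult intro!: mult_mono)
    qed
  qed measurable
qed

lemma integral_rphi_combination:
  assumes "finite \<Lambda>" "\<Lambda> \<subseteq> mindices d"
  shows "(LINT t|nu B d. (\<Sum>j\<in>\<Lambda>. b j * rphi B d j t)\<^sup>2) = (\<Sum>j\<in>\<Lambda>. (b j)\<^sup>2)"
proof -
  have "(LINT t|nu B d. (\<Sum>j\<in>\<Lambda>. b j * rphi B d j t)\<^sup>2)
      = (LINT t|nu B d. (\<Sum>i\<in>\<Lambda>. \<Sum>j\<in>\<Lambda>. b i * b j * (rphi B d i t * rphi B d j t)))"
    by (simp add: power2_eq_square sum_product mult_ac)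
  also have "\<dots> = (\<Sum>i\<in>\<Lambda>. \<Sum>j\<in>\<Lambda>. b i * b j * (LINT t|nu B d. rphi B d i t * rphi B d j t))"
    using integrable_rphi_mult[of B d] by simp
  also have "\<dots> = (\<Sum>i\<in>\<Lambda>. \<Sum>j\<in>\<Lambda>. b i * b j * (if i = j then 1 else 0))"
    using assms(2) by (intro sum.cong refl) (simp add: rphi_orthonormal subset_iff)
  also have "\<dots> = (\<Sum>i\<in>\<Lambda>. (b i)\<^sup>2)"
    using assms(1) by (intro sum.cong refl) (simp add: power2_eq_square if_distrib[where f = "\<lambda>x. _ * x"] cong: if_cong)
  finally show ?thesis .
qed

text \<open>\<open>lower_isometry\<close> for \<open>\<psi> j = rphi B d j / uweight B d j\<close>, cut off
  outside the set \<open>G\<close> of full measure where these functions are bounded by 1. Almost surely all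
  sample points lie in \<open>G\<close>.\<close>

lemma sampling_isometry:
  fixes R \<epsilon> :: real
  assumes \<Lambda>: "finite \<Lambda>" "\<Lambda> \<noteq> {}" "\<Lambda> \<subseteq> mindices d"
    and R: "1 \<le> R" "R < 2 ^ L / 2" "2 ^ L \<le> 4 * R" and \<epsilon>: "0 < \<epsilon>" "\<epsilon> < 1"
    and m: "44000 * real L * R\<^sup>2 * (ln (256 * real L * R\<^sup>2) * ln (2 * real (card \<Lambda>)) + ln (real L / \<epsilon>)) \<le> real m"
    and m0: "0 < m"
  shows "\<exists>E \<in> sets (\<Pi>\<^sub>M i\<in>{..<m}. nu B d). 1 - \<epsilon> \<le> measure (\<Pi>\<^sub>M i\<in>{..<m}. nu B d) E \<and>
    (\<forall>t\<in>E. (\<forall>l<m. \<forall>j\<in>\<Lambda>. \<bar>rphi B d j (t l)\<bar> \<le> uweight B d j) \<and>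
      (\<forall>c. (\<Sum>j\<in>\<Lambda>. uweight B d j * \<bar>c j\<bar>) \<le> R * L2_set c \<Lambda> \<longrightarrow>
         real m / 400 * (L2_set c \<Lambda>)\<^sup>2 \<le> (\<Sum>l<m. (\<Sum>j\<in>\<Lambda>. c j * rphi B d j (t l))\<^sup>2)))"
proof -
  interpret N: prob_space "nu B d" by (rule prob_space_nu)
  let ?PM = "\<Pi>\<^sub>M i\<in>{..<m}. nu B d"
  interpret PM: prob_space ?PM by (rule prob_space_PiM) (rule prob_space_nu)
  interpret nus: product_prob_space "\<lambda>_::nat. nu B d" UNIV by unfold_locales
  let ?u = "uweight B d"
  have u1: "1 \<le> ?u j" if "j \<in> \<Lambda>" for j using \<Lambda>(3) that by (intro uweight_ge_1) auto
  define G where "G = {t \<in> space (nu B d). \<forall>j\<in>\<Lambda>. \<bar>rphi B d j t\<bar> \<le> ?u j}"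
  have Gm [measurable]: "G \<in> sets (nu B d)" unfolding G_def using \<Lambda>(1) by measurable
  have AEG: "AE t in nu B d. t \<in> G"
  proof -
    have "AE t in nu B d. \<forall>j\<in>\<Lambda>. \<bar>rphi B d j t\<bar> \<le> ?u j"
      using \<Lambda>(1) AE_rphi_le by (subst AE_finite_all) auto
    then show ?thesis using AE_space by eventually_elim (simp add: G_def)
  qed
  define \<psi> where "\<psi> j t = rphi B d j t / ?u j * indicator G t" for j t
  have "\<exists>E \<in> sets ?PM. 1 - \<epsilon> \<le> measure ?PM E \<and>
    (\<forall>t\<in>E. \<forall>c. (\<Sum>j\<in>\<Lambda>. \<bar>c j\<bar>) \<le> R \<longrightarrow> (LINT x|nu B d. (\<Sum>j\<in>\<Lambda>. c j * \<psi> j x)\<^sup>2) = 1 \<longrightarrow>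
       real m / 400 \<le> (\<Sum>l<m. (\<Sum>j\<in>\<Lambda>. c j * \<psi> j (t l))\<^sup>2))"
  proof (rule N.lower_isometry[OF \<Lambda>(1,2) _ _ R \<epsilon> m m0])
    fix j assume j: "j \<in> \<Lambda>"
    show "\<psi> j \<in> borel_measurable (nu B d)" unfolding \<psi>_def by measurable
    show "\<bar>\<psi> j x\<bar> \<le> 1" if "x \<in> space (nu B d)" for x
      using u1[OF j] j unfolding \<psi>_def by (auto simp: indicator_def G_def abs_mult divide_le_eq)
  qed
  then obtain E where E: "E \<in> sets ?PM" "1 - \<epsilon> \<le> measure ?PM E"
    and iso: "\<And>t c. t \<in> E \<Longrightarrow> (\<Sum>j\<in>\<Lambda>. \<bar>c j\<bar>) \<le> R \<Longrightarrow> (LINT x|nu B d. (\<Sum>j\<in>\<Lambda>. c j * \<psi> j x)\<^sup>2) = 1 \<Longrightarrow>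
       real m / 400 \<le> (\<Sum>l<m. (\<Sum>j\<in>\<Lambda>. c j * \<psi> j (t l))\<^sup>2)" by blast
  define F where "F = PiE {..<m} (\<lambda>_. G)"
  have Fm: "F \<in> sets ?PM" unfolding F_def by (intro sets_PiM_I_finite) auto
  have "emeasure (nu B d) G = 1" using AEG by (intro N.emeasure_eq_1_AE) auto
  then have "emeasure ?PM F = 1" unfolding F_def by (subst nus.emeasure_PiM) auto
  then have F1: "measure ?PM F = 1" by (simp add: measure_def)
  then have "measure ?PM (space ?PM - F) = 0" using PM.prob_compl[OF Fm] by simp
  moreover have "measure ?PM E \<le> measure ?PM ((E \<inter> F) \<union> (space ?PM - F))"
    using E(1) Fm sets.sets_into_space[OF E(1)] by (intro PM.finite_measure_mono) auto
  moreover have "\<dots> \<le> measure ?PM (E \<inter> F) + measure ?PM (space ?PM - F)"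
    using E(1) Fm by (intro measure_Un_le) auto
  ultimately have p: "1 - \<epsilon> \<le> measure ?PM (E \<inter> F)" using E(2) by linarith
  have bd: "t l \<in> G" if "t \<in> E \<inter> F" "l < m" for t l
    using PiE_mem[of t "{..<m}" "\<lambda>_. G" l] that by (simp add: F_def)
  have main: "real m / 400 * (L2_set c \<Lambda>)\<^sup>2 \<le> (\<Sum>l<m. (\<Sum>j\<in>\<Lambda>. c j * rphi B d j (t l))\<^sup>2)"
    if t: "t \<in> E \<inter> F" and c: "(\<Sum>j\<in>\<Lambda>. ?u j * \<bar>c j\<bar>) \<le> R * L2_set c \<Lambda>" for t c
  proof (cases "L2_set c \<Lambda> = 0")
    case True
    then show ?thesis by (simp add: sum_nonneg)
  next
    case False
    define r where "r = L2_set c \<Lambda>"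
    have r: "0 < r" using False L2_set_nonneg[of c \<Lambda>] unfolding r_def by linarith
    have r2: "r\<^sup>2 = (\<Sum>j\<in>\<Lambda>. (c j)\<^sup>2)" by (simp add: r_def L2_set_def sum_nonneg)
    define c' where "c' j = c j * ?u j / r" for j
    have eqG: "(\<Sum>j\<in>\<Lambda>. c' j * \<psi> j x) = (\<Sum>j\<in>\<Lambda>. c j / r * rphi B d j x)" if "x \<in> G" for x
    proof (intro sum.cong refl)
      fix j assume "j \<in> \<Lambda>"
      then show "c' j * \<psi> j x = c j / r * rphi B d j x"
        using u1[of j] that by (simp add: c'_def \<psi>_def)
    qed
    have "(LINT x|nu B d. (\<Sum>j\<in>\<Lambda>. c' j * \<psi> j x)\<^sup>2) = (LINT x|nu B d. (\<Sum>j\<in>\<Lambda>. c j / r * rphi B d j x)\<^sup>2)"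
    proof (rule integral_cong_AE)
      show "(\<lambda>x. (\<Sum>j\<in>\<Lambda>. c' j * \<psi> j x)\<^sup>2) \<in> borel_measurable (nu B d)" unfolding \<psi>_def by measurable
      show "AE x in nu B d. (\<Sum>j\<in>\<Lambda>. c' j * \<psi> j x)\<^sup>2 = (\<Sum>j\<in>\<Lambda>. c j / r * rphi B d j x)\<^sup>2"
        using AEG by eventually_elim (simp only: eqG)
    qed measurable
    also have "\<dots> = (\<Sum>j\<in>\<Lambda>. (c j / r)\<^sup>2)" by (rule integral_rphi_combination[OF \<Lambda>(1,3)])
    also have "\<dots> = 1" using r by (simp add: power_divide sum_divide_distrib[symmetric] r2[symmetric])
    finally have i1: "(LINT x|nu B d. (\<Sum>j\<in>\<Lambda>. c' j * \<psi> j x)\<^sup>2) = 1" .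
    have "(\<Sum>j\<in>\<Lambda>. \<bar>c' j\<bar>) = (\<Sum>j\<in>\<Lambda>. ?u j * \<bar>c j\<bar>) / r"
      using r uweight_nonneg[of B d] by (simp add: c'_def abs_mult sum_divide_distrib mult.commute)
    also have "\<dots> \<le> R" using c r by (simp add: r_def[symmetric] pos_divide_le_eq)
    finally have "real m / 400 \<le> (\<Sum>l<m. (\<Sum>j\<in>\<Lambda>. c' j * \<psi> j (t l))\<^sup>2)"
      using iso t i1 by simp
    also have "\<dots> = (\<Sum>l<m. (\<Sum>j\<in>\<Lambda>. c j / r * rphi B d j (t l))\<^sup>2)"
      using eqG bd[OF t] by (intro sum.cong) auto
    also have "\<dots> = (\<Sum>l<m. (\<Sum>j\<in>\<Lambda>. c j * rphi B d j (t l))\<^sup>2) / r\<^sup>2"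
      by (simp add: sum_divide_distrib[symmetric] power_divide)
    finally show ?thesis using r by (simp add: r_def[symmetric] field_simps)
  qed
  show ?thesis
  proof (intro bexI conjI ballI allI impI)
    show "E \<inter> F \<in> sets ?PM" using E(1) Fm by auto
    show "1 - \<epsilon> \<le> measure ?PM (E \<inter> F)" by fact
    show "\<bar>rphi B d j (t l)\<bar> \<le> ?u j" if "t \<in> E \<inter> F" "l < m" "j \<in> \<Lambda>" for t l j
      using bd[OF that(1,2)] that(3) by (simp add: G_def)
  qed (rule main)
qed

text \<open>Either the isometry applies, or the weighted \<open>l\<^sup>1\<close>-norm is already large enough
  for the first term.\<close>

lemma real_l2_norm_le_samples:
  fixes c :: "mindex \<Rightarrow> real"
  assumes R: "0 < R" and m: "0 < m"
    and iso: "(\<Sum>j\<in>\<Lambda>. uweight B d j * \<bar>c j\<bar>) \<le> R * L2_set c \<Lambda> \<Longrightarrow>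
         real m / 400 * (L2_set c \<Lambda>)\<^sup>2 \<le> (\<Sum>l<m. (\<Sum>j\<in>\<Lambda>. c j * rphi B d j (t l))\<^sup>2)"
  shows "L2_set c \<Lambda> \<le> (\<Sum>j\<in>\<Lambda>. uweight B d j * \<bar>c j\<bar>) / R
     + 20 * L2_set (\<lambda>l. (\<Sum>j\<in>\<Lambda>. c j * rphi B d j (t l)) / sqrt (real m)) {..<m}"
proof (cases "(\<Sum>j\<in>\<Lambda>. uweight B d j * \<bar>c j\<bar>) \<le> R * L2_set c \<Lambda>")
  case True
  let ?g = "\<lambda>l. (\<Sum>j\<in>\<Lambda>. c j * rphi B d j (t l)) / sqrt (real m)"
  have "(L2_set ?g {..<m})\<^sup>2 = (\<Sum>l<m. (\<Sum>j\<in>\<Lambda>. c j * rphi B d j (t l))\<^sup>2) / real m"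
    using m by (simp add: L2_set_def sum_nonneg power_divide sum_divide_distrib[symmetric])
  then have "real m * (L2_set c \<Lambda>)\<^sup>2 \<le> real m * (400 * (L2_set ?g {..<m})\<^sup>2)"
    using iso[OF True] m by simp
  then have "(L2_set c \<Lambda>)\<^sup>2 \<le> 400 * (L2_set ?g {..<m})\<^sup>2"
    using m by (simp only: mult_le_cancel_left_pos of_nat_0_less_iff)
  also have "\<dots> = (20 * L2_set ?g {..<m})\<^sup>2" by (simp add: power_mult_distrib)
  finally have "L2_set c \<Lambda> \<le> 20 * L2_set ?g {..<m}" by (rule power2_le_imp_le) (simp add: L2_set_nonneg)
  moreover have "0 \<le> (\<Sum>j\<in>\<Lambda>. uweight B d j * \<bar>c j\<bar>) / R"
    using R uweight_nonneg by (intro divide_nonneg_nonneg sum_nonneg) auto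
  ultimately show ?thesis by linarith
next
  case False
  then have "L2_set c \<Lambda> \<le> (\<Sum>j\<in>\<Lambda>. uweight B d j * \<bar>c j\<bar>) / R"
    using R by (simp add: pos_le_divide_eq mult.commute)
  then show ?thesis using L2_set_nonneg[of _ "{..<m}"] by (simp add: add_increasing2)
qed

lemma mat_apply_design:
  "mat_apply (design B d m t) \<Lambda> h l = (\<Sum>j\<in>\<Lambda>. h j * complex_of_real (rphi B d j (t l))) / complex_of_real (sqrt (real m))"
  by (simp add: mat_apply_def design_def phi_eq sum_divide_distrib mult_ac)

text \<open>The design matrix is real, so that the real and the imaginary part can be treated
  separately.\<close>

lemma l2_norm_le_samples:
  fixes h :: "mindex \<Rightarrow> complex"
  assumes R: "0 < R" and m: "0 < m"
    and iso: "\<And>c. (\<Sum>j\<in>\<Lambda>. uweight B d j * \<bar>c j\<bar>) \<le> R * L2_set c \<Lambda> \<Longrightarrow>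
         real m / 400 * (L2_set c \<Lambda>)\<^sup>2 \<le> (\<Sum>l<m. (\<Sum>j\<in>\<Lambda>. c j * rphi B d j (t l))\<^sup>2)"
  shows "L2_set (\<lambda>j. cmod (h j)) \<Lambda> \<le> 2 * wnorm1 \<Lambda> (uweight B d) h / R
     + 40 * L2_set (\<lambda>l. cmod (mat_apply (design B d m t) \<Lambda> h l)) {..<m}"
proof -
  let ?g = "mat_apply (design B d m t) \<Lambda> h"
  have part: "L2_set (\<lambda>j. p (h j)) \<Lambda> \<le> wnorm1 \<Lambda> (uweight B d) h / R + 20 * L2_set (\<lambda>l. cmod (?g l)) {..<m}"
    if p: "\<And>z. \<bar>p z\<bar> \<le> cmod z" and lin: "\<And>l. p (?g l) = (\<Sum>j\<in>\<Lambda>. p (h j) * rphi B d j (t l)) / sqrt (real m)" for p :: "complex \<Rightarrow> real"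
  proof -
    have "L2_set (\<lambda>j. p (h j)) \<Lambda> \<le> (\<Sum>j\<in>\<Lambda>. uweight B d j * \<bar>p (h j)\<bar>) / R
       + 20 * L2_set (\<lambda>l. p (?g l)) {..<m}"
      unfolding lin by (rule real_l2_norm_le_samples[OF R m iso])
    also have "\<dots> \<le> wnorm1 \<Lambda> (uweight B d) h / R + 20 * L2_set (\<lambda>l. cmod (?g l)) {..<m}"
    proof (intro add_mono divide_right_mono mult_left_mono)
      show "(\<Sum>j\<in>\<Lambda>. uweight B d j * \<bar>p (h j)\<bar>) \<le> wnorm1 \<Lambda> (uweight B d) h"
        unfolding wnorm1_def by (intro sum_mono mult_left_mono p uweight_nonneg)
      have "(p (?g l))\<^sup>2 \<le> (cmod (?g l))\<^sup>2" for l
        using p[of "?g l"] by (simp add: abs_le_square_iff[symmetric])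
      then show "L2_set (\<lambda>l. p (?g l)) {..<m} \<le> L2_set (\<lambda>l. cmod (?g l)) {..<m}"
        unfolding L2_set_def by (intro real_sqrt_le_mono sum_mono)
    qed (use R in auto)
    finally show ?thesis .
  qed
  have "L2_set (\<lambda>j. Re (h j)) \<Lambda> \<le> wnorm1 \<Lambda> (uweight B d) h / R + 20 * L2_set (\<lambda>l. cmod (?g l)) {..<m}"
    by (rule part) (auto simp: mat_apply_design Re_divide_of_real abs_Re_le_cmod)
  moreover have "L2_set (\<lambda>j. Im (h j)) \<Lambda> \<le> wnorm1 \<Lambda> (uweight B d) h / R + 20 * L2_set (\<lambda>l. cmod (?g l)) {..<m}"
    by (rule part) (auto simp: mat_apply_design Im_divide_of_real abs_Im_le_cmod)
  moreover have "L2_set (\<lambda>j. cmod (h j)) \<Lambda> \<le> L2_set (\<lambda>j. Re (h j)) \<Lambda> + L2_set (\<lambda>j. Im (h j)) \<Lambda>"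
  proof -
    have "L2_set (\<lambda>j. cmod (h j)) \<Lambda> \<le> L2_set (\<lambda>j. \<bar>Re (h j)\<bar> + \<bar>Im (h j)\<bar>) \<Lambda>"
      by (intro L2_set_mono) (auto simp: cmod_le)
    also have "\<dots> \<le> L2_set (\<lambda>j. \<bar>Re (h j)\<bar>) \<Lambda> + L2_set (\<lambda>j. \<bar>Im (h j)\<bar>) \<Lambda>" by (rule L2_set_triangle_ineq)
    finally show ?thesis by (simp add: L2_set_def)
  qed
  ultimately show ?thesis by simp
qed

lemma mat_apply_design_le:
  assumes "\<And>j. j \<in> \<Lambda> \<Longrightarrow> \<bar>rphi B d j (t l)\<bar> \<le> uweight B d j"
  shows "cmod (mat_apply (design B d m t) \<Lambda> h l) \<le> wnorm1 \<Lambda> (uweight B d) h / sqrt (real m)"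
proof -
  have "cmod (\<Sum>j\<in>\<Lambda>. h j * complex_of_real (rphi B d j (t l))) \<le> (\<Sum>j\<in>\<Lambda>. uweight B d j * cmod (h j))"
    by (intro order.trans[OF norm_sum] sum_mono) (auto simp: norm_mult mult.commute[of "uweight B d _"] intro!: mult_left_mono assms)
  then show ?thesis unfolding mat_apply_design norm_divide wnorm1_def by (simp add: divide_right_mono)
qed

text \<open>With \<open>Q = K / \<delta>\<^sup>2\<close>, which is at least \<open>18\<close>, the squared
  radius \<open>R\<^sup>2\<close> is a multiple of \<open>Q\<close> and the number \<open>L\<close> of levels
  is at most a multiple of \<open>ln Q\<close>. All numerical constants inside logarithms are absorbed by
  powers of the arguments \<open>Q\<close>, \<open>Q * ln Q\<close>, \<open>n\<close> and \<open>ln Q /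
  (\<delta> * \<epsilon>)\<close> of the logarithms in \<open>polylog\<close>.\<close>

lemma sample_size_bound:
  fixes K \<delta> \<epsilon> :: real and n :: nat
  assumes K: "3 / 4 \<le> K" and \<delta>: "0 < \<delta>" "\<delta> \<le> 1 / 5" and \<epsilon>: "0 < \<epsilon>" "\<epsilon> < 1" and n: "2 \<le> n"
    and m: "10 ^ 12 * K * polylog K n \<delta> \<epsilon> \<le> real m"
  defines "R \<equiv> 200 * sqrt K / \<delta>"
  shows "\<exists>L::nat. 1 \<le> R \<and> R < 2 ^ L / 2 \<and> 2 ^ L \<le> 4 * R \<and>
     44000 * real L * R\<^sup>2 * (ln (256 * real L * R\<^sup>2) * ln (2 * real n) + ln (real L / \<epsilon>)) \<le> real m"
proof -
  define Q where "Q = K / \<delta>\<^sup>2"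
  have \<delta>2: "\<delta>\<^sup>2 \<le> 1 / 25" using power_mono[OF \<delta>(2), of 2] \<delta>(1) by (simp add: power_divide)
  have Q18: "18 \<le> Q"
  proof -
    have "18 * \<delta>\<^sup>2 \<le> K" using \<delta>2 K by linarith
    then show ?thesis unfolding Q_def using \<delta>(1) by (simp add: pos_le_divide_eq)
  qed
  have RQ: "R = 200 * sqrt Q" using \<delta> by (simp add: R_def Q_def real_sqrt_divide)
  have R2: "R\<^sup>2 = 40000 * Q" using Q18 by (simp add: RQ power_mult_distrib)
  have sq1: "1 \<le> sqrt Q" using Q18 by simp
  have R1: "200 \<le> R" using sq1 by (simp add: RQ)
  define k where "k = nat \<lfloor>log 2 R\<rfloor>"
  \<comment> \<open>two more than the integer part of \<open>log 2 R\<close>, so that \<open>R < 2^L / 2\<close> and \<open>2^L \<le> 4 * R\<close>\<close>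
  define L where "L = k + 2"
  have lR: "0 \<le> log 2 R" using R1 by simp
  have k1: "real k \<le> log 2 R" "log 2 R < real k + 1" unfolding k_def using lR by linarith+
  have "2 ^ k = 2 powr real k" by (simp add: powr_realpow)
  also have "\<dots> \<le> 2 powr (log 2 R)" using k1 by simp
  also have "\<dots> = R" using R1 by simp
  finally have L2: "2 ^ L \<le> 4 * R" by (simp add: L_def)
  have "R = 2 powr (log 2 R)" using R1 by simp
  also have "\<dots> < 2 powr (real (k + 1))" using k1 by simp
  also have "\<dots> = 2 ^ (k + 1)" by (subst powr_realpow) auto
  finally have L1: "R < 2 ^ L / 2" by (simp add: L_def)
  have lnQ2: "2 \<le> ln Q"
  proof -
    have "exp 2 = exp 1 * exp (1::real)" by (simp add: exp_add[symmetric])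
    also have "\<dots> \<le> 3 * 3" using exp_le by (intro mult_mono) auto
    also have "\<dots> \<le> Q" using Q18 by simp
    finally show ?thesis using Q18 by (subst ln_ge_iff) auto
  qed
  have LQ: "real L \<le> 6 * ln Q"
  proof -
    have "800 * sqrt Q \<le> Q ^ 4"
    proof -
      have "sqrt Q \<le> Q" using Q18 by (intro real_le_lsqrt) (auto simp: power2_eq_square)
      moreover have "5832 * Q \<le> Q ^ 3 * Q" using Q18 power_mono[of 18 Q 3] by (intro mult_right_mono) auto
      moreover have "Q ^ 4 = Q ^ 3 * Q" by (simp add: power_numeral_reduce)
      ultimately show ?thesis using Q18 by linarith
    qed
    then have le: "4 * R \<le> Q ^ 4" by (simp add: RQ)
    have "real L * ln 2 = ln (2 ^ L)" by (simp add: ln_realpow)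
    also have "\<dots> \<le> ln (Q ^ 4)" using L2 le by (intro ln_mono) auto
    also have "\<dots> = 4 * ln Q" using Q18 by (simp add: ln_realpow)
    finally have a: "real L * ln 2 \<le> 4 * ln Q" .
    have "real L * (2 / 3) \<le> real L * ln 2" using ln2_ge_two_thirds by (intro mult_left_mono) auto
    then show ?thesis using a by linarith
  qed
  define V where "V = Q * ln Q"
  have V36: "36 \<le> V" unfolding V_def using mult_mono[of 18 Q 2 "ln Q"] Q18 lnQ2 by simp
  have L0: "0 < real L" by (simp add: L_def)
  have l1: "ln (256 * real L * R\<^sup>2) \<le> 7 * ln V"
  proof -
    have "256 * real L * R\<^sup>2 \<le> 256 * (6 * ln Q) * (40000 * Q)"
      unfolding R2 using LQ Q18 by (intro mult_right_mono mult_left_mono) auto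
    also have "\<dots> = 61440000 * V" by (simp add: V_def)
    also have "\<dots> \<le> 36 ^ 6 * V" using V36 by simp
    also have "\<dots> \<le> V ^ 6 * V" using V36 by (intro mult_right_mono power_mono) auto
    also have "\<dots> = V ^ 7" by (simp add: power_numeral_reduce)
    finally have "256 * real L * R\<^sup>2 \<le> V ^ 7" .
    then have "ln (256 * real L * R\<^sup>2) \<le> ln (V ^ 7)" using L0 R1 by (intro ln_mono) auto
    then show ?thesis using V36 by (simp add: ln_realpow)
  qed
  have l2: "ln (2 * real n) \<le> 2 * ln (real n)"
  proof -
    have "ln (2 * real n) \<le> ln (real n * real n)" using n by (intro ln_mono) auto
    then show ?thesis using n by (simp add: ln_mult)
  qed
  define Z where "Z = 1 / (\<delta> * \<epsilon>) * ln Q"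
  have l3: "ln (real L / \<epsilon>) \<le> 2 * ln Z"
  proof -
    have "5 * (ln Q / \<epsilon>) \<le> (1 / \<delta>) * (ln Q / \<epsilon>)"
      using \<delta> \<epsilon> lnQ2 by (intro mult_right_mono) (auto simp: le_divide_eq)
    then have Z5: "5 * (ln Q / \<epsilon>) \<le> Z" by (simp add: Z_def)
    have "2 \<le> ln Q / \<epsilon>" using lnQ2 \<epsilon> by (simp add: le_divide_eq)
    then have Z10: "10 \<le> Z" using Z5 by linarith
    have "real L / \<epsilon> \<le> 6 * (ln Q / \<epsilon>)" using LQ \<epsilon> by (simp add: divide_right_mono)
    also have "\<dots> \<le> 10 * Z" using Z5 Z10 by linarith
    also have "\<dots> \<le> Z * Z" using Z10 by (intro mult_right_mono) auto
    finally have "ln (real L / \<epsilon>) \<le> ln (Z * Z)" using L0 \<epsilon> by (intro ln_mono) auto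
    then show ?thesis using Z10 by (simp add: ln_mult)
  qed
  have lnV0: "0 \<le> ln V" "0 \<le> ln (real n)" using V36 n by auto
  have lnZ0: "0 \<le> ln Z"
  proof -
    have "real 2 \<le> real L" by (simp add: L_def)
    then have "0 \<le> ln (real L / \<epsilon>)" using \<epsilon> by (intro ln_ge_zero) (simp add: le_divide_eq)
    then show ?thesis using l3 by linarith
  qed
  define M where "M = max (1 / \<delta> ^ 4 * ln V * ln (real n)) (1 / \<delta> * ln Z)"
  have MA: "ln V * ln (real n) \<le> M"
  proof -
    have "\<delta> ^ 4 \<le> 1" using \<delta> by (intro power_le_one) auto
    then have "1 \<le> 1 / \<delta> ^ 4" using \<delta> by (simp add: le_divide_eq)
    then have "1 * (ln V * ln (real n)) \<le> 1 / \<delta> ^ 4 * (ln V * ln (real n))" using lnV0 by (intro mult_right_mono) auto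
    then show ?thesis by (simp add: M_def mult.assoc)
  qed
  have MB: "ln Z \<le> M"
  proof -
    have "1 \<le> 1 / \<delta>" using \<delta> by (simp add: le_divide_eq)
    then have "1 * ln Z \<le> 1 / \<delta> * ln Z" using lnZ0 by (intro mult_right_mono) auto
    then show ?thesis by (simp add: M_def)
  qed
  have M0: "0 \<le> M" using MB lnZ0 by linarith
  have "44000 * real L * R\<^sup>2 * (ln (256 * real L * R\<^sup>2) * ln (2 * real n) + ln (real L / \<epsilon>))
     \<le> 44000 * (6 * ln Q) * (40000 * Q) * ((7 * ln V) * (2 * ln (real n)) + 2 * ln Z)"
  proof (intro mult_mono add_mono)
    have b1: "1 \<le> 256 * real L * R\<^sup>2"
    proof -
      have "1 * 1 \<le> (256 * real L) * R\<^sup>2" using R1 L0 by (intro mult_mono one_le_power) (auto simp: L_def)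
      then show ?thesis by simp
    qed
    have b0: "0 \<le> ln (256 * real L * R\<^sup>2)" using b1 by (rule ln_ge_zero)
    have b2: "0 \<le> ln (2 * real n)" using n by (intro ln_ge_zero) auto
    show "0 \<le> ln (2 * real n)" by (rule b2)
    have "real 2 \<le> real L" by (simp add: L_def)
    then have "0 \<le> ln (real L / \<epsilon>)" using \<epsilon> by (intro ln_ge_zero) (simp add: le_divide_eq)
    then show "0 \<le> ln (256 * real L * R\<^sup>2) * ln (2 * real n) + ln (real L / \<epsilon>)" using b0 b2 by simp
  qed (use l1 l2 l3 LQ R2 lnV0 lnQ2 Q18 in auto)
  also have "\<dots> = 10560000000 * (Q * ln Q) * (14 * (ln V * ln (real n)) + 2 * ln Z)" by simp
  also have "\<dots> \<le> 10560000000 * (Q * ln Q) * (16 * M)"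
    using MA MB Q18 lnQ2 by (intro mult_left_mono) auto
  also have "\<dots> \<le> 10 ^ 12 * (Q * ln Q * M)"
    using Q18 lnQ2 M0 by (simp add: mult_right_mono)
  also have "\<dots> = 10 ^ 12 * K * polylog K n \<delta> \<epsilon>"
    unfolding polylog_def M_def V_def Z_def Q_def by simp
  also have "\<dots> \<le> real m" by fact
  finally show ?thesis using L1 L2 R1 by (intro exI[of _ L]) auto
qed

section \<open>Deterministic analysis of the weighted LAD-LASSO\<close>

text \<open>On \<open>S\<close> one uses \<open>\<bar>x + h\<bar> \<ge> \<bar>x\<bar> - \<bar>h\<bar>\<close>
  and off \<open>S\<close> one uses \<open>\<bar>x + h\<bar> \<ge> \<bar>h\<bar> -
  \<bar>x\<bar>\<close>.\<close>

lemma cone_inequality: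
  fixes x h :: "'i \<Rightarrow> complex"
  assumes "finite A" "S \<subseteq> A" and p: "\<And>i. i \<in> A \<Longrightarrow> 0 \<le> p i"
  shows "wnorm1 A p h \<le> 2 * wnorm1 S p h + 2 * wnorm1 (A - S) p x
     + (wnorm1 A p (\<lambda>i. x i + h i) - wnorm1 A p x)"
proof -
  have split: "wnorm1 A p y = wnorm1 S p y + wnorm1 (A - S) p y" for y
    unfolding wnorm1_def using assms(1,2) by (simp add: sum.subset_diff[OF assms(2,1)] add.commute)
  have "wnorm1 S p x - wnorm1 S p h \<le> wnorm1 S p (\<lambda>i. x i + h i)"
    unfolding wnorm1_def sum_subtractf[symmetric] right_diff_distrib[symmetric]
    using assms(2) p by (intro sum_mono mult_left_mono norm_diff_ineq) auto
  moreover have "wnorm1 (A - S) p h - wnorm1 (A - S) p x \<le> wnorm1 (A - S) p (\<lambda>i. x i + h i)"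
    unfolding wnorm1_def sum_subtractf[symmetric] right_diff_distrib[symmetric]
  proof (intro sum_mono mult_left_mono)
    fix i show "cmod (h i) - cmod (x i) \<le> cmod (x i + h i)"
      using norm_diff_ineq[of "h i" "x i"] by (simp add: add.commute)
  qed (use p in auto)
  ultimately show ?thesis using split[of x] split[of h] split[of "\<lambda>i. x i + h i"] by linarith
qed

lemma wnorm1_le_wcard:
  assumes "finite A" "S \<subseteq> A" "wcard w S \<le> K"
  shows "wnorm1 S w h \<le> sqrt K * L2_set (\<lambda>i. cmod (h i)) A"
proof -
  have "wnorm1 S w h \<le> (\<Sum>i\<in>S. \<bar>w i\<bar> * \<bar>cmod (h i)\<bar>)"
    unfolding wnorm1_def by (intro sum_mono) (simp add: mult_right_mono)
  also have "\<dots> \<le> L2_set w S * L2_set (\<lambda>i. cmod (h i)) S" by (rule L2_set_mult_ineq)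
  also have "\<dots> \<le> sqrt K * L2_set (\<lambda>i. cmod (h i)) A"
  proof (intro mult_mono)
    show "L2_set w S \<le> sqrt K" using assms(3) by (simp add: L2_set_def wcard_def)
    show "L2_set (\<lambda>i. cmod (h i)) S \<le> L2_set (\<lambda>i. cmod (h i)) A"
      unfolding L2_set_def using assms(1,2) by (intro real_sqrt_le_mono sum_mono2) auto
    show "0 \<le> sqrt K"
      using order.trans[OF sum_nonneg assms(3)[unfolded wcard_def]] by auto
  qed auto
  finally show ?thesis .
qed

lemma wnorm1_nonneg: "(\<And>i. i \<in> A \<Longrightarrow> 0 \<le> w i) \<Longrightarrow> 0 \<le> wnorm1 A w z"
  unfolding wnorm1_def by (intro sum_nonneg) auto

text \<open>The two blocks of unknowns, coefficients and noise, have the sizes \<open>a\<close> and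
  \<open>b\<close>; \<open>\<Theta>\<close> measures how far they are from being balanced.\<close>

locale balance =
  fixes K H lam \<delta> :: real
  assumes K: "0 < K" and H: "0 < H" and lam: "0 < lam" and \<delta>: "0 < \<delta>" "\<delta> \<le> 1 / (1 + 4 * Theta K lam H)"
begin

abbreviation "\<Theta> \<equiv> Theta K lam H"
abbreviation "a \<equiv> sqrt K"
abbreviation "b \<equiv> lam * sqrt H"

lemma ab_pos: "0 < a" "0 < b"
  using K H lam by auto

lemma Theta_eq: "\<Theta> * min a b = sqrt (a\<^sup>2 + b\<^sup>2)"
proof -
  have "0 < min a b" using ab_pos by (simp only: min_less_iff_conj simp_thms)
  then have "min a b \<noteq> 0" by linarith
  then show ?thesis using K H by (simp add: Theta_def power_mult_distrib)
qed

lemma max_le_Theta: "max a b \<le> \<Theta> * min a b"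
  unfolding Theta_eq using ab_pos by (auto simp: max_def intro!: real_le_rsqrt)

lemma Theta_ge_1: "1 \<le> \<Theta>"
proof -
  have "1 * min a b \<le> \<Theta> * min a b" using max_le_Theta by linarith
  then show ?thesis using ab_pos by (simp add: mult_le_cancel_right)
qed

lemma delta_Theta: "\<delta> * \<Theta> \<le> 1 / 4" "\<delta> \<le> 1 / 5"
proof -
  have "\<delta> * (1 + 4 * \<Theta>) \<le> 1" using \<delta> Theta_ge_1 by (simp add: le_divide_eq)
  then have *: "\<delta> + 4 * (\<delta> * \<Theta>) \<le> 1" by (simp add: algebra_simps)
  then show "\<delta> * \<Theta> \<le> 1 / 4" using \<delta> by linarith
  show "\<delta> \<le> 1 / 5" using * mult_left_mono[OF Theta_ge_1, of \<delta>] \<delta> by linarith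
qed

text \<open>Relative to \<open>a b\<close>, the square of \<open>a + b\<close> costs a single factor
  \<open>\<Theta>\<close>, which \<open>\<delta>\<close> can compensate.\<close>

lemma sq_sum_le: "a\<^sup>2 + b\<^sup>2 \<le> 2 * \<Theta> * (a * b)"
proof -
  have s: "sqrt (a\<^sup>2 + b\<^sup>2) \<le> 2 * max a b"
  proof (rule real_le_lsqrt)
    have "a\<^sup>2 \<le> (max a b)\<^sup>2" "b\<^sup>2 \<le> (max a b)\<^sup>2"
      by (rule power_mono[OF max.cobounded1 less_imp_le[OF ab_pos(1)]], rule power_mono[OF max.cobounded2 less_imp_le[OF ab_pos(2)]])
    then have "a\<^sup>2 + b\<^sup>2 \<le> 2 * (max a b)\<^sup>2" by linarith
    also have "\<dots> \<le> (2 * max a b)\<^sup>2" by (simp add: power_mult_distrib)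
    finally show "a\<^sup>2 + b\<^sup>2 \<le> (2 * max a b)\<^sup>2" .
  qed (use ab_pos in auto)
  have "a\<^sup>2 + b\<^sup>2 = sqrt (a\<^sup>2 + b\<^sup>2) * sqrt (a\<^sup>2 + b\<^sup>2)" by simp
  also have "\<dots> \<le> (\<Theta> * min a b) * (2 * max a b)"
    using s ab_pos Theta_ge_1 unfolding Theta_eq[symmetric] by (intro mult_left_mono) auto
  also have "\<dots> = 2 * \<Theta> * (a * b)" by (simp add: min_def max_def)
  finally show ?thesis .
qed

context
  fixes n2 g2 X Y :: real
  assumes nn: "0 \<le> n2" "0 \<le> g2" "0 \<le> X" "0 \<le> Y"
    and n2: "n2 \<le> \<delta> / 100 * X + 40 * g2"
    and g2: "g2\<^sup>2 \<le> \<delta> * X * Y / 10 ^ 6"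
begin

lemma amgm: "4 * ((a * X) * (b * Y)) \<le> (a * X + b * Y)\<^sup>2"
  using sum_squares_bound[of "a * X" "b * Y"] unfolding power2_sum by linarith

text \<open>After inserting the assumption on \<open>n2\<close> there remains the term \<open>(40 a + b)
  g2\<close>. Its square is at most a small multiple of \<open>(a\<^sup>2 + b\<^sup>2) \<delta> X Y\<close>,
  hence of \<open>\<delta> \<Theta> (a X) (b Y)\<close> by \<open>sq_sum_le\<close>, and \<open>\<delta>
  \<Theta> \<le> 1 / 4\<close>.\<close>

lemma null_space_bound: "a * n2 + b * g2 \<le> (a * X + b * Y) / 10"
proof -
  have "(40 * a + b)\<^sup>2 \<le> 3200 * (a\<^sup>2 + b\<^sup>2)"
  proof -
    have "(40 * a + b)\<^sup>2 \<le> (40 * (a + b))\<^sup>2" using ab_pos by (intro power_mono) auto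
    also have "\<dots> \<le> 3200 * (a\<^sup>2 + b\<^sup>2)" using sum_squares_bound[of a b] by (simp add: power_mult_distrib power2_sum)
    finally show ?thesis .
  qed
  also have "\<dots> \<le> 6400 * \<Theta> * (a * b)" using sq_sum_le by simp
  finally have ab: "(40 * a + b)\<^sup>2 \<le> 6400 * \<Theta> * (a * b)" .
  have "((40 * a + b) * g2)\<^sup>2 \<le> (6400 * \<Theta> * (a * b)) * (\<delta> * X * Y / 10 ^ 6)"
    unfolding power_mult_distrib
  proof (rule mult_mono[OF ab g2])
    show "0 \<le> 6400 * \<Theta> * (a * b)" using Theta_ge_1 ab_pos by simp
  qed simp
  also have "\<dots> = 64 / 10000 * (\<delta> * \<Theta>) * ((a * X) * (b * Y))" by simp
  also have "\<dots> \<le> 64 / 10000 * (1 / 4) * ((a * X) * (b * Y))"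
    using delta_Theta nn ab_pos by (intro mult_right_mono mult_left_mono) auto
  also have "\<dots> = (4 * ((a * X) * (b * Y))) / 2500" by simp
  also have "\<dots> \<le> (a * X + b * Y)\<^sup>2 / 2500" by (intro divide_right_mono amgm) simp
  also have "\<dots> = ((a * X + b * Y) / 50)\<^sup>2" by (simp add: power_divide)
  finally have "(40 * a + b) * g2 \<le> (a * X + b * Y) / 50"
    by (rule power2_le_imp_le) (use nn ab_pos in auto)
  moreover have "a * n2 \<le> a * (\<delta> / 100 * X + 40 * g2)" using n2 ab_pos by (intro mult_left_mono) auto
  moreover have "\<delta> * (a * X) \<le> 1 * (a * X)" using delta_Theta(2) nn ab_pos by (intro mult_right_mono) auto
  moreover have "0 \<le> b * Y" "0 \<le> a * X" using nn ab_pos by simp_all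
  ultimately show ?thesis by (simp add: algebra_simps)
qed

text \<open>With \<open>\<Sigma>\<close> the bracket on the right, \<open>a X + b Y\<close> is at most a
  multiple of \<open>max a b * \<Sigma>\<close>. This gives \<open>X \<le> 5 / 2 * \<Theta> *
  \<Sigma>\<close>, and by the inequality of the means \<open>X Y \<le> 2 * \<Theta> *
  \<Sigma>\<^sup>2\<close>.\<close>

lemma l2_bound:
  assumes N: "a * X + b * Y \<le> 5 / 2 * (\<sigma> + lam * \<tau>)" and \<sigma>\<tau>: "0 \<le> \<sigma>" "0 \<le> \<tau>"
  shows "n2 + g2 \<le> sqrt \<delta> * sqrt \<Theta> / 10 * (\<sigma> / sqrt K + \<tau> / sqrt H)"
proof -
  define \<Sigma> where "\<Sigma> = \<sigma> / sqrt K + \<tau> / sqrt H"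
  have \<Sigma>0: "0 \<le> \<Sigma>" unfolding \<Sigma>_def using \<sigma>\<tau> K H by simp
  have "\<sigma> + lam * \<tau> = a * (\<sigma> / sqrt K) + b * (\<tau> / sqrt H)" using K H by simp
  also have "\<dots> \<le> max a b * (\<sigma> / sqrt K) + max a b * (\<tau> / sqrt H)"
    using \<sigma>\<tau> K H by (intro add_mono mult_right_mono) auto
  also have "\<dots> = max a b * \<Sigma>" by (simp add: \<Sigma>_def distrib_left)
  finally have N': "a * X + b * Y \<le> 5 / 2 * (max a b * \<Sigma>)"
    by (intro order.trans[OF N] mult_left_mono) auto
  have "a * X \<le> 5 / 2 * (max a b * \<Sigma>)"
  proof -
    have "0 \<le> b * Y" using nn ab_pos by simp
    then show ?thesis using N' by linarith
  qed
  also have "\<dots> \<le> 5 / 2 * ((\<Theta> * a) * \<Sigma>)"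
  proof -
    have "max a b \<le> \<Theta> * a" 
      using Theta_ge_1 by (intro order.trans[OF max_le_Theta] mult_left_mono min.cobounded1) auto
    then show ?thesis using \<Sigma>0 by (intro mult_left_mono mult_right_mono) auto
  qed
  finally have "a * X \<le> a * (5 / 2 * \<Theta> * \<Sigma>)" by (simp add: mult_ac)
  then have X: "X \<le> 5 / 2 * \<Theta> * \<Sigma>" using ab_pos by (simp add: mult_le_cancel_left)
  have "4 * ((a * b) * (X * Y)) \<le> (a * X + b * Y)\<^sup>2" using amgm by (simp add: mult_ac)
  also have "\<dots> \<le> (5 / 2 * (max a b * \<Sigma>))\<^sup>2" using N' nn ab_pos by (intro power_mono add_nonneg_nonneg) auto
  also have "\<dots> = 25 / 4 * \<Sigma>\<^sup>2 * (max a b * max a b)" by (simp add: power2_eq_square)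
  also have "\<dots> \<le> 25 / 4 * \<Sigma>\<^sup>2 * (max a b * (\<Theta> * min a b))"
    using max_le_Theta ab_pos by (intro mult_left_mono) (auto simp: max_def)
  also have "max a b * (\<Theta> * min a b) = \<Theta> * (a * b)" by (simp add: min_def max_def)
  finally have "(a * b) * (X * Y) \<le> (a * b) * (2 * \<Theta> * \<Sigma>\<^sup>2)"
  proof -
    assume *: "4 * ((a * b) * (X * Y)) \<le> 25 / 4 * \<Sigma>\<^sup>2 * (\<Theta> * (a * b))"
    have "0 \<le> (a * b) * (\<Theta> * \<Sigma>\<^sup>2)" using Theta_ge_1 ab_pos by simp
    moreover have "25 / 4 * \<Sigma>\<^sup>2 * (\<Theta> * (a * b)) = 25 / 4 * ((a * b) * (\<Theta> * \<Sigma>\<^sup>2))" by simp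
    moreover have "(a * b) * (2 * \<Theta> * \<Sigma>\<^sup>2) = 2 * ((a * b) * (\<Theta> * \<Sigma>\<^sup>2))" by simp
    ultimately show ?thesis using * by linarith
  qed
  then have XY: "X * Y \<le> 2 * \<Theta> * \<Sigma>\<^sup>2" using ab_pos by (simp add: mult_le_cancel_left)
  define r where "r = sqrt \<delta> * sqrt \<Theta>"
  have r: "0 \<le> r" "r\<^sup>2 = \<delta> * \<Theta>" using \<delta> Theta_ge_1 by (auto simp: r_def power_mult_distrib)
  have r1: "r \<le> 1" by (rule power2_le_imp_le) (use r delta_Theta in auto)
  have "g2\<^sup>2 \<le> \<delta> * (X * Y) / 10 ^ 6" using g2 by (simp add: mult_ac)
  also have "\<dots> \<le> \<delta> * (2 * \<Theta> * \<Sigma>\<^sup>2) / 10 ^ 6" using XY \<delta> by (intro divide_right_mono mult_left_mono) auto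
  also have "\<dots> \<le> (r * \<Sigma> / 600)\<^sup>2" using r(2) \<delta> Theta_ge_1 by (simp add: power_mult_distrib power_divide)
  finally have "g2 \<le> r * \<Sigma> / 600" by (rule power2_le_imp_le) (use r \<Sigma>0 in auto)
  moreover have "\<delta> / 100 * X \<le> r * \<Sigma> / 40"
  proof -
    have "\<delta> / 100 * X \<le> \<delta> / 100 * (5 / 2 * \<Theta> * \<Sigma>)" using X \<delta> by (intro mult_left_mono) auto
    also have "\<dots> = r * r * \<Sigma> / 40" using r(2) by (simp add: power2_eq_square)
    also have "\<dots> \<le> r * 1 * \<Sigma> / 40" using r r1 \<Sigma>0 by (intro divide_right_mono mult_right_mono mult_left_mono) auto
    finally show ?thesis by simp
  qed
  moreover have "0 \<le> r * \<Sigma>" using r \<Sigma>0 by simp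
  ultimately have "n2 + g2 \<le> r * \<Sigma> / 10" using n2 by linarith
  then show ?thesis by (simp add: r_def \<Sigma>_def)
qed

end
end

text \<open>The assumptions \<open>g\<close> and \<open>mH\<close> bound
  \<open>\<parallel>g\<parallel>\<^sub>2\<close> through \<open>\<parallel>g\<parallel>\<^sub>2\<^sup>2 \<le>
  (MAX i. \<bar>g\<^sub>i\<bar>) * \<parallel>g\<parallel>\<^sub>1\<close>. Then
  \<open>null_space_bound\<close> shows that at most a tenth of the total norm \<open>N\<close> lies on
  \<open>S\<close> and \<open>T\<close>, and optimality of the minimiser, in the form \<open>opt\<close>,
  together with \<open>cone_inequality\<close> for both blocks bounds \<open>N\<close> by the best
  approximation errors.\<close>

lemma lad_lasso_recovery:
  fixes x h :: "'i \<Rightarrow> complex" and e g :: "nat \<Rightarrow> complex" and u :: "'i \<Rightarrow> real" and v :: "nat \<Rightarrow> real"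
  assumes "balance K H lam \<delta>"
    and \<Lambda>: "finite \<Lambda>" and u: "\<And>i. i \<in> \<Lambda> \<Longrightarrow> 0 \<le> u i" and v: "\<And>i. i < m \<Longrightarrow> 1 \<le> v i" and m: "0 < m"
    and iso: "L2_set (\<lambda>i. cmod (h i)) \<Lambda> \<le> \<delta> / 100 * (wnorm1 \<Lambda> u h / sqrt K) + 40 * L2_set (\<lambda>i. cmod (g i)) {..<m}"
    and g: "\<And>i. i < m \<Longrightarrow> cmod (g i) \<le> wnorm1 \<Lambda> u h / sqrt (real m)"
    and mH: "10 ^ 12 * K * (H / \<delta>\<^sup>2) \<le> real m"
    and opt: "wnorm1 \<Lambda> u (\<lambda>i. x i + h i) + lam * wnorm1 {..<m} v (\<lambda>i. - e i + g i)
       \<le> wnorm1 \<Lambda> u x + lam * wnorm1 {..<m} v e"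
    and S: "S \<subseteq> \<Lambda>" "wcard u S \<le> K" and T: "T \<subseteq> {..<m}" "wcard v T \<le> H"
  defines "N \<equiv> wnorm1 \<Lambda> u h + lam * wnorm1 {..<m} v g"
    and "\<sigma> \<equiv> wnorm1 (\<Lambda> - S) u x" and "\<tau> \<equiv> wnorm1 ({..<m} - T) v e"
  shows "N \<le> 5 / 2 * (\<sigma> + lam * \<tau>)"
    and "L2_set (\<lambda>i. cmod (h i)) \<Lambda> + L2_set (\<lambda>i. cmod (g i)) {..<m}
       \<le> sqrt \<delta> * sqrt (Theta K lam H) / 10 * (\<sigma> / sqrt K + \<tau> / sqrt H)"
proof -
  interpret balance K H lam \<delta> by fact
  define X where "X = wnorm1 \<Lambda> u h / sqrt K"
  define Y where "Y = wnorm1 {..<m} v g / sqrt H"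
  define n2 where "n2 = L2_set (\<lambda>i. cmod (h i)) \<Lambda>"
  define g2 where "g2 = L2_set (\<lambda>i. cmod (g i)) {..<m}"
  have v0: "0 \<le> v i" if "i \<in> {..<m}" for i using v[of i] that by simp
  have hu0: "0 \<le> wnorm1 \<Lambda> u h" by (intro wnorm1_nonneg u)
  have gv0: "0 \<le> wnorm1 {..<m} v g" by (intro wnorm1_nonneg v0)
  have nn: "0 \<le> n2" "0 \<le> g2" "0 \<le> X" "0 \<le> Y" unfolding n2_def g2_def X_def Y_def using hu0 gv0 K H by auto
  have n2: "n2 \<le> \<delta> / 100 * X + 40 * g2" using iso by (simp add: n2_def g2_def X_def)
  have "g2\<^sup>2 = (\<Sum>i<m. cmod (g i) * cmod (g i))" by (simp add: g2_def L2_set_def sum_nonneg power2_eq_square)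
  also have "\<dots> \<le> (\<Sum>i<m. wnorm1 \<Lambda> u h / sqrt (real m) * (v i * cmod (g i)))"
  proof (intro sum_mono mult_mono g)
    fix i assume "i \<in> {..<m}"
    then show "cmod (g i) \<le> v i * cmod (g i)" using mult_right_mono[OF v[of i], of "cmod (g i)"] by simp
  qed (use hu0 in auto)
  also have "\<dots> = wnorm1 \<Lambda> u h / sqrt (real m) * wnorm1 {..<m} v g" by (simp add: wnorm1_def sum_distrib_left)
  also have "\<dots> = sqrt (K * H / real m) * (X * Y)" using K H by (simp add: X_def Y_def real_sqrt_mult real_sqrt_divide)
  also have "\<dots> \<le> (\<delta> / 10 ^ 6) * (X * Y)"
  proof (rule mult_right_mono)
    have "10 ^ 12 * (K * H) \<le> real m * \<delta>\<^sup>2" using mH \<delta> by (simp add: pos_divide_le_eq)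
    then have "K * H / real m \<le> (\<delta> / 10 ^ 6)\<^sup>2" using m by (simp add: power_divide field_simps)
    then show "sqrt (K * H / real m) \<le> \<delta> / 10 ^ 6" using \<delta> by (intro real_le_lsqrt) (auto simp: power_divide)
  qed (use nn in auto)
  finally have g2: "g2\<^sup>2 \<le> \<delta> * X * Y / 10 ^ 6" by simp
  have Neq: "N = a * X + b * Y" using K H by (simp add: N_def X_def Y_def)
  have "wnorm1 S u h \<le> a * n2" unfolding n2_def using \<Lambda> S by (rule wnorm1_le_wcard)
  moreover have "wnorm1 T v g \<le> sqrt H * g2" unfolding g2_def using _ T by (rule wnorm1_le_wcard) simp
  then have "lam * wnorm1 T v g \<le> lam * (sqrt H * g2)" using lam by (intro mult_left_mono) auto
  moreover have "a * n2 + b * g2 \<le> N / 10" unfolding Neq by (rule null_space_bound[OF nn n2 g2])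
  ultimately have nsp: "wnorm1 S u h + lam * wnorm1 T v g \<le> N / 10" by (simp add: mult.assoc)
  have 1: "wnorm1 \<Lambda> u h \<le> 2 * wnorm1 S u h + 2 * \<sigma> + (wnorm1 \<Lambda> u (\<lambda>i. x i + h i) - wnorm1 \<Lambda> u x)"
    unfolding \<sigma>_def using \<Lambda> S(1) u by (rule cone_inequality)
  have e: "wnorm1 A v (\<lambda>i. - e i) = wnorm1 A v e" for A by (simp add: wnorm1_def)
  have "wnorm1 {..<m} v g \<le> 2 * wnorm1 T v g + 2 * wnorm1 ({..<m} - T) v (\<lambda>i. - e i)
      + (wnorm1 {..<m} v (\<lambda>i. - e i + g i) - wnorm1 {..<m} v (\<lambda>i. - e i))"
    using _ T(1) v0 by (rule cone_inequality) simp
  then have "wnorm1 {..<m} v g \<le> 2 * wnorm1 T v g + 2 * \<tau> + (wnorm1 {..<m} v (\<lambda>i. - e i + g i) - wnorm1 {..<m} v e)"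
    unfolding e \<tau>_def .
  then have "lam * wnorm1 {..<m} v g \<le> lam * (2 * wnorm1 T v g + 2 * \<tau> + (wnorm1 {..<m} v (\<lambda>i. - e i + g i) - wnorm1 {..<m} v e))"
    using lam by (intro mult_left_mono) auto
  then have "N \<le> 2 * (wnorm1 S u h + lam * wnorm1 T v g) + 2 * (\<sigma> + lam * \<tau>)"
    using 1 opt unfolding N_def by (simp add: algebra_simps)
  moreover have "y \<le> 5 / 2 * w" if "y \<le> 2 * p + 2 * w" "p \<le> y / 10" for y p w :: real
    using that by linarith
  ultimately show N: "N \<le> 5 / 2 * (\<sigma> + lam * \<tau>)" using nsp by blast
  show "L2_set (\<lambda>i. cmod (h i)) \<Lambda> + L2_set (\<lambda>i. cmod (g i)) {..<m}
       \<le> sqrt \<delta> * sqrt (Theta K lam H) / 10 * (\<sigma> / sqrt K + \<tau> / sqrt H)"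
    unfolding n2_def[symmetric] g2_def[symmetric]
    using l2_bound[OF nn n2 g2 N[unfolded Neq]] wnorm1_nonneg[of "\<Lambda> - S" u x] wnorm1_nonneg[of "{..<m} - T" v e] u v0
    unfolding \<sigma>_def \<tau>_def by auto
qed

section \<open>Error bounds for function approximation\<close>

text \<open>Elements of \<open>Z\<close> on which \<open>F\<close> is close to the infimum give the inequality
  up to an arbitrarily small error.\<close>

lemma ennreal_le_affine_INF:
  fixes X b D :: ennreal and F :: "'z \<Rightarrow> ennreal" and c w :: real
  assumes le: "\<And>z. z \<in> Z \<Longrightarrow> X \<le> ennreal c * (F z / ennreal w + b) + D" and c: "0 < c" and w: "0 < w"
  shows "X \<le> ennreal c * ((INF z\<in>Z. F z) / ennreal w + b) + D"
proof (cases "(INF z\<in>Z. F z) = \<infinity>")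
  case True
  then show ?thesis using c w by (simp add: ennreal_mult_top ennreal_top_divide)
next
  case False
  show ?thesis
  proof (rule ennreal_le_epsilon)
    fix r :: real assume r: "0 < r"
    define \<eta> where "\<eta> = r * w / c"
    have \<eta>: "0 < \<eta>" using r c w by (simp add: \<eta>_def)
    have "(INF z\<in>Z. F z) < (INF z\<in>Z. F z) + ennreal \<eta>"
      using False \<eta> by (cases "INF z\<in>Z. F z" rule: ennreal_cases) (auto simp: ennreal_plus[symmetric] ennreal_less_iff simp del: ennreal_plus)
    then obtain z where z: "z \<in> Z" "F z < (INF z\<in>Z. F z) + ennreal \<eta>" by (auto simp: INF_less_iff)
    have "X \<le> ennreal c * (F z / ennreal w + b) + D" by (rule le[OF z(1)])
    also have "\<dots> \<le> ennreal c * (((INF z\<in>Z. F z) + ennreal \<eta>) / ennreal w + b) + D"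
      using z(2) by (intro add_mono mult_left_mono divide_right_mono_ennreal) auto
    also have "\<dots> = ennreal c * ((INF z\<in>Z. F z) / ennreal w + b) + D + ennreal c * (ennreal \<eta> / ennreal w)"
      by (simp add: add_divide_distrib_ennreal distrib_left add_ac)
    also have "ennreal c * (ennreal \<eta> / ennreal w) = ennreal r"
    proof -
      have "ennreal \<eta> / ennreal w = ennreal (\<eta> / w)" using w \<eta> by (simp add: divide_ennreal)
      moreover have "ennreal c * ennreal (\<eta> / w) = ennreal (c * (\<eta> / w))"
        by (rule ennreal_mult[symmetric]) (use c w \<eta> in auto)
      ultimately show ?thesis using c w by (simp add: \<eta>_def)
    qed
    finally show "X \<le> ennreal c * ((INF z\<in>Z. F z) / ennreal w + b) + D + ennreal r" .
  qed
qed

lemma real_le_affine_INF: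
  fixes X \<alpha> \<beta> :: real
  assumes le: "\<And>z. z \<in> Z \<Longrightarrow> X \<le> \<alpha> + \<beta> * F z" and \<beta>: "0 < \<beta>" and "Z \<noteq> {}"
  shows "X \<le> \<alpha> + \<beta> * (INF z\<in>Z. F z)"
proof -
  have "(X - \<alpha>) / \<beta> \<le> (INF z\<in>Z. F z)"
  proof (rule cINF_greatest[OF assms(3)])
    fix z assume "z \<in> Z"
    from le[OF this] show "(X - \<alpha>) / \<beta> \<le> F z" using \<beta> by (simp add: pos_divide_le_eq mult.commute)
  qed
  then show ?thesis using \<beta> by (simp add: pos_divide_le_eq mult.commute)
qed

lemma in_LinfE:
  assumes "in_Linf M f"
  obtains C where "f \<in> borel_measurable M" "AE t in M. cmod (f t) \<le> C"
proof -
  have f: "f \<in> borel_measurable M" "Linf_norm M f < \<infinity>" using assms by (auto simp: in_Linf_def)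
  have "AE t in M. ennreal (cmod (f t)) \<le> Linf_norm M f" unfolding Linf_norm_def by (rule esssup_AE)
  then have "AE t in M. cmod (f t) \<le> enn2real (Linf_norm M f)"
  proof eventually_elim
    case (elim t)
    then have "enn2real (ennreal (cmod (f t))) \<le> enn2real (Linf_norm M f)" using f(2) by (intro enn2real_mono) auto
    then show ?case by simp
  qed
  then show ?thesis using that f(1) by blast
qed

lemma expansion_measurable [measurable]: "expansion B d \<Lambda> z \<in> borel_measurable (nu B d)"
  unfolding expansion_def[abs_def] by measurable

lemma AE_expansion_le:
  assumes "finite \<Lambda>"
  shows "AE t in nu B d. cmod (expansion B d \<Lambda> z t) \<le> (\<Sum>i\<in>\<Lambda>. cmod (z i) * uweight B d i)"
proof -
  have "AE t in nu B d. \<forall>i\<in>\<Lambda>. \<bar>rphi B d i t\<bar> \<le> uweight B d i"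
    using assms AE_rphi_le by (subst AE_finite_all) auto
  then show ?thesis
  proof eventually_elim
    case (elim t)
    then show ?case unfolding expansion_def
      by (intro order.trans[OF norm_sum] sum_mono) (auto simp: norm_mult phi_eq intro!: mult_left_mono)
  qed
qed

lemma coeffs_of_expansion:
  assumes "finite \<Lambda>" "\<Lambda> \<subseteq> mindices d" "j \<in> mindices d"
  shows "coeffs_of B d (expansion B d \<Lambda> z) j = (if j \<in> \<Lambda> then z j else 0)"
proof -
  have i: "integrable (nu B d) (\<lambda>t. phi B d i t * cnj (phi B d j t))" for i
    using AE_rphi_le[of B d i] by (intro integrable_mult_cnj_phi[where C = "uweight B d i"]) (auto simp: phi_eq)
  have "coeffs_of B d (expansion B d \<Lambda> z) j = (LINT t|nu B d. (\<Sum>i\<in>\<Lambda>. z i * (phi B d i t * cnj (phi B d j t))))"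
    by (simp add: coeffs_of_def expansion_def sum_distrib_right mult.assoc)
  also have "\<dots> = (\<Sum>i\<in>\<Lambda>. z i * (LINT t|nu B d. phi B d i t * cnj (phi B d j t)))"
    using i by (subst Bochner_Integration.integral_sum) auto
  also have "\<dots> = (\<Sum>i\<in>\<Lambda>. z i * (if i = j then 1 else 0))"
    using assms by (intro sum.cong refl) (simp add: integral_phi_cnj_phi subset_iff)
  also have "\<dots> = (if j \<in> \<Lambda> then z j else 0)"
    using assms(1) by (simp add: if_distrib[where f = "\<lambda>x. _ * x"] cong: if_cong)
  finally show ?thesis .
qed

lemma coeffs_of_diff:
  assumes "f \<in> borel_measurable (nu B d)" "AE t in nu B d. cmod (f t) \<le> C"
    and "g \<in> borel_measurable (nu B d)" "AE t in nu B d. cmod (g t) \<le> C'"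
  shows "coeffs_of B d (\<lambda>p. f p - g p) i = coeffs_of B d f i - coeffs_of B d g i"
  unfolding coeffs_of_def left_diff_distrib
  using integrable_mult_cnj_phi[OF assms(1,2)] integrable_mult_cnj_phi[OF assms(3,4)]
  by (rule Bochner_Integration.integral_diff)

text \<open>Pythagoras: \<open>f\<close> is orthogonal to the span of the basis functions in
  \<open>\<Lambda>\<close>.\<close>

lemma L2_norm_diff_expansion_le:
  assumes \<Lambda>: "finite \<Lambda>" "\<Lambda> \<subseteq> mindices d"
    and f [measurable]: "f \<in> borel_measurable (nu B d)" and fb: "AE t in nu B d. cmod (f t) \<le> C"
    and orth: "\<And>j. j \<in> \<Lambda> \<Longrightarrow> coeffs_of B d f j = 0"
  shows "L2_norm (nu B d) (\<lambda>p. f p - expansion B d \<Lambda> h p) \<le> L2_norm (nu B d) f + L2_set (\<lambda>j. cmod (h j)) \<Lambda>"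
proof -
  interpret prob_space "nu B d" by (rule prob_space_nu)
  let ?E = "expansion B d \<Lambda> h"
  define W where "W = (\<Sum>i\<in>\<Lambda>. cmod (h i) * uweight B d i)"
  have Eb: "AE t in nu B d. cmod (?E t) \<le> W" unfolding W_def by (rule AE_expansion_le[OF \<Lambda>(1)])
  have fi: "integrable (nu B d) (\<lambda>t. (cmod (f t))\<^sup>2)"
  proof (rule integrable_const_bound[where B = "C\<^sup>2"])
    show "AE t in nu B d. norm ((cmod (f t))\<^sup>2) \<le> C\<^sup>2" using fb by eventually_elim (simp add: power_mono)
  qed measurable
  have Ei: "integrable (nu B d) (\<lambda>t. (cmod (?E t))\<^sup>2)"
  proof (rule integrable_const_bound[where B = "W\<^sup>2"])
    show "AE t in nu B d. norm ((cmod (?E t))\<^sup>2) \<le> W\<^sup>2" using Eb by eventually_elim (simp add: power_mono)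
  qed measurable
  have fphi: "integrable (nu B d) (\<lambda>t. f t * cnj (phi B d j t))" for j by (rule integrable_mult_cnj_phi[OF f fb])
  have fE: "f t * cnj (?E t) = (\<Sum>j\<in>\<Lambda>. cnj (h j) * (f t * cnj (phi B d j t)))" for t
    by (simp add: expansion_def sum_distrib_left mult_ac)
  have fEi: "integrable (nu B d) (\<lambda>t. f t * cnj (?E t))"
    unfolding fE using fphi by (intro Bochner_Integration.integrable_sum integrable_mult_right) auto
  have fE0: "(LINT t|nu B d. f t * cnj (?E t)) = 0"
    unfolding fE using fphi orth
    by (subst Bochner_Integration.integral_sum) (auto simp: coeffs_of_def intro!: sum.neutral)
  define q where "q t = Re (f t * cnj (?E t))" for t
  have Rei: "integrable (nu B d) q" unfolding q_def using fEi by (rule integrable_Re)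
  have Re0: "(LINT t|nu B d. q t) = 0" unfolding q_def using integral_Re[OF fEi] fE0 by simp
  have Re_E: "Re (?E t) = (\<Sum>j\<in>\<Lambda>. Re (h j) * rphi B d j t)" and Im_E: "Im (?E t) = (\<Sum>j\<in>\<Lambda>. Im (h j) * rphi B d j t)" for t
    by (simp_all add: expansion_def phi_eq)
  have qi: "integrable (nu B d) (\<lambda>t. (\<Sum>j\<in>\<Lambda>. b j * rphi B d j t)\<^sup>2)" for b
  proof -
    have "(\<lambda>t. (\<Sum>j\<in>\<Lambda>. b j * rphi B d j t)\<^sup>2) = (\<lambda>t. \<Sum>i\<in>\<Lambda>. \<Sum>j\<in>\<Lambda>. b i * b j * (rphi B d i t * rphi B d j t))"
      by (simp add: power2_eq_square sum_product mult_ac)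
    then show ?thesis using integrable_rphi_mult by simp
  qed
  have E2: "(LINT t|nu B d. (cmod (?E t))\<^sup>2) = (\<Sum>j\<in>\<Lambda>. (cmod (h j))\<^sup>2)"
    unfolding cmod_power2 Re_E Im_E
    using qi by (subst Bochner_Integration.integral_add) (auto simp: integral_rphi_combination[OF \<Lambda>] sum.distrib)
  have "(LINT t|nu B d. (cmod (f t - ?E t))\<^sup>2) = (LINT t|nu B d. (cmod (f t))\<^sup>2 + (cmod (?E t))\<^sup>2 - 2 * q t)"
    unfolding cmod_power2 q_def by (intro Bochner_Integration.integral_cong refl) (simp add: power2_eq_square algebra_simps)
  also have "\<dots> = (LINT t|nu B d. (cmod (f t))\<^sup>2) + (\<Sum>j\<in>\<Lambda>. (cmod (h j))\<^sup>2)"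
    using fi Ei Rei by (subst Bochner_Integration.integral_diff) (auto simp: Re0 E2)
  finally have eq: "(LINT t|nu B d. (cmod (f t - ?E t))\<^sup>2) = (LINT t|nu B d. (cmod (f t))\<^sup>2) + (\<Sum>j\<in>\<Lambda>. (cmod (h j))\<^sup>2)" .
  have "0 \<le> (LINT t|nu B d. (cmod (f t))\<^sup>2)" by simp
  then show ?thesis unfolding L2_norm_def L2_set_def eq by (intro sqrt_add_le_add_sqrt sum_nonneg) auto
qed

lemma C1_ge_3:
  assumes "0 < \<delta>" "\<delta> < 1 / 5"
  shows "3 \<le> C1 \<delta>"
proof -
  have "0 < rho \<delta>" "rho \<delta> < 1" using assms by (auto simp: rho_def field_simps)
  then show ?thesis by (simp add: C1_def le_divide_eq)
qed

lemma C2_ge: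
  assumes "0 < \<delta>" "\<delta> < 1 / 5"
  shows "sqrt \<delta> \<le> C2 \<delta>"
proof -
  define r where "r = rho \<delta>"
  have r: "0 < r" "r < 1" using assms by (auto simp: r_def rho_def field_simps)
  have "\<delta> \<le> r" using assms by (simp add: r_def rho_def le_divide_eq)
  then have "sqrt \<delta> \<le> sqrt r" by simp
  also have "\<dots> \<le> 4 * sqrt 2 * (1 + r) * max r (2 * sqrt r)"
  proof -
    have "1 \<le> 4 * sqrt 2 * (1 + r)"
    proof -
      have "1 * 1 \<le> (4 * sqrt 2) * (1 + r)" using r by (intro mult_mono) (auto intro: order.trans[of 1 4])
      then show ?thesis by simp
    qed
    then have "1 * sqrt r \<le> 4 * sqrt 2 * (1 + r) * max r (2 * sqrt r)"
      using r by (intro mult_mono) (auto simp: le_max_iff_disj)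
    then show ?thesis by simp
  qed
  also have "\<dots> \<le> 4 * sqrt 2 * (1 + r) * max r (2 * sqrt r) / (1 - r)"
  proof -
    have "0 \<le> 4 * sqrt 2 * (1 + r) * max r (2 * sqrt r)" using r by (auto simp: le_max_iff_disj)
    then show ?thesis using r by (simp add: le_divide_eq mult_left_le)
  qed
  finally show ?thesis by (simp add: C2_def r_def)
qed

lemma (in balance) delta_lt: "\<delta> < 1 / 5"
proof -
  have m0: "0 < min a b" using ab_pos by (simp only: min_less_iff_conj simp_thms)
  have "max a b < sqrt (a\<^sup>2 + b\<^sup>2)"
    using ab_pos by (intro real_less_rsqrt) (auto simp: max_def)
  then have "1 * min a b < \<Theta> * min a b" unfolding Theta_eq by linarith
  then have "1 < \<Theta>" using m0 by (simp only: mult_less_cancel_right_pos)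
  then have "1 / (1 + 4 * \<Theta>) < 1 / 5" by (intro divide_strict_left_mono) auto
  then show ?thesis using \<delta> by linarith
qed

lemma mat_apply_diff: "mat_apply A \<Lambda> (\<lambda>i. z i - y i) l = mat_apply A \<Lambda> z l - mat_apply A \<Lambda> y l"
  by (simp add: mat_apply_def right_diff_distrib sum_subtractf)

text \<open>The error of best approximation sees the coefficients of \<open>x\<close> on \<open>\<Lambda> -
  supp z'\<close> and all coefficients outside \<open>\<Lambda>\<close>.\<close>

lemma weighted_tail_split:
  assumes \<Lambda>: "finite \<Lambda>" "\<Lambda> \<subseteq> mindices d" and S: "supp z' \<subseteq> \<Lambda>"
  shows "ennreal (wnorm1 (\<Lambda> - supp z') (uweight B d) x)
      + (\<Sum>\<^sub>\<infinity>i\<in>mindices d - \<Lambda>. ennreal (uweight B d i * cmod (x i)))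
    \<le> (\<Sum>\<^sub>\<infinity>i\<in>mindices d. ennreal (uweight B d i * cmod (x i - z' i)))"
proof -
  let ?F = "\<lambda>i. ennreal (uweight B d i * cmod (x i - z' i))"
  have sm: "?F summable_on X" for X by (rule nonneg_summable_on_complete) simp
  have "(\<Sum>\<^sub>\<infinity>i\<in>mindices d. ?F i) = (\<Sum>\<^sub>\<infinity>i\<in>\<Lambda> \<union> (mindices d - \<Lambda>). ?F i)"
    using \<Lambda>(2) by (simp add: Un_absorb1)
  also have "\<dots> = (\<Sum>\<^sub>\<infinity>i\<in>\<Lambda>. ?F i) + (\<Sum>\<^sub>\<infinity>i\<in>mindices d - \<Lambda>. ?F i)"
    by (rule infsum_Un_disjoint[OF sm sm]) auto
  also have "(\<Sum>\<^sub>\<infinity>i\<in>mindices d - \<Lambda>. ?F i) = (\<Sum>\<^sub>\<infinity>i\<in>mindices d - \<Lambda>. ennreal (uweight B d i * cmod (x i)))"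
  proof (rule infsum_cong)
    fix i assume "i \<in> mindices d - \<Lambda>"
    then have "z' i = 0" using S by (auto simp: supp_def)
    then show "?F i = ennreal (uweight B d i * cmod (x i))" by simp
  qed
  also have "(\<Sum>\<^sub>\<infinity>i\<in>\<Lambda>. ?F i) = (\<Sum>i\<in>\<Lambda>. ?F i)" using \<Lambda>(1) by simp
  finally have eq: "(\<Sum>\<^sub>\<infinity>i\<in>mindices d. ?F i) = (\<Sum>i\<in>\<Lambda>. ?F i)
      + (\<Sum>\<^sub>\<infinity>i\<in>mindices d - \<Lambda>. ennreal (uweight B d i * cmod (x i)))" .
  have "ennreal (wnorm1 (\<Lambda> - supp z') (uweight B d) x) \<le> (\<Sum>i\<in>\<Lambda>. ?F i)"
  proof -
    have "ennreal (wnorm1 (\<Lambda> - supp z') (uweight B d) x) = (\<Sum>i\<in>\<Lambda> - supp z'. ?F i)"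
      unfolding wnorm1_def by (subst sum_ennreal[symmetric]) (auto simp: supp_def uweight_nonneg)
    also have "\<dots> \<le> (\<Sum>i\<in>\<Lambda>. ?F i)" using \<Lambda>(1) by (intro sum_mono2) auto
    finally show ?thesis .
  qed
  then show ?thesis unfolding eq by (rule add_right_mono)
qed

lemma Linf_norm_diff_expansion_le:
  assumes d: "1 \<le> d" and \<Lambda>: "finite \<Lambda>" "\<Lambda> \<subseteq> mindices d"
    and f: "f \<in> borel_measurable (nu B d)" "AE t in nu B d. cmod (f t) \<le> C"
    and h: "\<And>i. i \<in> \<Lambda> \<Longrightarrow> h i = xh i - coeffs_of B d f i"
  shows "Linf_norm (nu B d) (\<lambda>p. f p - expansion B d \<Lambda> xh p)
    \<le> ennreal (wnorm1 \<Lambda> (uweight B d) h)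
      + (\<Sum>\<^sub>\<infinity>i\<in>mindices d - \<Lambda>. ennreal (uweight B d i * cmod (coeffs_of B d f i)))"
proof -
  let ?g = "\<lambda>p. f p - expansion B d \<Lambda> xh p"
  define W where "W = (\<Sum>i\<in>\<Lambda>. cmod (xh i) * uweight B d i)"
  have Eb: "AE t in nu B d. cmod (expansion B d \<Lambda> xh t) \<le> W" unfolding W_def by (rule AE_expansion_le[OF \<Lambda>(1)])
  have gb: "AE t in nu B d. cmod (?g t) \<le> C + W"
    using f(2) Eb
  proof eventually_elim
    case (elim t)
    then show ?case using norm_triangle_ineq4[of "f t" "expansion B d \<Lambda> xh t"] by linarith
  qed
  have gm: "?g \<in> borel_measurable (nu B d)" using f(1) by measurable
  have co: "coeffs_of B d ?g i = coeffs_of B d f i - (if i \<in> \<Lambda> then xh i else 0)" if "i \<in> mindices d" for i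
    using coeffs_of_diff[OF f expansion_measurable Eb] coeffs_of_expansion[OF \<Lambda> that] by simp
  let ?F = "\<lambda>i. ennreal (uweight B d i * cmod (coeffs_of B d ?g i))"
  have sm: "?F summable_on X" for X by (rule nonneg_summable_on_complete) simp
  have "Linf_norm (nu B d) ?g \<le> (\<Sum>\<^sub>\<infinity>i\<in>mindices d. ?F i)" by (rule Linf_norm_le_coeff_sum[OF d gm gb])
  also have "\<dots> = (\<Sum>\<^sub>\<infinity>i\<in>\<Lambda> \<union> (mindices d - \<Lambda>). ?F i)"
    using \<Lambda>(2) by (simp add: Un_absorb1)
  also have "\<dots> = (\<Sum>\<^sub>\<infinity>i\<in>\<Lambda>. ?F i) + (\<Sum>\<^sub>\<infinity>i\<in>mindices d - \<Lambda>. ?F i)"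
    by (rule infsum_Un_disjoint[OF sm sm]) auto
  also have "(\<Sum>\<^sub>\<infinity>i\<in>mindices d - \<Lambda>. ?F i) = (\<Sum>\<^sub>\<infinity>i\<in>mindices d - \<Lambda>. ennreal (uweight B d i * cmod (coeffs_of B d f i)))"
    by (intro infsum_cong) (auto simp: co)
  also have "(\<Sum>\<^sub>\<infinity>i\<in>\<Lambda>. ?F i) = ennreal (wnorm1 \<Lambda> (uweight B d) h)"
  proof -
    have "(\<Sum>i\<in>\<Lambda>. ?F i) = ennreal (\<Sum>i\<in>\<Lambda>. uweight B d i * cmod (coeffs_of B d ?g i))"
      by (intro sum_ennreal) (simp add: uweight_nonneg)
    also have "(\<Sum>i\<in>\<Lambda>. uweight B d i * cmod (coeffs_of B d ?g i)) = wnorm1 \<Lambda> (uweight B d) h"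
      unfolding wnorm1_def
    proof (intro sum.cong refl)
      fix i assume i: "i \<in> \<Lambda>"
      then have "coeffs_of B d ?g i = - h i" using \<Lambda>(2) h[OF i] by (subst co) auto
      then show "uweight B d i * cmod (coeffs_of B d ?g i) = uweight B d i * cmod (h i)" by simp
    qed
    finally show ?thesis using \<Lambda>(1) by simp
  qed
  finally show ?thesis .
qed

text \<open>On a sample for which the bounds of \<open>sampling_isometry\<close> hold,
  \<open>lad_lasso_recovery\<close> applies with \<open>S = supp z'\<close> and \<open>T = supp e' \<inter>
  {..<m}\<close> for all competitors \<open>z'\<close> and \<open>e'\<close> in the definitions of
  \<open>sigma_L\<close> and \<open>sigma_H\<close>. Infima over \<open>e'\<close> and then over
  \<open>z'\<close> give the two estimates. The coefficients outside \<open>\<Lambda>\<close> enter the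
  uniform norm as \<open>rest\<close>, which is also part of every \<open>tail z'\<close>.\<close>

lemma recovery_on_event:
  fixes f :: "(nat \<Rightarrow> real) \<Rightarrow> complex" and e :: "nat \<Rightarrow> complex"
  assumes d: "1 \<le> d" and s: "2 \<le> s" "s \<le> 2 ^ (d + 1)"
    and lam: "0 < lam" and H: "0 < H" and v: "\<And>i. i < m \<Longrightarrow> 1 \<le> v i"
    and \<delta>: "0 < \<delta>" "\<delta> \<le> 1 / (1 + 4 * Theta (Kfun B d s) lam H)"
    and m0: "0 < m" and mH: "10 ^ 12 * Kfun B d s * (H / \<delta>\<^sup>2) \<le> real m"
    and bd: "\<And>l j. l < m \<Longrightarrow> j \<in> hyp_cross d s \<Longrightarrow> \<bar>rphi B d j (t l)\<bar> \<le> uweight B d j"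
    and iso: "\<And>c. (\<Sum>j\<in>hyp_cross d s. uweight B d j * \<bar>c j\<bar>) \<le> (200 * sqrt (Kfun B d s) / \<delta>) * L2_set c (hyp_cross d s) \<Longrightarrow>
         real m / 400 * (L2_set c (hyp_cross d s))\<^sup>2 \<le> (\<Sum>l<m. (\<Sum>j\<in>hyp_cross d s. c j * rphi B d j (t l))\<^sup>2)"
    and f: "in_Linf (nu B d) f"
    and min: "lad_lasso_minimizer B d (hyp_cross d s) m v lam t
        (\<lambda>i. mat_apply (design B d m t) (hyp_cross d s) (restrict_to (hyp_cross d s) (coeffs_of B d f)) i + e i) xh"
  defines "K \<equiv> Kfun B d s" and "\<Lambda> \<equiv> hyp_cross d s" and "x \<equiv> coeffs_of B d f"
  defines "A \<equiv> design B d m t" and "fh \<equiv> expansion B d (hyp_cross d s) xh"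
  defines "res \<equiv> (\<lambda>i. e i - (mat_apply A \<Lambda> (restrict_to \<Lambda> x) i + e i - mat_apply A \<Lambda> xh i))"
  shows "Linf_norm (nu B d) (\<lambda>p. f p - fh p) + ennreal (lam * wnorm1 {..<m} v res)
           \<le> ennreal (C1 \<delta>) * (sigma_L B d s x + ennreal (lam * sigma_H m v H e))" (is ?claim1)
    and "ennreal (L2_norm (nu B d) (\<lambda>p. f p - fh p) + L2_set (\<lambda>i. cmod (res i)) {..<m})
           \<le> ennreal (C2 \<delta> * (1 + sqrt (Theta K lam H))) *
               (sigma_L B d s x / ennreal (real s powr (gam B / 2)) + ennreal (sigma_H m v H e / sqrt H)) +
             ennreal (L2_norm (nu B d) (\<lambda>p. f p - expansion B d \<Lambda> x p))" (is ?claim2)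
proof -
  let ?u = "uweight B d"
  have \<Lambda>: "finite \<Lambda>" "\<Lambda> \<subseteq> mindices d" unfolding \<Lambda>_def by (rule finite_hyp_cross, auto simp: hyp_cross_def)
  have sK: "real s powr gam B \<le> 4 * K" unfolding K_def using s by (intro Kfun_ge) auto
  have s_pos: "0 < real s powr gam B" using s by simp
  then have K0: "0 < K" using sK by linarith
  interpret balance K H lam \<delta>
    using K0 H lam \<delta> unfolding K_def by unfold_locales
  define xL where "xL = restrict_to \<Lambda> x"
  define h where "h i = xh i - xL i" for i
  define g where "g = mat_apply A \<Lambda> h"
  have res: "res = g" unfolding res_def g_def h_def xL_def[symmetric] by (simp add: mat_apply_diff fun_eq_iff)
  have suppL: "supp xL \<subseteq> \<Lambda>" by (auto simp: xL_def restrict_to_def supp_def)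
  have minle: "wnorm1 \<Lambda> ?u xh + lam * wnorm1 {..<m} v (\<lambda>i. mat_apply A \<Lambda> xh i - (mat_apply A \<Lambda> xL i + e i))
      \<le> wnorm1 \<Lambda> ?u xL + lam * wnorm1 {..<m} v (\<lambda>i. mat_apply A \<Lambda> xL i - (mat_apply A \<Lambda> xL i + e i))"
    using min[unfolded lad_lasso_minimizer_def is_arg_min_linorder]
    unfolding \<Lambda>_def[symmetric] x_def[symmetric] A_def[symmetric] xL_def[symmetric]
    using suppL by blast
  have opt: "wnorm1 \<Lambda> ?u (\<lambda>i. xL i + h i) + lam * wnorm1 {..<m} v (\<lambda>i. - e i + g i)
       \<le> wnorm1 \<Lambda> ?u xL + lam * wnorm1 {..<m} v e"
  proof -
    have "(\<lambda>i. mat_apply A \<Lambda> xh i - (mat_apply A \<Lambda> xL i + e i)) = (\<lambda>i. - e i + g i)"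
      by (simp add: g_def h_def[abs_def] mat_apply_diff fun_eq_iff)
    moreover have "wnorm1 {..<m} v (\<lambda>i. mat_apply A \<Lambda> xL i - (mat_apply A \<Lambda> xL i + e i)) = wnorm1 {..<m} v e"
      by (simp add: wnorm1_def)
    ultimately show ?thesis using minle by (simp add: h_def)
  qed
  have iso': "L2_set (\<lambda>i. cmod (h i)) \<Lambda> \<le> \<delta> / 100 * (wnorm1 \<Lambda> ?u h / sqrt K) + 40 * L2_set (\<lambda>i. cmod (g i)) {..<m}"
  proof -
    have "L2_set (\<lambda>j. cmod (h j)) \<Lambda> \<le> 2 * wnorm1 \<Lambda> ?u h / (200 * sqrt K / \<delta>) + 40 * L2_set (\<lambda>l. cmod (g l)) {..<m}"
      unfolding g_def A_def
      by (rule l2_norm_le_samples) (use K0 \<delta> m0 iso in \<open>auto simp: K_def \<Lambda>_def\<close>)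
    then show ?thesis by (simp add: field_simps)
  qed
  have gb: "cmod (g i) \<le> wnorm1 \<Lambda> ?u h / sqrt (real m)" if "i < m" for i
    unfolding g_def A_def using bd[OF that] by (intro mat_apply_design_le) (auto simp: \<Lambda>_def)
  define n2 where "n2 = L2_set (\<lambda>i. cmod (h i)) \<Lambda>"
  define g2 where "g2 = L2_set (\<lambda>i. cmod (g i)) {..<m}"
  define N where "N = wnorm1 \<Lambda> ?u h + lam * wnorm1 {..<m} v g"
  define q where "q = sqrt \<delta> * sqrt (Theta K lam H) / 10"
  have q0: "0 < q" unfolding q_def using \<delta> Theta_ge_1 by simp
  define \<tau> where "\<tau> = sigma_H m v H e"
  define Z where "Z = {z'. finite (supp z') \<and> card (supp z') \<le> s \<and> lower_set d (supp z')}"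
  define tail where "tail z' = (\<Sum>\<^sub>\<infinity>i\<in>mindices d. ennreal (?u i * cmod (x i - z' i)))" for z'
  have sigma: "sigma_L B d s x = (INF z'\<in>Z. tail z')" by (simp add: sigma_L_def Z_def tail_def)
  define rest where "rest = (\<Sum>\<^sub>\<infinity>i\<in>mindices d - \<Lambda>. ennreal (?u i * cmod (x i)))"
  have v0: "0 \<le> v i" if "i < m" for i using v[OF that] by linarith
  have W: "{e'. wcard v (supp e' \<inter> {..<m}) \<le> H} \<noteq> {}"
  proof -
    have "(\<lambda>_. 0) \<in> {e'. wcard v (supp e' \<inter> {..<m}) \<le> H}" using H by (simp add: supp_def wcard_def)
    then show ?thesis by blast
  qed
  have \<tau>0: "0 \<le> \<tau>" unfolding \<tau>_def sigma_H_def using W by (intro cINF_greatest wnorm1_nonneg v0) auto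
  have bounds: "N \<le> 5 / 2 * (\<sigma> + lam * \<tau>)" "n2 + g2 \<le> q * (\<sigma> / sqrt K + \<tau> / sqrt H)"
    if z: "z' \<in> Z" and \<sigma>: "\<sigma> = wnorm1 (\<Lambda> - supp z') ?u x" for z' \<sigma>
  proof -
    have S: "supp z' \<subseteq> \<Lambda>" unfolding \<Lambda>_def using z by (intro lower_set_subset_hyp_cross) (auto simp: Z_def)
    have wS: "wcard ?u (supp z') \<le> K" unfolding K_def using z by (intro wcard_le_Kfun) (auto simp: Z_def)
    have \<sigma>': "\<sigma> = wnorm1 (\<Lambda> - supp z') ?u xL"
      unfolding \<sigma> wnorm1_def xL_def restrict_to_def by (intro sum.cong) auto
    have each: "N \<le> 5 / 2 * (\<sigma> + lam * w)" "n2 + g2 \<le> q * (\<sigma> / sqrt K + w / sqrt H)"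
      if e': "wcard v (supp e' \<inter> {..<m}) \<le> H" and w: "w = wnorm1 {..<m} v (\<lambda>i. e i - e' i)" for e' w
    proof -
      define \<tau>' where "\<tau>' = wnorm1 ({..<m} - supp e' \<inter> {..<m}) v e"
      have "\<tau>' = wnorm1 ({..<m} - supp e' \<inter> {..<m}) v (\<lambda>i. e i - e' i)"
        unfolding \<tau>'_def wnorm1_def by (intro sum.cong) (auto simp: supp_def)
      also have "\<dots> \<le> w" unfolding w wnorm1_def by (intro sum_mono2) (auto simp: v0)
      finally have \<tau>w: "\<tau>' \<le> w" .
      have r: "N \<le> 5 / 2 * (\<sigma> + lam * \<tau>')" "n2 + g2 \<le> q * (\<sigma> / sqrt K + \<tau>' / sqrt H)"
        unfolding N_def n2_def g2_def q_def \<sigma>' \<tau>'_def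
        using lad_lasso_recovery[OF balance_axioms \<Lambda>(1) uweight_nonneg v m0 iso' gb _ opt S wS _ e'] mH
        by (auto simp: K_def)
      have "lam * \<tau>' \<le> lam * w" using \<tau>w lam by (intro mult_left_mono) auto
      then show "N \<le> 5 / 2 * (\<sigma> + lam * w)" using r(1) by argo
      have "\<tau>' / sqrt H \<le> w / sqrt H" using \<tau>w H by (intro divide_right_mono) auto
      then have "q * (\<sigma> / sqrt K + \<tau>' / sqrt H) \<le> q * (\<sigma> / sqrt K + w / sqrt H)" using q0 by (intro mult_left_mono) auto
      then show "n2 + g2 \<le> q * (\<sigma> / sqrt K + w / sqrt H)" using r(2) by linarith
    qed
    have "N \<le> 5 / 2 * \<sigma> + (5 / 2 * lam) * \<tau>"
      unfolding \<tau>_def sigma_H_def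
    proof (rule real_le_affine_INF[OF _ _ W])
      show "N \<le> 5 / 2 * \<sigma> + 5 / 2 * lam * wnorm1 {..<m} v (\<lambda>i. e i - e' i)"
        if "e' \<in> {e'. wcard v (supp e' \<inter> {..<m}) \<le> H}" for e'
        using each(1)[of e'] that by (simp add: algebra_simps)
    qed (use lam in simp)
    then show "N \<le> 5 / 2 * (\<sigma> + lam * \<tau>)" by (simp add: algebra_simps)
    have "n2 + g2 \<le> q * (\<sigma> / sqrt K) + (q / sqrt H) * \<tau>"
      unfolding \<tau>_def sigma_H_def
    proof (rule real_le_affine_INF[OF _ _ W])
      show "n2 + g2 \<le> q * (\<sigma> / sqrt K) + q / sqrt H * wnorm1 {..<m} v (\<lambda>i. e i - e' i)"
        if "e' \<in> {e'. wcard v (supp e' \<inter> {..<m}) \<le> H}" for e'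
        using each(2)[of e'] that by (simp add: algebra_simps)
    qed (use q0 H in simp)
    then show "n2 + g2 \<le> q * (\<sigma> / sqrt K + \<tau> / sqrt H)" by (simp add: algebra_simps)
  qed
  have tails: "ennreal (wnorm1 (\<Lambda> - supp z') ?u x) + rest \<le> tail z'" if "z' \<in> Z" for z'
  proof -
    have "supp z' \<subseteq> \<Lambda>" unfolding \<Lambda>_def using that by (intro lower_set_subset_hyp_cross) (auto simp: Z_def)
    then show ?thesis unfolding rest_def tail_def by (rule weighted_tail_split[OF \<Lambda>])
  qed
  obtain C where C: "f \<in> borel_measurable (nu B d)" "AE p in nu B d. cmod (f p) \<le> C" using f by (rule in_LinfE)
  have fh: "fh = expansion B d \<Lambda> xh" by (simp add: fh_def \<Lambda>_def)
  have hx: "h i = xh i - coeffs_of B d f i" if "i \<in> \<Lambda>" for i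
    using that by (simp add: h_def xL_def restrict_to_def x_def)
  have sup: "Linf_norm (nu B d) (\<lambda>p. f p - fh p) \<le> ennreal (wnorm1 \<Lambda> ?u h) + rest"
    unfolding fh rest_def x_def using hx by (intro Linf_norm_diff_expansion_le[OF d \<Lambda> C])
  have gv0: "0 \<le> wnorm1 {..<m} v g" "0 \<le> wnorm1 \<Lambda> ?u h" by (auto intro!: wnorm1_nonneg v0 uweight_nonneg)
  have div1: "y / 1 = y" for y :: ennreal by (simp add: divide_ennreal_def)
  have C13: "3 \<le> C1 \<delta>" using \<delta>(1) delta_lt by (rule C1_ge_3)
  have "Linf_norm (nu B d) (\<lambda>p. f p - fh p) + ennreal (lam * wnorm1 {..<m} v g)
      \<le> ennreal (C1 \<delta>) * (tail z' / ennreal 1 + ennreal (lam * \<tau>)) + 0" if z: "z' \<in> Z" for z'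
  proof -
    define \<sigma> where "\<sigma> = wnorm1 (\<Lambda> - supp z') ?u x"
    have \<sigma>0: "0 \<le> \<sigma>" unfolding \<sigma>_def by (intro wnorm1_nonneg uweight_nonneg)
    have "Linf_norm (nu B d) (\<lambda>p. f p - fh p) + ennreal (lam * wnorm1 {..<m} v g)
      \<le> (ennreal (wnorm1 \<Lambda> ?u h) + rest) + ennreal (lam * wnorm1 {..<m} v g)"
      by (intro add_right_mono sup)
    also have "\<dots> = ennreal N + rest"
      unfolding N_def using gv0 lam by (simp add: ennreal_plus add_ac)
    also have "\<dots> \<le> ennreal (C1 \<delta> * (\<sigma> + lam * \<tau>)) + ennreal (C1 \<delta>) * rest"
    proof (intro add_mono ennreal_leI)
      have "5 / 2 * (\<sigma> + lam * \<tau>) \<le> C1 \<delta> * (\<sigma> + lam * \<tau>)"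
        using C13 \<sigma>0 \<tau>0 lam by (intro mult_right_mono) auto
      then show "N \<le> C1 \<delta> * (\<sigma> + lam * \<tau>)" using bounds(1)[OF z \<sigma>_def] by linarith
      have "ennreal 1 * rest \<le> ennreal (C1 \<delta>) * rest" using C13 by (intro mult_right_mono ennreal_leI) auto
      then show "rest \<le> ennreal (C1 \<delta>) * rest" by simp
    qed
    also have "\<dots> = ennreal (C1 \<delta>) * ((ennreal \<sigma> + rest) + ennreal (lam * \<tau>))"
      using C13 \<sigma>0 \<tau>0 lam by (simp add: ennreal_mult ennreal_plus distrib_left add_ac)
    also have "\<dots> \<le> ennreal (C1 \<delta>) * (tail z' + ennreal (lam * \<tau>))"
      using tails[OF z] unfolding \<sigma>_def by (intro mult_left_mono add_right_mono) auto
    finally show ?thesis by (simp add: div1)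
  qed
  from ennreal_le_affine_INF[of Z _ "C1 \<delta>" tail 1 "ennreal (lam * \<tau>)" 0, OF this]
  show ?claim1 unfolding res sigma \<tau>_def[symmetric] using C13 by (simp add: div1)
  let ?D = "L2_norm (nu B d) (\<lambda>p. f p - expansion B d \<Lambda> x p)"
  have D0: "0 \<le> ?D" by (simp add: L2_norm_def)
  define w where "w = real s powr (gam B / 2)"
  have w0: "0 < w" unfolding w_def using s by simp
  have w2: "w\<^sup>2 \<le> 4 * K" unfolding w_def using sK s by (simp add: power2_eq_square powr_add[symmetric])
  then have wK: "w \<le> 2 * sqrt K"
    by (intro power2_le_imp_le[of w "2 * sqrt K"]) (use K0 in \<open>auto simp: power_mult_distrib\<close>)
  define c where "c = C2 \<delta> * (1 + sqrt (Theta K lam H))"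
  have qc: "2 * q \<le> c" and c0: "0 < c"
  proof -
    have "2 * q \<le> sqrt \<delta> * sqrt (Theta K lam H)" unfolding q_def using \<delta> Theta_ge_1 by simp
    also have "\<dots> \<le> C2 \<delta> * (1 + sqrt (Theta K lam H))"
      using C2_ge[OF \<delta>(1) delta_lt] \<delta> Theta_ge_1 by (intro mult_mono order.trans[OF _ C2_ge[OF \<delta>(1) delta_lt]]) auto
    finally show "2 * q \<le> c" by (simp add: c_def)
    then show "0 < c" using q0 by linarith
  qed
  have L2: "L2_norm (nu B d) (\<lambda>p. f p - fh p) \<le> ?D + n2"
  proof -
    define W where "W = (\<Sum>i\<in>\<Lambda>. cmod (x i) * ?u i)"
    have Eb: "AE p in nu B d. cmod (expansion B d \<Lambda> x p) \<le> W" unfolding W_def by (rule AE_expansion_le[OF \<Lambda>(1)])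
    have "L2_norm (nu B d) (\<lambda>p. (f p - expansion B d \<Lambda> x p) - expansion B d \<Lambda> h p) \<le> ?D + n2"
      unfolding n2_def
    proof (rule L2_norm_diff_expansion_le[OF \<Lambda>])
      show "(\<lambda>p. f p - expansion B d \<Lambda> x p) \<in> borel_measurable (nu B d)" using C(1) by measurable
      show "AE p in nu B d. cmod (f p - expansion B d \<Lambda> x p) \<le> C + W"
        using C(2) Eb
      proof eventually_elim
        case (elim p)
        then show ?case using norm_triangle_ineq4[of "f p" "expansion B d \<Lambda> x p"] by linarith
      qed
      show "coeffs_of B d (\<lambda>p. f p - expansion B d \<Lambda> x p) j = 0" if "j \<in> \<Lambda>" for j
        using coeffs_of_diff[OF C expansion_measurable Eb, of j] coeffs_of_expansion[OF \<Lambda>, of j B x] that \<Lambda>(2)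
        by (auto simp: x_def)
    qed
    moreover have "f p - expansion B d \<Lambda> x p - expansion B d \<Lambda> h p = f p - fh p" for p
    proof -
      have "expansion B d \<Lambda> x p + expansion B d \<Lambda> h p = fh p"
        unfolding fh expansion_def sum.distrib[symmetric]
        by (intro sum.cong refl) (simp add: hx x_def left_diff_distrib)
      then show ?thesis by (simp add: algebra_simps)
    qed
    ultimately show ?thesis by simp
  qed
  have "ennreal (L2_norm (nu B d) (\<lambda>p. f p - fh p) + g2)
      \<le> ennreal c * (tail z' / ennreal w + ennreal (\<tau> / sqrt H)) + ennreal ?D" if z: "z' \<in> Z" for z'
  proof -
    define \<sigma> where "\<sigma> = wnorm1 (\<Lambda> - supp z') ?u x"
    have \<sigma>0: "0 \<le> \<sigma>" unfolding \<sigma>_def by (intro wnorm1_nonneg uweight_nonneg)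
    have "n2 + g2 \<le> q * (\<sigma> / sqrt K + \<tau> / sqrt H)" by (rule bounds(2)[OF z \<sigma>_def])
    also have "\<dots> \<le> q * (2 * (\<sigma> / w) + 2 * (\<tau> / sqrt H))"
    proof (intro mult_left_mono add_mono)
      have "\<sigma> / (2 * sqrt K) \<le> \<sigma> / w" using wK w0 \<sigma>0 K0 by (intro divide_left_mono) auto
      then show "\<sigma> / sqrt K \<le> 2 * (\<sigma> / w)" by simp
      have "0 \<le> \<tau> / sqrt H" using \<tau>0 H by simp
      then show "\<tau> / sqrt H \<le> 2 * (\<tau> / sqrt H)" by linarith
    qed (use q0 in auto)
    also have "\<dots> = 2 * q * (\<sigma> / w + \<tau> / sqrt H)" by (simp add: algebra_simps)
    also have "\<dots> \<le> c * (\<sigma> / w + \<tau> / sqrt H)"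
      using qc \<sigma>0 \<tau>0 w0 H by (intro mult_right_mono) auto
    finally have "L2_norm (nu B d) (\<lambda>p. f p - fh p) + g2 \<le> c * (\<sigma> / w + \<tau> / sqrt H) + ?D"
      using L2 by linarith
    then have "ennreal (L2_norm (nu B d) (\<lambda>p. f p - fh p) + g2) \<le> ennreal (c * (\<sigma> / w + \<tau> / sqrt H) + ?D)"
      by (rule ennreal_leI)
    also have "\<dots> = ennreal c * (ennreal \<sigma> / ennreal w + ennreal (\<tau> / sqrt H)) + ennreal ?D"
      using c0 \<sigma>0 \<tau>0 w0 H D0 by (simp add: ennreal_plus ennreal_mult divide_ennreal)
    also have "\<dots> \<le> ennreal c * (tail z' / ennreal w + ennreal (\<tau> / sqrt H)) + ennreal ?D"
    proof (intro add_right_mono mult_left_mono divide_right_mono_ennreal)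
      have "ennreal \<sigma> \<le> ennreal \<sigma> + rest" by simp
      also have "\<dots> \<le> tail z'" unfolding \<sigma>_def by (rule tails[OF z])
      finally show "ennreal \<sigma> \<le> tail z'" .
    qed auto
    finally show ?thesis .
  qed
  from ennreal_le_affine_INF[of Z _ c tail w "ennreal (\<tau> / sqrt H)" "ennreal ?D", OF this]
  show ?claim2 unfolding res sigma \<tau>_def[symmetric] g2_def[symmetric] w_def[symmetric] c_def[symmetric]
    using c0 w0 by simp
qed

theorem theorem5p25:
  shows "\<exists>c>0. \<forall>(B::poly_basis) (d::nat) (s::nat) (m::nat) (\<epsilon>::real) (lam::real) (H::real)
            (v::nat \<Rightarrow> real) (\<delta>::real).
    let K = Kfun B d s; \<Lambda> = hyp_cross d s; n = card \<Lambda>; \<Theta> = Theta K lam H in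
    1 \<le> d \<longrightarrow> 0 < \<epsilon> \<longrightarrow> \<epsilon> < 1 \<longrightarrow> 2 \<le> s \<longrightarrow> s \<le> 2 ^ (d + 1) \<longrightarrow> 0 < lam \<longrightarrow> 0 < H \<longrightarrow>
    (\<forall>i<m. 1 \<le> v i) \<longrightarrow>
    0 < \<delta> \<longrightarrow> \<delta> < 1 \<longrightarrow> \<delta> \<le> 1 / (1 + 4 * \<Theta>) \<longrightarrow>
    c * real s powr gam B * max (polylog K n \<delta> \<epsilon>) (H / \<delta>\<^sup>2) \<le> real m \<longrightarrow>
    (\<exists>E \<in> sets (\<Pi>\<^sub>M i\<in>{..<m}. nu B d).
       1 - \<epsilon> \<le> measure (\<Pi>\<^sub>M i\<in>{..<m}. nu B d) E \<and>
       (\<forall>t\<in>E. \<forall>f (e::nat \<Rightarrow> complex) xh.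
          let x = coeffs_of B d f;
              A = design B d m t;
              y = (\<lambda>i. mat_apply A \<Lambda> (restrict_to \<Lambda> x) i + e i);
              fh = expansion B d \<Lambda> xh;
              res = (\<lambda>i. e i - (y i - mat_apply A \<Lambda> xh i))
          in
          in_L2 (nu B d) f \<longrightarrow> in_Linf (nu B d) f \<longrightarrow>
          lad_lasso_minimizer B d \<Lambda> m v lam t y xh \<longrightarrow>
            Linf_norm (nu B d) (\<lambda>p. f p - fh p) + ennreal (lam * wnorm1 {..<m} v res)
              \<le> ennreal (C1 \<delta>) * (sigma_L B d s x + ennreal (lam * sigma_H m v H e)) \<and>
            (2 * (MAX i\<in>{..<m}. \<bar>v i\<bar>)\<^sup>2 \<le> H \<longrightarrow>
              ennreal (L2_norm (nu B d) (\<lambda>p. f p - fh p) + L2_set (\<lambda>i. cmod (res i)) {..<m})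
                \<le> ennreal (C2 \<delta> * (1 + sqrt \<Theta>)) *
                    (sigma_L B d s x / ennreal (real s powr (gam B / 2)) +
                     ennreal (sigma_H m v H e / sqrt H)) +
                  ennreal (L2_norm (nu B d) (\<lambda>p. f p - expansion B d \<Lambda> x p)))))"
\<comment> \<open>the constant of \<open>sample_size_bound\<close>; its square root provides the factor \<open>10^6\<close> in the bound on the residual\<close>
proof (intro exI[of _ "10 ^ 12"] conjI allI, goal_cases)
  case (2 B d s m \<epsilon> lam H v \<delta>)
  show ?case
    unfolding Let_def
  proof (intro impI, goal_cases)
    case prems: 1
    define K where "K = Kfun B d s"
    note d = prems(1) and \<epsilon> = prems(2,3) and s = prems(4,5) and lam = prems(6) and H = prems(7)
      and v = prems(8) and dl = prems(9-11) and m = prems(12)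
    have sK: "real s powr gam B \<le> 4 * K" unfolding K_def using s by (intro Kfun_ge) auto
    have "3 \<le> 2 powr gam B" unfolding two_powr_gam by (cases B) auto
    also have "\<dots> \<le> real s powr gam B" using s gam_pos[of B] by (intro powr_mono2) auto
    finally have K34: "3 / 4 \<le> K" using sK by linarith
    interpret balance K H lam \<delta> using K34 H lam dl unfolding K_def by unfold_locales auto
    define M where "M = max (polylog K (card (hyp_cross d s)) \<delta> \<epsilon>) (H / \<delta>\<^sup>2)"
    have M: "polylog K (card (hyp_cross d s)) \<delta> \<epsilon> \<le> M" "H / \<delta>\<^sup>2 \<le> M" by (simp_all add: M_def)
    have HD: "0 < H / \<delta>\<^sup>2" using H dl by simp
    have "K * M \<le> real s powr gam B * M" using Kfun_le[of B d s] M HD unfolding K_def[symmetric] by (intro mult_right_mono) auto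
    then have mM: "10 ^ 12 * K * M \<le> real m" using m unfolding K_def[symmetric] M_def[symmetric] by simp
    have mH: "10 ^ 12 * K * (H / \<delta>\<^sup>2) \<le> real m"
      by (rule order.trans[OF mult_left_mono[OF M(2)] mM]) (use K34 in simp)
    have mP: "10 ^ 12 * K * polylog K (card (hyp_cross d s)) \<delta> \<epsilon> \<le> real m"
      by (rule order.trans[OF mult_left_mono[OF M(1)] mM]) (use K34 in simp)
    have "0 < 10 ^ 12 * K * (H / \<delta>\<^sup>2)" using K34 by (intro mult_pos_pos HD) auto
    then have m0: "0 < m" using mH by (metis less_le_trans of_nat_0_less_iff)
    \<comment> \<open>chosen so that \<open>2 * \<parallel>h\<parallel>\<^sub>1\<^sub>,\<^sub>u / R = \<delta> / 100 * X\<close>\<close>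
    define R where "R = 200 * sqrt K / \<delta>"
    obtain L :: nat where L: "1 \<le> R" "R < 2 ^ L / 2" "2 ^ L \<le> 4 * R"
      "44000 * real L * R\<^sup>2 * (ln (256 * real L * R\<^sup>2) * ln (2 * real (card (hyp_cross d s))) + ln (real L / \<epsilon>)) \<le> real m"
      using sample_size_bound[OF K34 dl(1) delta_Theta(2) \<epsilon> card_hyp_cross_ge_2[OF d s(1)] mP] unfolding R_def by blast
    have "hyp_cross d s \<noteq> {}" using card_hyp_cross_ge_2[OF d s(1)] by auto
    from sampling_isometry[where B = B and d = d, OF finite_hyp_cross this _ L(1,2,3) \<epsilon> L(4) m0]
    obtain E where E: "E \<in> sets (\<Pi>\<^sub>M i\<in>{..<m}. nu B d)" "1 - \<epsilon> \<le> measure (\<Pi>\<^sub>M i\<in>{..<m}. nu B d) E"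
      and bd: "\<And>t l j. t \<in> E \<Longrightarrow> l < m \<Longrightarrow> j \<in> hyp_cross d s \<Longrightarrow> \<bar>rphi B d j (t l)\<bar> \<le> uweight B d j"
      and iso: "\<And>t c. t \<in> E \<Longrightarrow> (\<Sum>j\<in>hyp_cross d s. uweight B d j * \<bar>c j\<bar>) \<le> R * L2_set c (hyp_cross d s) \<Longrightarrow>
         real m / 400 * (L2_set c (hyp_cross d s))\<^sup>2 \<le> (\<Sum>l<m. (\<Sum>j\<in>hyp_cross d s. c j * rphi B d j (t l))\<^sup>2)"
      by (auto simp: hyp_cross_def)
    note rec = recovery_on_event[OF d s lam H _ dl(1,3) m0 mH[unfolded K_def] bd iso[unfolded R_def K_def]]
    show ?case
      by (intro bexI[OF _ E(1)] conjI E(2) ballI allI impI rec) (use v in auto)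
  qed
qed simp

end
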